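(* Let $G$ be an HNN-extension with finite associated subgroups $A_1,A_2$, and let $H,K\subseteq G$ be finitely generated subgroups which intersect trivially all the conjugates in $G$ of the base group of $G$ (and are, therefore, free). Then $$\overline{r}(H\cap K)\leqslant 6m\cdot\overline{r}(H)\,\overline{r}(K),\qquad\text{where } m=\max_{g\in G}|g^{-1}A_1g\cap HK|.$$ In particular, $$\overline{r}(H\cap K)\leqslant 6|A_1|\cdot\overline{r}(H)\,\overline{r}(K).$$
   Context: For a free group $F$, $r(F)$ denotes its rank and $\overline{r}(F)=\max(r(F)-1,0)$ its reduced rank. $HK=\{hk: h\in H,k\in K\}$ (a subset of $G$, not necessarily a subgroup). The base group and its associated (isomorphic) subgroups $A_1,A_2$ are regarded as subgroups of the HNN-extension $G$, in which $A_1$ and $A_2$ are conjugate by the stable letter. *)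

theory Defs
  imports "HOL-Algebra.Generated_Groups" "HOL-Library.Extended_Nat"
begin

section \<open>Free groups and their rank\<close>

text \<open>A group word is a list of pairs \<open>(x, e)\<close>; the pair stands for \<open>x\<close> if \<open>e\<close> holds and for the
  inverse of \<open>x\<close> otherwise.\<close>

definition word_value :: "('a, 'b) monoid_scheme \<Rightarrow> ('a \<times> bool) list \<Rightarrow> 'a" where
  "word_value F w = foldr (\<lambda>(x, e) g. (if e then x else inv\<^bsub>F\<^esub> x) \<otimes>\<^bsub>F\<^esub> g) w \<one>\<^bsub>F\<^esub>"

definition reduced_words :: "'a set \<Rightarrow> ('a \<times> bool) list set" where
  "reduced_words X =
     {w. set w \<subseteq> X \<times> UNIV \<and> successively (\<lambda>p q. \<not> (fst p = fst q \<and> snd p \<noteq> snd q)) w}"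

definition free_basis :: "('a, 'b) monoid_scheme \<Rightarrow> 'a set \<Rightarrow> bool" where
  "free_basis F X \<longleftrightarrow>
     X \<subseteq> carrier F \<and> bij_betw (word_value F) (reduced_words X) (carrier F)"

definition free_group :: "('a, 'b) monoid_scheme \<Rightarrow> bool" where
  "free_group F \<longleftrightarrow> group F \<and> (\<exists>X. free_basis F X)"

definition ecard :: "'a set \<Rightarrow> enat" where
  "ecard X = (if finite X then enat (card X) else \<infinity>)"

text \<open>All free bases of a group have the same cardinality, so the infimum is the cardinality of any
  of them; it is \<open>\<infinity>\<close> if the group is not free or not finitely generated.\<close>

definition free_rank :: "('a, 'b) monoid_scheme \<Rightarrow> enat" where
  "free_rank F = (INF X \<in> {X. free_basis F X}. ecard X)"

text \<open>Subtraction on \<^typ>\<open>enat\<close> is truncated at \<open>0\<close>, and \<open>\<infinity> - 1 = \<infinity>\<close>.\<close>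

definition reduced_rank :: "('a, 'b) monoid_scheme \<Rightarrow> enat" where
  "reduced_rank F = free_rank F - 1"

definition fin_gen_subgroup :: "'a set \<Rightarrow> ('a, 'b) monoid_scheme \<Rightarrow> bool" where
  "fin_gen_subgroup H G \<longleftrightarrow> subgroup H G \<and> (\<exists>S. finite S \<and> S \<subseteq> H \<and> generate G S = H)"


section \<open>HNN-extensions\<close>

datatype 'a hnn_letter = Base 'a | Stable | Stable_inv

definition hnn_words :: "('a, 'b) monoid_scheme \<Rightarrow> 'a hnn_letter list set" where
  "hnn_words B = lists (Base ` carrier B \<union> {Stable, Stable_inv})"

text \<open>The congruence on words presenting \<open>\<langle>B, t | t\<inverse> a t = \<phi> a (a \<in> A)\<rangle>\<close>; the first two
  rules impose the multiplication table of \<open>B\<close>.\<close>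

inductive hnn_cong ::
  "('a, 'b) monoid_scheme \<Rightarrow> 'a set \<Rightarrow> ('a \<Rightarrow> 'a) \<Rightarrow> 'a hnn_letter list \<Rightarrow> 'a hnn_letter list \<Rightarrow> bool"
  for B A \<phi> where
  base_mult: "\<lbrakk>x \<in> carrier B; y \<in> carrier B\<rbrakk> \<Longrightarrow> hnn_cong B A \<phi> [Base x, Base y] [Base (x \<otimes>\<^bsub>B\<^esub> y)]"
| base_one: "hnn_cong B A \<phi> [Base \<one>\<^bsub>B\<^esub>] []"
| stable_right_inv: "hnn_cong B A \<phi> [Stable, Stable_inv] []"
| stable_left_inv: "hnn_cong B A \<phi> [Stable_inv, Stable] []"
| conj: "a \<in> A \<Longrightarrow> hnn_cong B A \<phi> [Stable_inv, Base a, Stable] [Base (\<phi> a)]"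
| refl: "u \<in> hnn_words B \<Longrightarrow> hnn_cong B A \<phi> u u"
| sym: "hnn_cong B A \<phi> u v \<Longrightarrow> hnn_cong B A \<phi> v u"
| trans: "\<lbrakk>hnn_cong B A \<phi> u v; hnn_cong B A \<phi> v w\<rbrakk> \<Longrightarrow> hnn_cong B A \<phi> u w"
| append: "\<lbrakk>hnn_cong B A \<phi> u u'; hnn_cong B A \<phi> v v'\<rbrakk> \<Longrightarrow> hnn_cong B A \<phi> (u @ v) (u' @ v')"

definition hnn_class ::
  "('a, 'b) monoid_scheme \<Rightarrow> 'a set \<Rightarrow> ('a \<Rightarrow> 'a) \<Rightarrow> 'a hnn_letter list \<Rightarrow> 'a hnn_letter list set" where
  "hnn_class B A \<phi> u = {v. hnn_cong B A \<phi> u v}"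

definition hnn_group ::
  "('a, 'b) monoid_scheme \<Rightarrow> 'a set \<Rightarrow> ('a \<Rightarrow> 'a) \<Rightarrow> 'a hnn_letter list set monoid" where
  "hnn_group B A \<phi> =
     \<lparr>carrier = hnn_class B A \<phi> ` hnn_words B,
      mult = (\<lambda>X Y. \<Union>u\<in>X. \<Union>v\<in>Y. hnn_class B A \<phi> (u @ v)),
      one = hnn_class B A \<phi> []\<rparr>"

text \<open>\<open>G\<close> is the HNN-extension of its subgroup \<open>B\<close> with associated subgroups \<open>A\<^sub>1, A\<^sub>2\<close>, isomorphism
  \<open>\<phi>: A\<^sub>1 \<rightarrow> A\<^sub>2\<close> and stable letter \<open>t\<close>: the presented group is isomorphic to \<open>G\<close> via the identity on
  the base group and the letter \<open>Stable\<close> going to \<open>t\<close>.\<close>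

locale hnn_extension = group G for G (structure) +
  fixes B A\<^sub>1 A\<^sub>2 :: "'a set" and \<phi> :: "'a \<Rightarrow> 'a" and t :: 'a
  assumes base_subgroup: "subgroup B G"
    and assoc_subgroups: "subgroup A\<^sub>1 G" "A\<^sub>1 \<subseteq> B" "subgroup A\<^sub>2 G" "A\<^sub>2 \<subseteq> B"
    and assoc_iso: "\<phi> \<in> iso (G\<lparr>carrier := A\<^sub>1\<rparr>) (G\<lparr>carrier := A\<^sub>2\<rparr>)"
    and stable_closed: "t \<in> carrier G"
    and presented: "\<exists>\<psi> \<in> iso (hnn_group (G\<lparr>carrier := B\<rparr>) A\<^sub>1 \<phi>) G.
           (\<forall>b\<in>B. \<psi> (hnn_class (G\<lparr>carrier := B\<rparr>) A\<^sub>1 \<phi> [Base b]) = b) \<and>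
           \<psi> (hnn_class (G\<lparr>carrier := B\<rparr>) A\<^sub>1 \<phi> [Stable]) = t"

definition conjugate_set :: "('a, 'b) monoid_scheme \<Rightarrow> 'a \<Rightarrow> 'a set \<Rightarrow> 'a set" where
  "conjugate_set G g A = (\<lambda>a. inv\<^bsub>G\<^esub> g \<otimes>\<^bsub>G\<^esub> a \<otimes>\<^bsub>G\<^esub> g) ` A"

end

theory Submission
  imports Defs
begin

text \<open>
  Let \<open>T\<close> be the Bass-Serre tree, with vertices \<open>gB\<close> and edges \<open>gA\<^sub>1\<close>. The subgroups \<open>H\<close>, \<open>K\<close> and
  \<open>H \<inter> K\<close> act freely on it, so they are free, and for an invariant subtree with finitely many
  orbits the rank is (edge orbits) - (vertex orbits) + 1; hence twice the reduced rank is the sum of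
  \<open>deg v - 2\<close> over the vertex orbits. Let \<open>T\<^sub>H\<close>, \<open>T\<^sub>K\<close> be invariant subtrees without leaves and with
  finitely many orbits. An \<open>H\<close>-orbit and a \<open>K\<close>-orbit of edges meet in at most \<open>m\<close> orbits of
  \<open>H \<inter> K\<close>, because these are separated by elements of the (conjugate of \<open>A\<^sub>1\<close>) edge stabilizer
  lying in \<open>HK\<close>. So over a pair of vertex orbits of degrees \<open>p\<close>, \<open>q\<close> the degrees \<open>d\<close> in
  \<open>T\<^sub>H \<inter> T\<^sub>K\<close> are at most \<open>min p q\<close> and add up to at most \<open>m p q\<close>, and
  \<open>(d - 2) p q \<le> 3 (p - 2) (q - 2) d\<close> gives the bound.
\<close>

subsection \<open>Free bases\<close>

text \<open>The obstacle is that all tree properties must be extracted from a bare presentation. A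
  tree is therefore encoded by Boolean sides of its edges: acyclicity says that crossing an edge
  changes its own coordinate only, a geodesic is the set of edges on which two vertices disagree,
  and connectedness becomes the existence of a first edge. For the coset graph the sides come from a
  derivation on words, and the same sides, restricted to a subtree, certify that a set of generators
  is a free basis.

  The counting is a weighted average. Multiplying the sum of d - 2 by pq makes the estimate linear
  in d, the bound on the sum of the d then brings back a factor pq, and this factor cancels. The 3
  is the value of q / (q - 2) at q = 3; each of the three sums is twice a reduced rank, so 3 becomes
  3 * 2 * 2 / 2 = 6. Pruning leaves gives p, q >= 2, hence nonnegative factors p - 2 and q - 2. The
  two subtrees may be disjoint, but then \<open>H \<inter> K\<close> fixes an edge of the bridge
  between them and is trivial.\<close>

context group
begin

lemma word_value_Nil [simp]: "word_value G [] = \<one>"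
  by (simp add: word_value_def)

lemma word_value_Cons [simp]:
  "word_value G ((x, b) # w) = (if b then x else inv x) \<otimes> word_value G w"
  by (simp add: word_value_def)

lemma word_value_closed:
  assumes "X \<subseteq> carrier G" "set w \<subseteq> X \<times> UNIV"
  shows "word_value G w \<in> carrier G"
  using assms(2)
proof (induction w)
  case (Cons p w)
  then show ?case using assms(1) by (cases p) auto
qed simp

lemma word_value_append:
  assumes "X \<subseteq> carrier G" "set u \<subseteq> X \<times> UNIV" "set w \<subseteq> X \<times> UNIV"
  shows "word_value G (u @ w) = word_value G u \<otimes> word_value G w"
  using assms(2)
proof (induction u)
  case Nil
  then show ?case using word_value_closed[OF assms(1,3)] by simp
next
  case (Cons p u)
  obtain x b where p: "p = (x, b)" by force
  have "x \<in> carrier G" "word_value G u \<in> carrier G"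
    using Cons.prems assms(1) word_value_closed[OF assms(1)] p by auto
  then show ?case
    using Cons word_value_closed[OF assms(1,3)] p by (simp add: m_assoc)
qed

lemma generate_word_value:
  assumes X: "X \<subseteq> carrier G" and g: "g \<in> generate G X"
  obtains w where "set w \<subseteq> X \<times> UNIV" "word_value G w = g"
proof -
  have "\<exists>w. set w \<subseteq> X \<times> UNIV \<and> word_value G w = g"
    using g
  proof (induction rule: generate.induct)
    case one
    show ?case by (rule exI[of _ "[]"]) simp
  next
    case (incl x)
    then show ?case using X by (intro exI[of _ "[(x, True)]"]) auto
  next
    case (inv x)
    then show ?case using X by (intro exI[of _ "[(x, False)]"]) auto
  next
    case (eng g h)
    then obtain u w where "set u \<subseteq> X \<times> UNIV" "word_value G u = g"
      "set w \<subseteq> X \<times> UNIV" "word_value G w = h" by blast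
    then show ?case
      using word_value_append[OF X] by (intro exI[of _ "u @ w"]) auto
  qed
  then show ?thesis using that by blast
qed

text \<open>Both signs of a generator are counted: only the parity matters, and a cancelling pair
  removes two occurrences.\<close>

definition letter_count :: "'a set \<Rightarrow> ('a \<times> bool) list \<Rightarrow> nat" where
  "letter_count P w = length (filter (\<lambda>p. fst p \<in> P) w)"

text \<open>Reduction proceeds from the right, so a new first letter can cancel only against the
  head of a reduced word. Each cancellation deletes two letters over the same generator, hence the
  parities survive; they later make maps defined on reduced words multiplicative.\<close>

lemma ex_reduced_word:
  assumes X: "X \<subseteq> carrier G" and w: "set w \<subseteq> X \<times> UNIV"
  shows "\<exists>u\<in>reduced_words X. word_value G u = word_value G w \<and>
           (\<forall>P. even (letter_count P u) = even (letter_count P w))"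
  using w
proof (induction w)
  case Nil
  then show ?case by (intro bexI[of _ "[]"]) (auto simp: reduced_words_def)
next
  case (Cons p w)
  obtain x b where p: "p = (x, b)" by force
  have x: "x \<in> X" "x \<in> carrier G" using Cons.prems X p by auto
  obtain u where u: "u \<in> reduced_words X" "word_value G u = word_value G w"
    "\<And>P. even (letter_count P u) = even (letter_count P w)"
    using Cons by auto
  have uX: "set u \<subseteq> X \<times> UNIV" using u(1) by (auto simp: reduced_words_def)
  show ?case
  proof (cases "\<exists>u'. u = (x, \<not> b) # u'")
    case True
    then obtain u' where u': "u = (x, \<not> b) # u'" by blast
    have cl: "word_value G u' \<in> carrier G"
      using word_value_closed[OF X] uX u' by simp
    have "u' \<in> reduced_words X"
      using u(1) u' by (auto simp: reduced_words_def successively_Cons)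
    moreover have "word_value G u' = word_value G (p # w)"
      using u(2)[symmetric] u' p x cl by (cases b) (simp_all add: m_assoc[symmetric])
    moreover have "even (letter_count P u') = even (letter_count P (p # w))" for P
      using u(3)[of P] u' p by (auto simp: letter_count_def)
    ultimately show ?thesis by blast
  next
    case False
    have "p # u \<in> reduced_words X"
      using u(1) uX False p x
      by (cases u) (auto simp: reduced_words_def)
    moreover have "word_value G (p # u) = word_value G (p # w)"
      using u(2) p by simp
    moreover have "even (letter_count P (p # u)) = even (letter_count P (p # w))" for P
      using u(3)[of P] p by (auto simp: letter_count_def)
    ultimately show ?thesis by blast
  qed
qed

text \<open>The homomorphisms to the group of order two, each given by the complement of its kernel;
  counting them shows that the rank is well defined.\<close>

definition parity_sets :: "'a set set" where
  "parity_sets = {Z. Z \<subseteq> carrier G \<and>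
     (\<forall>g\<in>carrier G. \<forall>h\<in>carrier G. g \<otimes> h \<in> Z \<longleftrightarrow> (g \<in> Z) \<noteq> (h \<in> Z))}"

lemma parity_set_word_value:
  assumes X: "X \<subseteq> carrier G" and Z: "Z \<in> parity_sets" and w: "set w \<subseteq> X \<times> UNIV"
  shows "word_value G w \<in> Z \<longleftrightarrow> odd (letter_count (Z \<inter> X) w)"
  using w
proof (induction w)
  case Nil
  have "\<one> \<otimes> \<one> \<in> Z \<longleftrightarrow> (\<one> \<in> Z) \<noteq> (\<one> \<in> Z)" using Z unfolding parity_sets_def by blast
  then show ?case by (simp add: letter_count_def)
next
  case (Cons p w)
  obtain x b where p: "p = (x, b)" by force
  have x: "x \<in> X" "x \<in> carrier G" using Cons.prems X p by auto
  have mult: "g \<otimes> h \<in> Z \<longleftrightarrow> (g \<in> Z) \<noteq> (h \<in> Z)" if "g \<in> carrier G" "h \<in> carrier G" for g h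
    using Z that unfolding parity_sets_def by blast
  have "inv x \<in> Z \<longleftrightarrow> x \<in> Z"
    using mult[of "inv x" x] mult[of \<one> \<one>] x by simp
  moreover have "word_value G w \<in> carrier G" using word_value_closed[OF X] Cons.prems by simp
  ultimately show ?case
    using Cons mult[of x "word_value G w"] mult[of "inv x" "word_value G w"] x p
    by (auto simp: letter_count_def)
qed

text \<open>The universal property of a free basis, tested on the group of order two: the values on
  \<open>X\<close> determine a homomorphism and may be prescribed at will. For finite
  \<open>X\<close> this counts the homomorphisms, whose number does not depend on the basis, as 2 to
  the power |X|.\<close>

lemma free_basis_parity_sets:
  assumes "free_basis G X"
  shows "bij_betw (\<lambda>Z. Z \<inter> X) parity_sets (Pow X)"
proof -
  have X: "X \<subseteq> carrier G" and bij: "bij_betw (word_value G) (reduced_words X) (carrier G)"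
    using assms by (auto simp: free_basis_def)
  have surj: "\<exists>w\<in>reduced_words X. word_value G w = g" if "g \<in> carrier G" for g
  proof -
    have "g \<in> word_value G ` reduced_words X" using bij that by (simp add: bij_betw_def)
    then show ?thesis by auto
  qed
  have wordX: "set w \<subseteq> X \<times> UNIV" if "w \<in> reduced_words X" for w
    using that by (simp add: reduced_words_def)
  have "inj_on (\<lambda>Z. Z \<inter> X) parity_sets"
  proof (rule inj_onI)
    fix Z Z' assume Z: "Z \<in> parity_sets" "Z' \<in> parity_sets" "Z \<inter> X = Z' \<inter> X"
    have "g \<in> Z \<longleftrightarrow> g \<in> Z'" if g: "g \<in> carrier G" for g
    proof -
      obtain w where "w \<in> reduced_words X" "word_value G w = g"
        using surj[OF g] by blast
      then show ?thesis
        using parity_set_word_value[OF X Z(1) wordX] parity_set_word_value[OF X Z(2) wordX] Z(3)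
        by auto
    qed
    then show "Z = Z'" using Z(1,2) unfolding parity_sets_def by blast
  qed
  moreover have "\<exists>Z\<in>parity_sets. Z \<inter> X = P" if P: "P \<subseteq> X" for P
  proof -
    \<comment> \<open>The homomorphism that is nontrivial on exactly the generators in
      \<open>P\<close> counts letters from \<open>P\<close> modulo two. By
      \<open>ex_reduced_word\<close> this parity can be read off any word, reduced or not.\<close>
    define Z where "Z = word_value G ` {w \<in> reduced_words X. odd (letter_count P w)}"
    have Z: "word_value G w \<in> Z \<longleftrightarrow> odd (letter_count P w)" if w: "set w \<subseteq> X \<times> UNIV" for w
    proof -
      obtain u where u: "u \<in> reduced_words X" "word_value G u = word_value G w"
        "even (letter_count P u) = even (letter_count P w)"
        using ex_reduced_word[OF X w] by blast
      have "word_value G u \<in> Z \<longleftrightarrow> odd (letter_count P u)"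
        using u(1) bij_betw_imp_inj_on[OF bij] by (auto simp: Z_def inj_on_def)
      then show ?thesis using u by simp
    qed
    have "Z \<in> parity_sets"
      unfolding parity_sets_def
    proof (intro CollectI conjI ballI)
      show "Z \<subseteq> carrier G" unfolding Z_def using word_value_closed[OF X wordX] by auto
      fix g h assume gh: "g \<in> carrier G" "h \<in> carrier G"
      then obtain u w where "u \<in> reduced_words X" "word_value G u = g"
        "w \<in> reduced_words X" "word_value G w = h"
        using surj[OF gh(1)] surj[OF gh(2)] by blast
      then show "g \<otimes> h \<in> Z \<longleftrightarrow> (g \<in> Z) \<noteq> (h \<in> Z)"
        using Z[of u] Z[of w] Z[of "u @ w"] word_value_append[OF X wordX wordX] wordX
        by (auto simp: letter_count_def)
    qed
    moreover have "x \<in> Z \<longleftrightarrow> x \<in> P" if "x \<in> X" for x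
      using Z[of "[(x, True)]"] that X by (auto simp: letter_count_def split: if_splits)
    then have "Z \<inter> X = P" using P by blast
    ultimately show ?thesis by blast
  qed
  ultimately show ?thesis unfolding bij_betw_def by blast
qed

lemma free_basis_card_unique:
  assumes "free_basis G X" "free_basis G Y" "finite X"
  shows "finite Y \<and> card Y = card X"
proof -
  have b: "bij_betw (\<lambda>Z. Z \<inter> X) parity_sets (Pow X)" "bij_betw (\<lambda>Z. Z \<inter> Y) parity_sets (Pow Y)"
    using assms(1,2) free_basis_parity_sets by auto
  have "finite (Pow Y)" using b assms(3) bij_betw_finite by (metis finite_Pow_iff)
  moreover have "card (Pow Y) = card (Pow X)" using b bij_betw_same_card by metis
  ultimately show ?thesis using assms(3) by (simp add: card_Pow)
qed

lemma free_rank_eq: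
  assumes "free_basis G X" "finite X"
  shows "free_rank G = enat (card X)"
proof -
  have "ecard Y = enat (card X)" if "free_basis G Y" for Y
    using free_basis_card_unique[OF assms(1) that assms(2)] by (simp add: ecard_def)
  then have "(ecard ` {Y. free_basis G Y}) = {enat (card X)}" using assms(1) by force
  then show ?thesis by (simp add: free_rank_def)
qed

lemma reduced_rank_eq:
  assumes "free_basis G X" "finite X"
  shows "reduced_rank G = enat (card X - 1)"
  using free_rank_eq[OF assms] by (simp add: reduced_rank_def one_enat_def)

end

subsection \<open>A tree criterion for free bases\<close>

fun walk :: "('v \<Rightarrow> 'e \<Rightarrow> 'v \<Rightarrow> bool) \<Rightarrow> 'v \<Rightarrow> 'e list \<Rightarrow> 'v \<Rightarrow> bool" where
  "walk st v [] z \<longleftrightarrow> v = z"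
| "walk st v (e # es) z \<longleftrightarrow> (\<exists>u. st v e u \<and> walk st u es z)"

lemma walk_append: "walk st v (es @ fs) z \<longleftrightarrow> (\<exists>u. walk st v es u \<and> walk st u fs z)"
  by (induction es arbitrary: v) auto

lemma walk_rev:
  assumes "\<And>v e u. st v e u \<Longrightarrow> st u e v" "walk st v es z"
  shows "walk st z (rev es) v"
  using assms(2)
proof (induction es arbitrary: v)
  case (Cons e es)
  then show ?case using assms(1) by (fastforce simp: walk_append)
qed simp

text \<open>Each step flips the potential in the coordinate of its own edge and nowhere else, and
  without repeated edges no flip is undone.\<close>

lemma walk_separates:
  assumes "\<And>v e u f. st v e u \<Longrightarrow> (\<delta> v f \<noteq> \<delta> u f) = (f = e)" "walk st v es z" "distinct es"
  shows "(\<delta> v f \<noteq> \<delta> z f) = (f \<in> set es)"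
  using assms(2,3)
proof (induction es arbitrary: v)
  case (Cons e es)
  then obtain u where u: "st v e u" "walk st u es z" by auto
  have "(\<delta> u f \<noteq> \<delta> z f) = (f \<in> set es)" using Cons u by simp
  then show ?case using assms(1)[OF u(1), of f] Cons.prems(2) by auto
qed simp

lemma walk_crosses:
  assumes "\<And>v e u f. st v e u \<Longrightarrow> (\<delta> v f \<noteq> \<delta> u f) = (f = e)" "walk st v es z" "\<delta> v f \<noteq> \<delta> z f"
  shows "f \<in> set es"
  using assms(2,3)
proof (induction es arbitrary: v)
  case (Cons e es)
  then obtain u where u: "st v e u" "walk st u es z" by auto
  then show ?case using Cons.IH[OF u(2)] Cons.prems(2) assms(1)[OF u(1), of f] by auto
qed simp

text \<open>A shortest walk never returns to its first edge: \<open>v\<close> is an endpoint of that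
  edge, so the walk could start with the second passage or just after it. An edge crossed once
  separates the ends.\<close>

lemma walk_first_edge:
  assumes st: "\<And>v e u f. st v e u \<Longrightarrow> (\<delta> v f \<noteq> \<delta> u f) = (f = e)"
    and ends: "\<And>v e u v' u'. st v e u \<Longrightarrow> st v' e u' \<Longrightarrow> v = v' \<or> v = u'"
    and walk: "walk st v es w" and ne: "v \<noteq> w"
  shows "\<exists>e u. st v e u \<and> \<delta> v e \<noteq> \<delta> w e"
proof -
  obtain ds where ds: "walk st v ds w" "\<And>fs. walk st v fs w \<Longrightarrow> length ds \<le> length fs"
    using ex_has_least_nat[of "\<lambda>es. walk st v es w" es length] walk by blast
  obtain e ds' where e: "ds = e # ds'" using ds(1) ne by (cases ds) auto
  then obtain u where u: "st v e u" "walk st u ds' w" using ds(1) by auto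
  have "\<delta> v e \<noteq> \<delta> w e"
  proof
    assume "\<delta> v e = \<delta> w e"
    then have "\<delta> u e \<noteq> \<delta> w e" using st[OF u(1), of e] by auto
    then have "e \<in> set ds'" using walk_crosses[where st = st and \<delta> = \<delta>, OF st u(2)] by blast
    then obtain as bs where s: "ds' = as @ e # bs" using split_list by metis
    then obtain x y where x: "walk st u as x" "st x e y" "walk st y bs w"
      using u(2) by (auto simp: walk_append)
    have "v = x \<or> v = y" using ends[OF u(1) x(2)] .
    then have "walk st v (e # bs) w \<or> walk st v bs w" using x by auto
    then show False using ds(2)[of "e # bs"] ds(2)[of bs] e s by auto
  qed
  then show ?thesis using u(1) by blast
qed

text \<open>Consider the first return to an edge \<open>e\<close> from \<open>v\<close> to
  \<open>u\<close>. The stretch in between leads from \<open>u\<close> to an endpoint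
  \<open>x\<close> of \<open>e\<close>; it is nonempty with distinct edges other than
  \<open>e\<close>, so \<open>x\<close> differs from \<open>u\<close> in one of their coordinates
  and from \<open>v\<close> in the coordinate \<open>e\<close>. But \<open>e\<close> has no third
  endpoint.\<close>

lemma walk_distinct:
  assumes st: "\<And>v e u f. st v e u \<Longrightarrow> (\<delta> v f \<noteq> \<delta> u f) = (f = e)"
    and ends: "\<And>v e u v' u'. st v e u \<Longrightarrow> st v' e u' \<Longrightarrow> v' = v \<or> v' = u"
    and "walk st v es z" "successively (\<noteq>) es"
  shows "distinct es"
  using assms(3,4)
proof (induction es arbitrary: v)
  case (Cons e es)
  then obtain u where u: "st v e u" "walk st u es z" by auto
  have dist: "distinct es" using Cons u by (auto simp: successively_Cons)
  have "e \<notin> set es"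
  proof
    assume "e \<in> set es"
    then obtain as bs where es: "es = as @ e # bs" "e \<notin> set as" using split_list_first by metis
    have as: "as \<noteq> []" using Cons.prems(2) es by auto
    obtain x where x: "walk st u as x" "walk st x (e # bs) z"
      using u(2) es(1) by (auto simp: walk_append)
    obtain y where "st x e y" using x(2) by auto
    then have "x = v \<or> x = u" using ends u(1) by blast
    moreover have *: "(\<delta> u f \<noteq> \<delta> x f) = (f \<in> set as)" for f
      using walk_separates[where st = st and \<delta> = \<delta>, OF st x(1)] dist es by auto
    then have "x \<noteq> u" using as by (metis last_in_set)
    moreover have "\<delta> v e \<noteq> \<delta> x e" using *[of e] st[OF u(1), of e] es(2) by auto
    ultimately show False by blast
  qed
  then show ?case using dist by simp
qed simp

text \<open>\<open>\<epsilon> g x\<close> is the edge from \<open>g\<close> to \<open>g x\<close> of the Cayley graph and \<open>\<delta>\<close> is a potential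
  showing that the graph has no cycle; equivalently \<open>\<delta>\<close> collects the Fox derivatives modulo two.\<close>

lemma (in group) free_basis_if_potential:
  fixes \<delta> :: "'a \<Rightarrow> 'e \<Rightarrow> bool" and \<epsilon> :: "'a \<Rightarrow> 'a \<Rightarrow> 'e"
  assumes X: "X \<subseteq> carrier G" and gen: "carrier G \<subseteq> generate G X"
    and inj: "\<And>g h x y. \<lbrakk>g \<in> carrier G; h \<in> carrier G; x \<in> X; y \<in> X; \<epsilon> g x = \<epsilon> h y\<rbrakk> \<Longrightarrow> g = h \<and> x = y"
    and cross: "\<And>g x e. \<lbrakk>g \<in> carrier G; x \<in> X\<rbrakk> \<Longrightarrow> (\<delta> g e \<noteq> \<delta> (g \<otimes> x) e) = (e = \<epsilon> g x)"
  shows "free_basis G X"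
proof -
  define st where "st v e u \<longleftrightarrow> (\<exists>g\<in>carrier G. \<exists>x\<in>X. e = \<epsilon> g x \<and>
      ((v = g \<and> u = g \<otimes> x) \<or> (v = g \<otimes> x \<and> u = g)))" for v e u
  have st_sym: "st u e v" if "st v e u" for v e u using that unfolding st_def by blast
  have st_cross: "(\<delta> v f \<noteq> \<delta> u f) = (f = e)" if "st v e u" for v e u f
    using that cross unfolding st_def by metis
  have st_ends: "v' = v \<or> v' = u" if "st v e u" "st v' e u'" for v e u v' u'
    using that inj unfolding st_def by metis
  define letter where "letter p = (if snd p then fst p else inv (fst p))" for p :: "'a \<times> bool"
  \<comment> \<open>An inverse letter runs along its edge backwards, so the edge is named by its
    origin \<open>g \<otimes> inv x\<close>.\<close>
  define edge where "edge g p = (if snd p then \<epsilon> g (fst p) else \<epsilon> (g \<otimes> inv (fst p)) (fst p))"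
    for g and p :: "'a \<times> bool"
  have x_ne: "x \<noteq> \<one>" if "x \<in> X" for x
    using cross[OF one_closed that, of "\<epsilon> \<one> x"] by auto
  have letter_cl: "letter p \<in> carrier G" if "fst p \<in> X" for p
    using that X by (auto simp: letter_def)
  have st_edge: "st g (edge g p) (g \<otimes> letter p)" if "g \<in> carrier G" "fst p \<in> X" for g p
  proof -
    have x: "fst p \<in> carrier G" using that X by blast
    have "g \<otimes> inv (fst p) \<otimes> fst p = g" using x that by (simp add: m_assoc)
    then show ?thesis
      unfolding st_def edge_def letter_def using x that by (cases "snd p") force+
  qed
  have edge_inj: "p = q" if "g \<in> carrier G" "fst p \<in> X" "fst q \<in> X" "edge g p = edge g q" for g p q
  proof -
    have x: "fst p \<in> carrier G" "fst q \<in> carrier G" using that X by blast+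
    have "inv x \<noteq> \<one>" if "x \<in> X" for x using x_ne[OF that] X that by (metis inv_one inv_inv subsetD)
    then have ne: "g \<otimes> inv x \<noteq> g" if "x \<in> X" for x
      using that l_cancel_one[of g "inv x"] subsetD[OF X] \<open>g \<in> carrier G\<close> by simp
    have cl: "g \<otimes> inv (fst p) \<in> carrier G" "g \<otimes> inv (fst q) \<in> carrier G"
      using x that(1) by auto
    show ?thesis
    proof (cases "snd p = snd q")
      case True
      have "fst p = fst q"
        using that(4) True inj[OF that(1,1,2,3)] inj[OF cl that(2,3)]
        by (auto simp: edge_def split: if_splits)
      then show ?thesis using True by (simp add: prod_eq_iff)
    next
      case False
      then have "\<epsilon> g (fst p) = \<epsilon> (g \<otimes> inv (fst q)) (fst q)
          \<or> \<epsilon> (g \<otimes> inv (fst p)) (fst p) = \<epsilon> g (fst q)"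
        using that(4) by (auto simp: edge_def split: if_splits)
      then have "g = g \<otimes> inv (fst q) \<or> g \<otimes> inv (fst p) = g"
        using inj[OF that(1) cl(2) that(2,3)] inj[OF cl(1) that(1,2,3)] by blast
      then show ?thesis using ne[OF that(2)] ne[OF that(3)] by simp
    qed
  qed
  \<comment> \<open>At the new vertex, the only letter leading back over the edge just crossed is
    the inverse of \<open>p\<close>. Hence reduced words spell walks without backtracking.\<close>
  have no_back: "edge g p \<noteq> edge (g \<otimes> letter p) q"
    if "g \<in> carrier G" "fst p \<in> X" "fst q \<in> X" "\<not> (fst p = fst q \<and> snd p \<noteq> snd q)" for g p q
  proof -
    have x: "fst p \<in> carrier G" using that X by blast
    define p' where "p' = (fst p, \<not> snd p)"
    have "edge (g \<otimes> letter p) p' = edge g p"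
      unfolding edge_def p'_def letter_def using that(1) x by (simp add: m_assoc)
    moreover have "q \<noteq> p'" using that(4) unfolding p'_def by auto
    moreover have "g \<otimes> letter p \<in> carrier G" using that letter_cl by simp
    ultimately show ?thesis using edge_inj[of "g \<otimes> letter p" p' q] that by (auto simp: p'_def)
  qed
  \<comment> \<open>The recursion returns a function of the current vertex, which moves along with
    the word.\<close>
  define path where "path = (\<lambda>w. rec_list (\<lambda>g. []) (\<lambda>p w r g. edge g p # r (g \<otimes> letter p)) w)"
  have path_simps: "path [] g = []" "path (p # w) g = edge g p # path w (g \<otimes> letter p)" for p w g
    by (simp_all add: path_def)
  have val: "word_value G (p # w) = letter p \<otimes> word_value G w" for p w
    by (cases p) (simp add: letter_def)
  have walk_path: "walk st g (path w g) (g \<otimes> word_value G w)"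
    if "g \<in> carrier G" "set w \<subseteq> X \<times> UNIV" for g w
    using that
  proof (induction w arbitrary: g)
    case (Cons p w)
    have p: "fst p \<in> X" "set w \<subseteq> X \<times> UNIV" using Cons.prems by auto
    have "walk st (g \<otimes> letter p) (path w (g \<otimes> letter p)) (g \<otimes> letter p \<otimes> word_value G w)"
      using Cons letter_cl p by simp
    moreover have "g \<otimes> letter p \<otimes> word_value G w = g \<otimes> word_value G (p # w)"
      using Cons.prems p letter_cl word_value_closed[OF X p(2)] by (simp only: val m_assoc)
    ultimately show ?case using st_edge[OF Cons.prems(1) p(1)] by (auto simp: path_simps)
  qed (simp add: path_simps)
  have path_succ: "successively (\<noteq>) (path w g)"
    if "g \<in> carrier G" "w \<in> reduced_words X" for g w
    using that
  proof (induction w arbitrary: g)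
    case (Cons p w)
    have p: "fst p \<in> X" "w \<in> reduced_words X"
      using Cons.prems by (auto simp: reduced_words_def successively_Cons)
    have *: "successively (\<noteq>) (path w (g \<otimes> letter p))" using Cons p letter_cl by simp
    show ?case
    proof (cases w)
      case (Cons q w')
      have "fst q \<in> X" "\<not> (fst p = fst q \<and> snd p \<noteq> snd q)"
        using Cons.prems Cons by (auto simp: reduced_words_def)
      then show ?thesis using no_back[OF Cons.prems(1) p(1)] * Cons by (auto simp: path_simps)
    qed (simp add: path_simps)
  qed (simp add: path_simps)
  have red_tl: "w \<in> reduced_words X" if "p # w \<in> reduced_words X" for p w
    using that by (auto simp: reduced_words_def successively_Cons)
  have wordX: "set w \<subseteq> X \<times> UNIV" if "w \<in> reduced_words X" for w
    using that by (simp add: reduced_words_def)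
  \<comment> \<open>If two reduced words with the same value begin differently, going back along one
    and out along the other is a closed walk without backtracking. Its edges are then distinct, so
    the potential would change on each of them although the two ends agree; the walk has no
    edges.\<close>
  have no_fork: "(u = [] \<and> w = []) \<or> (u \<noteq> [] \<and> w \<noteq> [] \<and> hd u = hd w)"
    if uw: "u \<in> reduced_words X" "w \<in> reduced_words X" "word_value G u = word_value G w" for u w
  proof (rule ccontr)
    assume neg: "\<not> ?thesis"
    let ?es = "rev (path u \<one>) @ path w \<one>"
    let ?z = "\<one> \<otimes> word_value G u"
    have "walk st ?z ?es ?z"
      using walk_path[OF one_closed wordX[OF uw(1)]] walk_path[OF one_closed wordX[OF uw(2)]] uw(3)
        walk_rev[where st = st, OF st_sym] by (auto simp: walk_append)
    moreover have "successively (\<noteq>) ?es"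
    proof -
      have "hd (path u \<one>) \<noteq> hd (path w \<one>)" if "u \<noteq> []" "w \<noteq> []"
      proof -
        obtain p u' q w' where e: "u = p # u'" "w = q # w'" using \<open>u \<noteq> []\<close> \<open>w \<noteq> []\<close> neq_Nil_conv by metis
        then have "fst p \<in> X" "fst q \<in> X" "p \<noteq> q" using wordX[OF uw(1)] wordX[OF uw(2)] neg by auto
        then show ?thesis using edge_inj[of \<one> p q] e by (auto simp: path_simps)
      qed
      moreover have "path w g = [] \<longleftrightarrow> w = []" for w g by (cases w) (auto simp: path_simps)
      moreover have "successively (\<noteq>) (rev (path u \<one>))"
        using path_succ[OF one_closed uw(1)] by (simp add: successively_rev eq_commute)
      ultimately show ?thesis
        using path_succ[OF one_closed uw(2)] by (auto simp: successively_append_iff last_rev)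
    qed
    ultimately have "distinct ?es"
      by (rule walk_distinct[where st = st and \<delta> = \<delta>, rotated 2])
        (erule st_cross, erule (1) st_ends)
    then have no: "f \<notin> set ?es" for f
      using walk_separates[where st = st and \<delta> = \<delta>, OF st_cross \<open>walk st ?z ?es ?z\<close>, of f] by auto
    have "set ?es = {}"
    proof (rule equals0I)
      fix f assume "f \<in> set ?es"
      with no show False by (rule notE)
    qed
    then have "path u \<one> = []" "path w \<one> = []" by auto
    then show False using neg by (cases u; cases w) (auto simp: path_simps)
  qed
  have "u = w" if "u \<in> reduced_words X" "w \<in> reduced_words X" "word_value G u = word_value G w" for u w
    using that
  proof (induction u arbitrary: w)
    case Nil
    then show ?case using no_fork[of "[]" w] by simp
  next
    case (Cons p u)
    obtain w' where w': "w = p # w'" using no_fork[of "p # u" w] Cons.prems by (cases w) auto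
    have r: "u \<in> reduced_words X" "w' \<in> reduced_words X" using Cons.prems w' red_tl by blast+
    have "fst p \<in> X" using wordX[OF Cons.prems(1)] by auto
    then have "word_value G u = word_value G w'"
      using Cons.prems(3) w' letter_cl word_value_closed[OF X wordX] r by (simp only: val) auto
    then show ?case using Cons.IH r w' by simp
  qed
  then have "inj_on (word_value G) (reduced_words X)" by (rule inj_onI)
  moreover have "g \<in> word_value G ` reduced_words X" if "g \<in> carrier G" for g
  proof -
    have "g \<in> generate G X" using gen that by blast
    then obtain w where w: "set w \<subseteq> X \<times> UNIV" "word_value G w = g"
      using generate_word_value[OF X] by blast
    then show ?thesis using ex_reduced_word[OF X w(1)] by (metis imageI)
  qed
  ultimately show ?thesis
    using X word_value_closed[OF X wordX] unfolding free_basis_def bij_betw_def by blast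
qed

subsection \<open>Free actions\<close>

definition orb :: "('a, 'b) monoid_scheme \<Rightarrow> ('a \<Rightarrow> 'x \<Rightarrow> 'x) \<Rightarrow> 'x \<Rightarrow> 'x set" where
  "orb G act x = (\<lambda>g. act g x) ` carrier G"

definition orbs :: "('a, 'b) monoid_scheme \<Rightarrow> ('a \<Rightarrow> 'x \<Rightarrow> 'x) \<Rightarrow> 'x set \<Rightarrow> 'x set set" where
  "orbs G act X = orb G act ` X"

definition rep :: "'x set \<Rightarrow> 'x" where
  "rep A = (SOME x. x \<in> A)"

locale free_act = group G for G (structure) +
  fixes act :: "'a \<Rightarrow> 'x \<Rightarrow> 'x" and X :: "'x set"
  assumes act_closed: "\<lbrakk>g \<in> carrier G; x \<in> X\<rbrakk> \<Longrightarrow> act g x \<in> X"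
    and act_one: "x \<in> X \<Longrightarrow> act \<one> x = x"
    and act_mult: "\<lbrakk>g \<in> carrier G; h \<in> carrier G; x \<in> X\<rbrakk> \<Longrightarrow> act (g \<otimes> h) x = act g (act h x)"
    and act_free: "\<lbrakk>g \<in> carrier G; x \<in> X; act g x = x\<rbrakk> \<Longrightarrow> g = \<one>"
begin

lemma act_inv: "\<lbrakk>g \<in> carrier G; x \<in> X\<rbrakk> \<Longrightarrow> act (inv g) (act g x) = x"
  by (simp add: act_mult[symmetric] act_one)

lemma act_inv': "\<lbrakk>g \<in> carrier G; x \<in> X\<rbrakk> \<Longrightarrow> act g (act (inv g) x) = x"
  by (simp add: act_mult[symmetric] act_one)

lemma act_inj:
  assumes "g \<in> carrier G" "h \<in> carrier G" "x \<in> X" "act g x = act h x"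
  shows "g = h"
proof -
  have "act (inv g \<otimes> h) x = x" using assms act_inv[OF assms(1,3)] by (simp add: act_mult)
  then have "inv g \<otimes> h = \<one>" using act_free assms by simp
  then show ?thesis using assms(1,2) by (metis inv_closed inv_equality inv_inv)
qed

lemma act_inj2:
  assumes "g \<in> carrier G" "x \<in> X" "y \<in> X" "act g x = act g y"
  shows "x = y"
  using assms act_inv by metis

lemma orb_self: "x \<in> X \<Longrightarrow> x \<in> orb G act x"
  unfolding orb_def using act_one by (metis imageI one_closed)

lemma orb_act: "\<lbrakk>g \<in> carrier G; x \<in> X\<rbrakk> \<Longrightarrow> orb G act (act g x) = orb G act x"
proof -
  assume g: "g \<in> carrier G" "x \<in> X"
  have "act h (act g x) \<in> orb G act x" if "h \<in> carrier G" for h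
    unfolding orb_def using that g act_mult[of h g x] by (metis imageI m_closed)
  moreover have "act h x \<in> orb G act (act g x)" if h: "h \<in> carrier G" for h
  proof -
    have "act h x = act (h \<otimes> inv g) (act g x)"
      using h g by (simp add: act_mult[symmetric] m_assoc)
    then show ?thesis unfolding orb_def using h g by auto
  qed
  ultimately show ?thesis by (auto simp: orb_def)
qed

lemma orb_eqD: "\<lbrakk>x \<in> X; y \<in> X; orb G act x = orb G act y\<rbrakk> \<Longrightarrow> \<exists>g\<in>carrier G. y = act g x"
  using orb_self[of y] by (auto simp: orb_def)

lemma orb_subset: "x \<in> X \<Longrightarrow> orb G act x \<subseteq> X"
  using act_closed by (auto simp: orb_def)

lemma orbs_memD: "\<lbrakk>A \<in> orbs G act X; x \<in> A\<rbrakk> \<Longrightarrow> x \<in> X \<and> orb G act x = A"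
proof -
  assume *: "A \<in> orbs G act X" "x \<in> A"
  then obtain y where y: "y \<in> X" "A = orb G act y" by (auto simp: orbs_def)
  then obtain g where "g \<in> carrier G" "x = act g y" using * by (auto simp: orb_def)
  then show ?thesis using y act_closed orb_act by simp
qed

lemma rep_in: "A \<in> orbs G act X \<Longrightarrow> rep A \<in> A"
proof -
  assume "A \<in> orbs G act X"
  then obtain x where "x \<in> A" using orb_self by (auto simp: orbs_def)
  then show ?thesis unfolding rep_def by (rule someI)
qed

lemma rep_orb:
  assumes "A \<in> orbs G act X" shows "rep A \<in> X" "orb G act (rep A) = A"
  using orbs_memD[OF assms rep_in[OF assms]] by auto

lemma free_act_subset:
  assumes "Y \<subseteq> X" "\<And>g y. \<lbrakk>g \<in> carrier G; y \<in> Y\<rbrakk> \<Longrightarrow> act g y \<in> Y"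
  shows "free_act G act Y"
proof
  fix g h x assume "x \<in> Y"
  then have x: "x \<in> X" using assms(1) by blast
  show "act \<one> x = x" using x by (rule act_one)
  assume g: "g \<in> carrier G"
  show "act g x \<in> Y" using g \<open>x \<in> Y\<close> by (rule assms(2))
  show "act g x = x \<Longrightarrow> g = \<one>" using g x by (rule act_free)
  assume "h \<in> carrier G"
  then show "act (g \<otimes> h) x = act g (act h x)" using g x by (simp add: act_mult)
qed

text \<open>Choose a value at one representative of each orbit and transport it. Freeness makes the
  transporting element \<open>c x\<close> unique, hence
  \<open>c (act g x) = g \<otimes> c x\<close>.\<close>

lemma ex_equivariant:
  fixes act' :: "'a \<Rightarrow> 'y \<Rightarrow> 'y"
  assumes ex: "\<And>x. x \<in> X \<Longrightarrow> \<exists>y\<in>Y. Q x y"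
    and Q: "\<And>g x y. \<lbrakk>g \<in> carrier G; x \<in> X; y \<in> Y; Q x y\<rbrakk> \<Longrightarrow> Q (act g x) (act' g y)"
    and closed: "\<And>g y. \<lbrakk>g \<in> carrier G; y \<in> Y\<rbrakk> \<Longrightarrow> act' g y \<in> Y"
    and mult: "\<And>g h y. \<lbrakk>g \<in> carrier G; h \<in> carrier G; y \<in> Y\<rbrakk> \<Longrightarrow> act' (g \<otimes> h) y = act' g (act' h y)"
  shows "\<exists>f. \<forall>x\<in>X. f x \<in> Y \<and> Q x (f x) \<and> (\<forall>g\<in>carrier G. f (act g x) = act' g (f x))"
proof -
  obtain f0 where f0: "\<And>x. x \<in> X \<Longrightarrow> f0 x \<in> Y \<and> Q x (f0 x)" using ex by metis
  define r where "r x = rep (orb G act x)" for x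
  have r: "r x \<in> X" "\<exists>g\<in>carrier G. x = act g (r x)" if "x \<in> X" for x
  proof -
    have "orb G act x \<in> orbs G act X" using that by (simp add: orbs_def)
    then show "r x \<in> X" "\<exists>g\<in>carrier G. x = act g (r x)"
      using rep_orb orb_eqD[of "r x" x] that unfolding r_def by auto
  qed
  define c where "c x = (SOME g. g \<in> carrier G \<and> x = act g (r x))" for x
  have c: "c x \<in> carrier G" "x = act (c x) (r x)" if "x \<in> X" for x
    using someI_ex[of "\<lambda>g. g \<in> carrier G \<and> x = act g (r x)"] r[OF that] unfolding c_def by auto
  have c_act: "c (act g x) = g \<otimes> c x" if "g \<in> carrier G" "x \<in> X" for g x
  proof -
    have "r (act g x) = r x" using orb_act that by (simp add: r_def)
    then have "act (c (act g x)) (r x) = act (g \<otimes> c x) (r x)"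
      using that c[of "act g x"] c[of x] act_mult[of g "c x" "r x"] r act_closed by metis
    then show ?thesis using act_inj r c act_closed that by (metis m_closed)
  qed
  define f where "f x = act' (c x) (f0 (r x))" for x
  have "f x \<in> Y" "Q x (f x)" if "x \<in> X" for x
    using that f0 r c closed Q[of "c x" "r x" "f0 (r x)"] unfolding f_def by auto
  moreover have "f (act g x) = act' g (f x)" if "g \<in> carrier G" "x \<in> X" for g x
    unfolding f_def using c_act[OF that] orb_act[OF that] mult that c f0 r by (simp add: r_def)
  ultimately show ?thesis by blast
qed

end

locale equivariant_map = X: free_act G act X + Y: free_act G act' Y
  for G (structure) and act :: "'a \<Rightarrow> 'x \<Rightarrow> 'x" and X and act' :: "'a \<Rightarrow> 'y \<Rightarrow> 'y" and Y +
  fixes \<pi> :: "'x \<Rightarrow> 'y"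
  assumes map_closed: "x \<in> X \<Longrightarrow> \<pi> x \<in> Y"
    and map_act: "\<lbrakk>g \<in> carrier G; x \<in> X\<rbrakk> \<Longrightarrow> \<pi> (act g x) = act' g (\<pi> x)"
begin

text \<open>Two points of one orbit with the same image differ by an element fixing that image, and
  the action on \<open>Y\<close> is free.\<close>

lemma fibre_orb_inj: "inj_on (orb G act) {x \<in> X. \<pi> x = y}"
proof (rule inj_onI)
  fix u v assume *: "u \<in> {x \<in> X. \<pi> x = y}" "v \<in> {x \<in> X. \<pi> x = y}" "orb G act u = orb G act v"
  then obtain g where g: "g \<in> carrier G" "v = act g u" using X.orb_eqD by blast
  then have "act' g y = y" using * map_act by auto
  then have "g = \<one>" using Y.act_free g * map_closed by blast
  then show "u = v" using g X.act_one * by simp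
qed

lemma finite_fibre: "finite (orbs G act X) \<Longrightarrow> finite {x \<in> X. \<pi> x = y}"
  by (rule inj_on_finite[OF fibre_orb_inj]) (auto simp: orbs_def)

lemma card_fibre_act:
  assumes "g \<in> carrier G" "y \<in> Y"
  shows "card {x \<in> X. \<pi> x = act' g y} = card {x \<in> X. \<pi> x = y}"
proof -
  have "bij_betw (act g) {x \<in> X. \<pi> x = y} {x \<in> X. \<pi> x = act' g y}"
    by (rule bij_betw_byWitness[where f' = "act (inv g)"])
      (use assms X.act_inv X.act_inv' X.act_closed Y.act_inv map_act in auto)
  then show ?thesis by (simp add: bij_betw_same_card)
qed

text \<open>An orbit lying over \<open>A\<close> meets the fibre over \<open>rep A\<close> in
  exactly one point. Applied to the source and target maps, this turns numbers of edge orbits into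
  sums of degrees.\<close>

lemma card_orbs_over:
  assumes fin: "finite (orbs G act X)" "finite S" and S: "S \<subseteq> orbs G act' Y"
  shows "card (orbs G act {x \<in> X. orb G act' (\<pi> x) \<in> S}) = (\<Sum>A\<in>S. card {x \<in> X. \<pi> x = rep A})"
proof -
  let ?F = "Sigma S (\<lambda>A. {x \<in> X. \<pi> x = rep A})"
  have "inj_on (\<lambda>(A, x). orb G act x) ?F"
  proof (rule inj_onI, clarsimp)
    fix A C u v
    assume *: "A \<in> S" "C \<in> S" "u \<in> X" "v \<in> X" "\<pi> u = rep A" "\<pi> v = rep C" "orb G act u = orb G act v"
    then obtain g where g: "g \<in> carrier G" "v = act g u" using X.orb_eqD by blast
    then have "orb G act' (rep C) = orb G act' (rep A)"
      using * map_act map_closed Y.orb_act by metis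
    then have "A = C" using Y.rep_orb * S by (metis subsetD)
    then show "A = C \<and> u = v" using fibre_orb_inj[of "rep A"] * by (auto simp: inj_on_def)
  qed
  moreover have "(\<lambda>(A, x). orb G act x) ` ?F = orbs G act {x \<in> X. orb G act' (\<pi> x) \<in> S}"
  proof (intro subset_antisym subsetI)
    fix D assume "D \<in> (\<lambda>(A, x). orb G act x) ` ?F"
    then obtain A x where "A \<in> S" "x \<in> X" "\<pi> x = rep A" "D = orb G act x" by auto
    then show "D \<in> orbs G act {x \<in> X. orb G act' (\<pi> x) \<in> S}"
      using Y.rep_orb(2) S by (auto simp: orbs_def)
  next
    fix D assume "D \<in> orbs G act {x \<in> X. orb G act' (\<pi> x) \<in> S}"
    then obtain x where x: "x \<in> X" "orb G act' (\<pi> x) \<in> S" "D = orb G act x" by (auto simp: orbs_def)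
    define A where "A = orb G act' (\<pi> x)"
    have A: "A \<in> orbs G act' Y" "A \<in> S" using x S by (auto simp: A_def)
    then obtain g where g: "g \<in> carrier G" "rep A = act' g (\<pi> x)"
      using Y.rep_in[OF A(1)] by (auto simp: A_def orb_def)
    then have "(A, act g x) \<in> ?F" using A x X.act_closed map_act by auto
    moreover have "orb G act (act g x) = D" using X.orb_act g x by simp
    ultimately show "D \<in> (\<lambda>(A, x). orb G act x) ` ?F" by force
  qed
  ultimately have "card (orbs G act {x \<in> X. orb G act' (\<pi> x) \<in> S}) = card ?F"
    using card_image by fastforce
  also have "\<dots> = (\<Sum>A\<in>S. card {x \<in> X. \<pi> x = rep A})"
    using fin finite_fibre by (simp add: card_SigmaI)
  finally show ?thesis .
qed

lemma card_orbs:
  assumes "finite (orbs G act X)" "finite (orbs G act' Y)"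
  shows "card (orbs G act X) = (\<Sum>A\<in>orbs G act' Y. card {x \<in> X. \<pi> x = rep A})"
proof -
  have "{x \<in> X. orb G act' (\<pi> x) \<in> orbs G act' Y} = X" using map_closed by (auto simp: orbs_def)
  then show ?thesis using card_orbs_over[OF assms subset_refl] by simp
qed

lemma card_orbs_bij:
  assumes "bij_betw \<pi> X Y"
  shows "card (orbs G act X) = card (orbs G act' Y)"
proof -
  have "inj_on \<pi> X" "\<pi> ` X = Y" using assms by (auto simp: bij_betw_def)
  have im: "\<pi> ` orb G act x = orb G act' (\<pi> x)" if "x \<in> X" for x
    using that map_act by (force simp: orb_def)
  have "inj_on (image \<pi>) (orbs G act X)"
    by (rule inj_onI) (metis X.orb_subset \<open>inj_on \<pi> X\<close> imageE inj_on_image_eq_iff orbs_def)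
  moreover have "image \<pi> ` orbs G act X = (\<lambda>x. orb G act' (\<pi> x)) ` X"
    unfolding orbs_def image_image by (rule image_cong) (auto simp: im)
  then have "image \<pi> ` orbs G act X = orbs G act' Y"
    by (simp add: orbs_def \<open>\<pi> ` X = Y\<close>[symmetric] image_image)
  ultimately show ?thesis by (metis card_image)
qed

end

subsection \<open>Group actions on trees\<close>

text \<open>A tree is a graph in which every edge \<open>e\<close> has two sides, given by \<open>side e\<close>: crossing an edge
  changes the side of that edge only, and distinct vertices \<open>v, w\<close> are separated by an edge
  incident to \<open>v\<close>.\<close>

locale tree_action = group G for G (structure) +
  fixes V :: "'v set" and E :: "'e set" and src tgt :: "'e \<Rightarrow> 'v"
    and av :: "'a \<Rightarrow> 'v \<Rightarrow> 'v" and ae :: "'a \<Rightarrow> 'e \<Rightarrow> 'e" and side :: "'e \<Rightarrow> 'v \<Rightarrow> bool"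
  assumes src_closed: "e \<in> E \<Longrightarrow> src e \<in> V"
    and tgt_closed: "e \<in> E \<Longrightarrow> tgt e \<in> V"
    and av_closed: "\<lbrakk>g \<in> carrier G; v \<in> V\<rbrakk> \<Longrightarrow> av g v \<in> V"
    and av_one: "v \<in> V \<Longrightarrow> av \<one> v = v"
    and av_mult: "\<lbrakk>g \<in> carrier G; h \<in> carrier G; v \<in> V\<rbrakk> \<Longrightarrow> av (g \<otimes> h) v = av g (av h v)"
    and ae_closed: "\<lbrakk>g \<in> carrier G; e \<in> E\<rbrakk> \<Longrightarrow> ae g e \<in> E"
    and ae_one: "e \<in> E \<Longrightarrow> ae \<one> e = e"
    and ae_mult: "\<lbrakk>g \<in> carrier G; h \<in> carrier G; e \<in> E\<rbrakk> \<Longrightarrow> ae (g \<otimes> h) e = ae g (ae h e)"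
    and src_ae: "\<lbrakk>g \<in> carrier G; e \<in> E\<rbrakk> \<Longrightarrow> src (ae g e) = av g (src e)"
    and tgt_ae: "\<lbrakk>g \<in> carrier G; e \<in> E\<rbrakk> \<Longrightarrow> tgt (ae g e) = av g (tgt e)"
    and side_edge: "\<lbrakk>e \<in> E; f \<in> E\<rbrakk> \<Longrightarrow> side f (src e) \<noteq> side f (tgt e) \<longleftrightarrow> f = e"
    and finite_side: "\<lbrakk>v \<in> V; w \<in> V\<rbrakk> \<Longrightarrow> finite {e \<in> E. side e v \<noteq> side e w}"
    and side_act: "\<lbrakk>g \<in> carrier G; e \<in> E; v \<in> V; w \<in> V\<rbrakk> \<Longrightarrow>
      side (ae g e) (av g v) \<noteq> side (ae g e) (av g w) \<longleftrightarrow> side e v \<noteq> side e w"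
    and first_edge: "\<lbrakk>v \<in> V; w \<in> V; v \<noteq> w\<rbrakk> \<Longrightarrow>
      \<exists>e\<in>E. side e v \<noteq> side e w \<and> (src e = v \<or> tgt e = v)"
begin

text \<open>The edge set of the geodesic between \<open>v\<close> and \<open>w\<close>; its
  cardinality is their distance.\<close>

definition sep :: "'v \<Rightarrow> 'v \<Rightarrow> 'e set" where
  "sep v w = {e \<in> E. side e v \<noteq> side e w}"

definition incident :: "'e \<Rightarrow> 'v \<Rightarrow> bool" where
  "incident e v \<longleftrightarrow> src e = v \<or> tgt e = v"

text \<open>For a vertex not on \<open>e\<close> the value is \<open>src e\<close>, so it is always
  an endpoint of \<open>e\<close>.\<close>

definition opp :: "'e \<Rightarrow> 'v \<Rightarrow> 'v" where
  "opp e v = (if src e = v then tgt e else src e)"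

lemma sep_edges: "e \<in> sep v w \<Longrightarrow> e \<in> E"
  by (simp add: sep_def)

lemma sep_self [simp]: "sep v v = {}"
  by (simp add: sep_def)

lemma sep_commute: "sep v w = sep w v"
  by (auto simp: sep_def)

text \<open>Sides are Boolean, so \<open>sep\<close> is additive modulo two. This replaces
  concatenation of paths in all later arguments.\<close>

lemma sep_iff: "e \<in> sep u w \<longleftrightarrow> (e \<in> sep u v) \<noteq> (e \<in> sep v w)"
  by (auto simp: sep_def)

lemma finite_sep: "\<lbrakk>v \<in> V; w \<in> V\<rbrakk> \<Longrightarrow> finite (sep v w)"
  unfolding sep_def by (rule finite_side)

lemma sep_edge: "e \<in> E \<Longrightarrow> sep (src e) (tgt e) = {e}"
  using side_edge by (auto simp: sep_def)

lemma src_neq_tgt: "e \<in> E \<Longrightarrow> src e \<noteq> tgt e"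
  using sep_edge by force

lemma opp_closed: "e \<in> E \<Longrightarrow> opp e v \<in> V"
  by (simp add: opp_def src_closed tgt_closed)

lemma incident_opp: "incident e (opp e v)"
  by (simp add: incident_def opp_def)

lemma sep_opp: "\<lbrakk>e \<in> E; incident e v\<rbrakk> \<Longrightarrow> sep v (opp e v) = {e}"
  using sep_edge[of e] sep_commute by (auto simp: incident_def opp_def)

lemma incident_cases: "\<lbrakk>incident e v; incident e w\<rbrakk> \<Longrightarrow> w = v \<or> w = opp e v"
  by (auto simp: incident_def opp_def)

text \<open>The induction step for distances: crossing a first edge toggles exactly that coordinate,
  and it was a separating one.\<close>

lemma sep_step:
  assumes "v \<in> V" "w \<in> V" "v \<noteq> w"
  obtains e where "e \<in> sep v w" "incident e v" "opp e v \<in> V" "sep (opp e v) w = sep v w - {e}"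
    "card (sep (opp e v) w) < card (sep v w)"
proof -
  obtain e where e: "e \<in> E" "side e v \<noteq> side e w" "incident e v"
    using first_edge[OF assms] by (auto simp: incident_def)
  have "e \<in> sep v w" using e by (simp add: sep_def)
  moreover have "f \<in> sep (opp e v) w \<longleftrightarrow> f \<in> sep v w \<and> f \<noteq> e" for f
    using sep_opp[OF e(1,3)] sep_iff[of f v w "opp e v"] calculation by auto
  then have s: "sep (opp e v) w = sep v w - {e}" by blast
  moreover have "card (sep v w - {e}) < card (sep v w)"
    using \<open>e \<in> sep v w\<close> finite_sep assms by (intro card_Diff1_less) auto
  ultimately show ?thesis using that e opp_closed by metis
qed

lemma sep_empty: "\<lbrakk>v \<in> V; w \<in> V; sep v w = {}\<rbrakk> \<Longrightarrow> v = w"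
  using first_edge by (fastforce simp: sep_def)

text \<open>Walk from \<open>a\<close> towards \<open>b\<close>; when \<open>e\<close> is the next
  edge to be crossed, \<open>x\<close> is the current vertex or the following one.\<close>

lemma sep_endpoint:
  assumes "a \<in> V" "b \<in> V" "e \<in> sep a b" "incident e x"
  shows "sep a x \<subseteq> sep a b"
  using assms
proof (induction "card (sep a b)" arbitrary: a rule: less_induct)
  case less
  then have "a \<noteq> b" by auto
  then obtain f where f: "f \<in> sep a b" "incident f a" "opp f a \<in> V" "sep (opp f a) b = sep a b - {f}"
    "card (sep (opp f a) b) < card (sep a b)"
    using sep_step[OF less.prems(1,2)] by metis
  have s: "sep a (opp f a) = {f}" using sep_opp f sep_edges by blast
  show ?case
  proof (cases "e = f")
    case True
    then show ?thesis using incident_cases[OF f(2), of x] less.prems s by auto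
  next
    case False
    then have "e \<in> sep (opp f a) b" using f(4) less.prems(3) by simp
    then have "sep (opp f a) x \<subseteq> sep (opp f a) b"
      by (rule less.hyps[OF f(5,3) less.prems(2) _ less.prems(4)])
    moreover have "y \<in> sep (opp f a) x \<or> y = f" if "y \<in> sep a x" for y
      using sep_iff[of y a x "opp f a"] s that by auto
    ultimately show ?thesis using f(1,4) by auto
  qed
qed

lemma ae_inv: "\<lbrakk>g \<in> carrier G; e \<in> E\<rbrakk> \<Longrightarrow> ae g (ae (inv g) e) = e"
  by (simp add: ae_mult[symmetric] ae_one)

lemma sep_act:
  assumes g: "g \<in> carrier G" and v: "v \<in> V" "w \<in> V"
  shows "sep (av g v) (av g w) = ae g ` sep v w"
proof
  show "ae g ` sep v w \<subseteq> sep (av g v) (av g w)"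
    using side_act[OF g] v ae_closed g by (auto simp: sep_def)
  show "sep (av g v) (av g w) \<subseteq> ae g ` sep v w"
  proof
    fix e assume "e \<in> sep (av g v) (av g w)"
    then have e: "e \<in> E" "side e (av g v) \<noteq> side e (av g w)" by (auto simp: sep_def)
    let ?f = "ae (inv g) e"
    have "?f \<in> E" using e g ae_closed by simp
    moreover have "side ?f v \<noteq> side ?f w"
      using side_act[OF g \<open>?f \<in> E\<close> v] e ae_inv g by simp
    ultimately have "?f \<in> sep v w" by (simp add: sep_def)
    then show "e \<in> ae g ` sep v w" using ae_inv[OF g e(1)] by (metis imageI)
  qed
qed

lemma incident_act: "\<lbrakk>g \<in> carrier G; e \<in> E; incident e v\<rbrakk> \<Longrightarrow> incident (ae g e) (av g v)"
  by (auto simp: incident_def src_ae tgt_ae)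

lemma av_inv: "\<lbrakk>g \<in> carrier G; v \<in> V\<rbrakk> \<Longrightarrow> av (inv g) (av g v) = v"
  by (simp add: av_mult[symmetric] av_one)

lemma opp_act: "\<lbrakk>g \<in> carrier G; e \<in> E; v \<in> V\<rbrakk> \<Longrightarrow> opp (ae g e) (av g v) = av g (opp e v)"
  using av_inv src_closed by (metis opp_def src_ae tgt_ae)

lemma card_sep_act:
  assumes "g \<in> carrier G" "v \<in> V" "w \<in> V"
  shows "card (sep (av g v) (av g w)) = card (sep v w)"
proof -
  have "inj_on (ae g) (sep v w)"
    by (rule inj_onI) (metis assms(1) ae_mult ae_one inv_closed l_inv sep_edges)
  then show ?thesis using sep_act[OF assms] by (simp add: card_image)
qed

end

locale free_tree = tree_action G V E src tgt av ae side
  for G (structure) and V :: "'v set" and E :: "'e set" and src tgt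
    and av :: "'a \<Rightarrow> 'v \<Rightarrow> 'v" and ae side +
  assumes free: "\<lbrakk>g \<in> carrier G; v \<in> V; av g v = v\<rbrakk> \<Longrightarrow> g = \<one>"
begin

sublocale V: free_act G av V
  by unfold_locales (auto simp: av_closed av_one av_mult free)

sublocale E: free_act G ae E
  by unfold_locales (auto simp: ae_closed ae_one ae_mult, metis free src_ae src_closed)

sublocale src: equivariant_map G ae E av V src
  by unfold_locales (auto simp: src_closed src_ae)

sublocale tgt: equivariant_map G ae E av V tgt
  by unfold_locales (auto simp: tgt_closed tgt_ae)

end

section \<open>Lifting a spanning tree of the quotient graph\<close>

context free_tree
begin

text \<open>The distance from \<open>v\<close> to the orbit of \<open>b\<close>, which is the
  distance in the quotient graph.\<close>

definition level :: "'v \<Rightarrow> 'v \<Rightarrow> nat" where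
  "level b v = (LEAST n. \<exists>g\<in>carrier G. card (sep v (av g b)) = n)"

lemma level_attained: "\<exists>g\<in>carrier G. card (sep v (av g b)) = level b v"
  unfolding level_def by (rule LeastI_ex) auto

lemma level_le: "g \<in> carrier G \<Longrightarrow> level b v \<le> card (sep v (av g b))"
  unfolding level_def by (rule Least_le) auto

lemma level_act:
  assumes b: "b \<in> V" and g: "g \<in> carrier G" and v: "v \<in> V"
  shows "level b (av g v) = level b v"
proof -
  have le: "level b (av h w) \<le> level b w" if "h \<in> carrier G" "w \<in> V" for h w
  proof -
    obtain k where k: "k \<in> carrier G" "card (sep w (av k b)) = level b w"
      using level_attained by blast
    then have "card (sep (av h w) (av (h \<otimes> k) b)) = level b w"
      using card_sep_act[OF that(1,2), of "av k b"] that b by (simp add: av_mult av_closed)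
    then show ?thesis using level_le[of "h \<otimes> k" b "av h w"] k that by simp
  qed
  have "level b v \<le> level b (av g v)"
    using le[of "inv g" "av g v"] g v by (simp add: av_closed av_inv)
  then show ?thesis using le[OF g v] by simp
qed

lemma level_zero:
  assumes "b \<in> V" "v \<in> V"
  shows "level b v = 0 \<longleftrightarrow> (\<exists>g\<in>carrier G. v = av g b)"
proof
  assume "level b v = 0"
  then obtain g where g: "g \<in> carrier G" "card (sep v (av g b)) = 0"
    using level_attained by metis
  then have "sep v (av g b) = {}" using finite_sep[of v "av g b"] assms av_closed by simp
  then show "\<exists>g\<in>carrier G. v = av g b" using sep_empty[of v "av g b"] assms av_closed g by blast
next
  assume "\<exists>g\<in>carrier G. v = av g b"
  then show "level b v = 0" using level_le[of _ b v] by fastforce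
qed

lemma level_descent:
  assumes "b \<in> V" "v \<in> V" "level b v \<noteq> 0"
  shows "\<exists>e\<in>E. incident e v \<and> level b (opp e v) < level b v"
proof -
  obtain g where g: "g \<in> carrier G" "card (sep v (av g b)) = level b v"
    using level_attained by blast
  have "v \<noteq> av g b" using g assms(3) by auto
  then obtain e where e: "e \<in> sep v (av g b)" "incident e v"
    "card (sep (opp e v) (av g b)) < card (sep v (av g b))"
    using sep_step[of v "av g b"] assms av_closed g(1) by metis
  then have "level b (opp e v) < level b v" using level_le[OF g(1), of b "opp e v"] g(2) by simp
  then show ?thesis using e sep_edges by blast
qed

text \<open>The edges chosen for the vertices outside the orbit of \<open>b\<close> form the lift of a spanning tree of
  the quotient graph, and \<open>\<rho> v\<close> is the translate of that tree containing \<open>v\<close>.\<close>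

lemma ex_retraction:
  assumes b: "b \<in> V" and fin: "finite (orbs G av V)"
  obtains \<rho> F where "F \<subseteq> E" "\<And>g e. \<lbrakk>g \<in> carrier G; e \<in> F\<rbrakk> \<Longrightarrow> ae g e \<in> F"
    "\<And>v. v \<in> V \<Longrightarrow> \<rho> v \<in> carrier G"
    "\<And>g v. \<lbrakk>g \<in> carrier G; v \<in> V\<rbrakk> \<Longrightarrow> \<rho> (av g v) = g \<otimes> \<rho> v"
    "\<rho> b = \<one>" "\<And>e. e \<in> F \<Longrightarrow> \<rho> (src e) = \<rho> (tgt e)"
    "\<And>v. v \<in> V \<Longrightarrow> sep v (av (\<rho> v) b) \<subseteq> F"
    "Suc (card (orbs G ae F)) = card (orbs G av V)"
proof -
  define W where "W = {v \<in> V. level b v \<noteq> 0}"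
  have W_act: "av g v \<in> W" if "g \<in> carrier G" "v \<in> W" for g v
    using that level_act[OF b] av_closed by (simp add: W_def)
  interpret W: free_act G av W
    by (rule V.free_act_subset) (use W_act in \<open>auto simp: W_def\<close>)
  \<comment> \<open>Every vertex off the orbit of \<open>b\<close> chooses an edge towards lower
    level. The choice is made equivariantly, so that the set of chosen edges is invariant.\<close>
  have "\<exists>p. \<forall>v\<in>W. p v \<in> E \<and> (incident (p v) v \<and> level b (opp (p v) v) < level b v) \<and>
      (\<forall>g\<in>carrier G. p (av g v) = ae g (p v))"
  proof (rule W.ex_equivariant)
    fix v assume "v \<in> W"
    then show "\<exists>e\<in>E. incident e v \<and> level b (opp e v) < level b v"
      using level_descent[OF b] by (simp add: W_def)
  next
    fix g v e
    assume "g \<in> carrier G" "v \<in> W" "e \<in> E" "incident e v \<and> level b (opp e v) < level b v"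
    then show "incident (ae g e) (av g v) \<and> level b (opp (ae g e) (av g v)) < level b (av g v)"
      by (simp add: incident_act opp_act level_act[OF b] opp_closed W_def)
  qed (auto simp: ae_closed ae_mult)
  then obtain p where p: "\<And>v. v \<in> W \<Longrightarrow> p v \<in> E" "\<And>v. v \<in> W \<Longrightarrow> incident (p v) v"
    "\<And>v. v \<in> W \<Longrightarrow> level b (opp (p v) v) < level b v"
    "\<And>g v. \<lbrakk>g \<in> carrier G; v \<in> W\<rbrakk> \<Longrightarrow> p (av g v) = ae g (p v)" by metis
  define par where "par v = (if v \<in> W then opp (p v) v else v)" for v
  have par_V: "par v \<in> V" if "v \<in> V" for v
    using that p(1) opp_closed by (simp add: par_def)
  have par_act: "par (av g v) = av g (par v)" if "g \<in> carrier G" "v \<in> V" for g v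
  proof -
    have "av g v \<in> W \<longleftrightarrow> v \<in> W" using that level_act[OF b] av_closed by (simp add: W_def)
    then show ?thesis using that p(1,4) opp_act by (simp add: par_def)
  qed
  have par_level: "level b (par v) \<le> level b v - 1" if "v \<in> V" for v
    using that p(3)[of v] by (auto simp: par_def W_def)
  have it_V: "(par ^^ n) v \<in> V" if "v \<in> V" for n v
    by (induction n) (use that par_V in auto)
  have it_act: "(par ^^ n) (av g v) = av g ((par ^^ n) v)" if "g \<in> carrier G" "v \<in> V" for n g v
    by (induction n) (use that par_act it_V in auto)
  have it_level: "level b ((par ^^ n) v) \<le> level b v - n" if "v \<in> V" for n v
  proof (induction n)
    case (Suc n)
    then show ?case using par_level[OF it_V[OF that], of n] by (simp only: funpow.simps comp_apply)
  qed simp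
  \<comment> \<open>Levels are constant on the finitely many orbits, hence bounded; \<open>N\<close>
    steps to the parent bring every vertex into the orbit of \<open>b\<close>.\<close>
  define N where "N = Max ((\<lambda>A. level b (rep A)) ` orbs G av V)"
  have N: "level b v \<le> N" if v: "v \<in> V" for v
  proof -
    have A: "orb G av v \<in> orbs G av V" using v by (simp add: orbs_def)
    obtain g where "g \<in> carrier G" "v = av g (rep (orb G av v))"
      using V.orb_eqD[OF V.rep_orb(1)[OF A] v V.rep_orb(2)[OF A]] by blast
    then have "level b v = level b (rep (orb G av v))"
      using level_act[OF b] V.rep_orb(1)[OF A] by metis
    then show ?thesis unfolding N_def using fin A by simp
  qed
  define root where "root = par ^^ N"
  have root_V: "root v \<in> V" if "v \<in> V" for v using that it_V by (simp add: root_def)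
  have root_level: "level b (root v) = 0" if "v \<in> V" for v
    using it_level[OF that, of N] N[OF that] by (simp add: root_def)
  have par_fix: "par v = v" if "v \<in> V" "level b v = 0" for v using that by (simp add: par_def W_def)
  have root_par: "root (par v) = root v" if "v \<in> V" for v
    using par_fix[OF root_V root_level] that by (simp add: root_def funpow_swap1)
  have root_fix: "root v = v" if "v \<in> V" "level b v = 0" for v
  proof -
    have "(par ^^ n) v = v" for n by (induction n) (use that par_fix in auto)
    then show ?thesis by (simp add: root_def)
  qed
  \<comment> \<open>The root of \<open>v\<close> is a translate of \<open>b\<close> by a group
    element that freeness makes unique; this uniqueness yields equivariance of
    \<open>\<rho>\<close>.\<close>
  define \<rho> where "\<rho> v = (SOME g. g \<in> carrier G \<and> root v = av g b)" for v
  have \<rho>: "\<rho> v \<in> carrier G" "root v = av (\<rho> v) b" if "v \<in> V" for v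
    using someI_ex[of "\<lambda>g. g \<in> carrier G \<and> root v = av g b"] level_zero[OF b root_V[OF that]]
      root_level[OF that] unfolding \<rho>_def by auto
  have \<rho>_act: "\<rho> (av g v) = g \<otimes> \<rho> v" if "g \<in> carrier G" "v \<in> V" for g v
  proof -
    have "av (\<rho> (av g v)) b = av (g \<otimes> \<rho> v) b"
      using \<rho>[of "av g v"] \<rho>[of v] that it_act[OF that] av_closed av_mult[OF _ _ b]
      by (simp add: root_def)
    then show ?thesis using V.act_inj[OF _ _ b] \<rho>(1) that av_closed by simp
  qed
  have "level b b = 0" using level_zero[OF b b] av_one[OF b] by (metis one_closed)
  then have \<rho>_b: "\<rho> b = \<one>"
    using V.act_inj[OF \<rho>(1)[OF b] one_closed b] \<rho>(2)[OF b] root_fix[OF b] av_one[OF b] by simp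
  have \<rho>_par: "\<rho> (par v) = \<rho> v" if "v \<in> V" for v
    using root_par[OF that] by (simp add: \<rho>_def)
  define F where "F = p ` W"
  have F_E: "F \<subseteq> E" using p(1) by (auto simp: F_def)
  have F_act: "ae g e \<in> F" if g: "g \<in> carrier G" and e: "e \<in> F" for g e
  proof -
    obtain v where v: "v \<in> W" "e = p v" using e by (auto simp: F_def)
    then have "ae g e = p (av g v)" using p(4) g by simp
    then show ?thesis using W_act[OF g v(1)] by (simp add: F_def)
  qed
  have F_\<rho>: "\<rho> (src e) = \<rho> (tgt e)" if eF: "e \<in> F" for e
  proof -
    obtain v where v: "v \<in> W" "e = p v" using eF by (auto simp: F_def)
    then have "\<rho> (opp e v) = \<rho> v" using \<rho>_par[of v] by (simp add: par_def W_def)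
    then show ?thesis using p(2)[OF v(1)] v(2) by (auto simp: incident_def opp_def split: if_splits)
  qed
  have "sep v ((par ^^ n) v) \<subseteq> F" if "v \<in> V" for n v
  proof (induction n)
    case (Suc n)
    let ?w = "(par ^^ n) v"
    have "sep ?w (par ?w) \<subseteq> F"
      using sep_opp[of "p ?w" ?w] p(1,2) by (auto simp: par_def F_def)
    moreover have "f \<in> sep v (par ?w) \<Longrightarrow> f \<in> sep v ?w \<or> f \<in> sep ?w (par ?w)" for f
      using sep_iff[of f v "par ?w" ?w] by blast
    ultimately show ?case using Suc by auto
  qed simp
  then have F_sep: "sep v (av (\<rho> v) b) \<subseteq> F" if "v \<in> V" for v
    using \<rho>(2)[OF that] that unfolding root_def by metis
  interpret p: equivariant_map G av W ae F p
  proof -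
    interpret F: free_act G ae F by (rule E.free_act_subset[OF F_E F_act])
    show "equivariant_map G av W ae F p"
      by unfold_locales (auto simp: F_def p(4))
  qed
  \<comment> \<open>An edge chosen by both of its ends would lower the level in both directions. So
    the orbits of chosen edges match the vertex orbits other than that of \<open>b\<close>, which
    accounts for the \<open>Suc\<close>.\<close>
  have "inj_on p W"
  proof (rule inj_onI, rule ccontr)
    fix v w assume vw: "v \<in> W" "w \<in> W" "p v = p w" "v \<noteq> w"
    then have "w = opp (p v) v" "v = opp (p w) w"
      using incident_cases p(2) by metis+
    then show False using p(3)[OF vw(1)] p(3)[OF vw(2)] by simp
  qed
  then have "card (orbs G ae F) = card (orbs G av W)"
    using p.card_orbs_bij by (simp add: bij_betw_def F_def)
  moreover have "orbs G av V = insert (orb G av b) (orbs G av W)"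
  proof -
    have "orb G av v = orb G av b" if "v \<in> V" "v \<notin> W" for v
      using that level_zero[OF b that(1)] V.orb_act b by (auto simp: W_def)
    then show ?thesis using b by (auto simp: orbs_def W_def)
  qed
  moreover have "orb G av b \<notin> orbs G av W"
  proof
    assume "orb G av b \<in> orbs G av W"
    then have "b \<in> W" using W.orbs_memD[OF _ V.orb_self[OF b]] by blast
    then show False using \<open>level b b = 0\<close> by (simp add: W_def)
  qed
  moreover have "finite (orbs G av W)"
    using fin by (rule finite_subset[rotated]) (auto simp: orbs_def W_def)
  ultimately have "Suc (card (orbs G ae F)) = card (orbs G av V)" by simp
  then show ?thesis
    using that F_E F_act \<rho>(1) \<rho>_act \<rho>_b F_\<rho> F_sep by blast
qed

text \<open>Contracting every translate of the lifted spanning tree turns the tree into a Cayley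
  graph: \<open>\<rho>\<close> sends vertices to group elements, and an edge of \<open>R\<close>
  leads from the identity to \<open>x e\<close>. The sides supply the potential. One generator
  remains for each edge orbit outside \<open>F\<close>, and \<open>F\<close> has one orbit fewer
  than \<open>V\<close>.\<close>

theorem ex_free_basis:
  assumes b: "b \<in> V" and fin: "finite (orbs G av V)" "finite (orbs G ae E)"
  obtains X where "free_basis G X" "finite X"
    "int (card X) = int (card (orbs G ae E)) - int (card (orbs G av V)) + 1"
proof -
  obtain \<rho> F where F: "F \<subseteq> E" "\<And>g e. \<lbrakk>g \<in> carrier G; e \<in> F\<rbrakk> \<Longrightarrow> ae g e \<in> F"
    and \<rho>_cl: "\<And>v. v \<in> V \<Longrightarrow> \<rho> v \<in> carrier G"
    and \<rho>_act: "\<And>g v. \<lbrakk>g \<in> carrier G; v \<in> V\<rbrakk> \<Longrightarrow> \<rho> (av g v) = g \<otimes> \<rho> v"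
    and \<rho>_b: "\<rho> b = \<one>" and \<rho>_F: "\<And>e. e \<in> F \<Longrightarrow> \<rho> (src e) = \<rho> (tgt e)"
    and F_sep: "\<And>v. v \<in> V \<Longrightarrow> sep v (av (\<rho> v) b) \<subseteq> F"
    and card_F: "Suc (card (orbs G ae F)) = card (orbs G av V)"
    by (rule ex_retraction[OF b fin(1)], rule that)
  define R where "R = {e \<in> E - F. \<rho> (src e) = \<one>}"
  define x where "x e = \<rho> (tgt e)" for e
  have R: "e \<in> E" "e \<notin> F" "\<rho> (src e) = \<one>" if "e \<in> R" for e using that by (auto simp: R_def)
  have x_cl: "x e \<in> carrier G" if "e \<in> R" for e
    using R(1)[OF that] tgt_closed \<rho>_cl by (simp add: x_def)
  have ac: "av g b \<in> V" if "g \<in> carrier G" for g using that b av_closed by simp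
  \<comment> \<open>Only edges of \<open>F\<close> lie between a vertex and the base point of its
    translate, so the remaining edges do not tell them apart.\<close>
  have near: "side f (av g v) = side f (av (g \<otimes> \<rho> v) b)"
    if "g \<in> carrier G" "v \<in> V" "f \<in> E - F" for g v f
  proof -
    have "sep (av g v) (av (g \<otimes> \<rho> v) b) \<subseteq> F"
      using F_sep[of "av g v"] \<rho>_act that av_closed by simp
    then show ?thesis using that(3) by (auto simp: sep_def)
  qed
  have cross: "side f (av g b) \<noteq> side f (av (g \<otimes> x e) b) \<longleftrightarrow> f = ae g e"
    if "g \<in> carrier G" "e \<in> R" "f \<in> E - F" for g e f
  proof -
    have e: "src e \<in> V" "tgt e \<in> V" "ae g e \<in> E"
      using R(1)[OF that(2)] src_closed tgt_closed ae_closed that(1) by auto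
    have "side f (av g (src e)) \<noteq> side f (av g (tgt e)) \<longleftrightarrow> f = ae g e"
      using side_edge[OF e(3), of f] that(3) src_ae[OF that(1) R(1)[OF that(2)]]
        tgt_ae[OF that(1) R(1)[OF that(2)]] by simp
    then show ?thesis
      using near[OF that(1) e(1) that(3)] near[OF that(1) e(2) that(3)] R(3)[OF that(2)] that(1)
      by (simp add: x_def)
  qed
  have aF: "ae g e \<in> E - F" if "g \<in> carrier G" "e \<in> E - F" for g e
    using that F(2)[of "inv g" "ae g e"] ae_closed E.act_inv by auto
  have inj_x: "inj_on x R"
  proof (rule inj_onI)
    fix d e assume *: "d \<in> R" "e \<in> R" "x d = x e"
    have "d \<in> E - F" using R[OF *(1)] by simp
    then have "d = ae \<one> d \<longleftrightarrow> d = ae \<one> e"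
      using cross[OF one_closed *(1), of d] cross[OF one_closed *(2), of d] *(3) by simp
    then show "d = e" using ae_one R(1)[OF *(1)] R(1)[OF *(2)] by simp
  qed
  define X where "X = x ` R"
  define \<epsilon> where "\<epsilon> g y = ae g (inv_into R x y)" for g y
  \<comment> \<open>The criterion quantifies over all \<open>f\<close>; on coordinates that are not
    edges of the Cayley graph the potential has to be constant.\<close>
  define \<delta> where "\<delta> g f \<longleftrightarrow> f \<in> E - F \<and> side f (av g b)" for g f
  have inv_x: "inv_into R x y \<in> R" "x (inv_into R x y) = y" if "y \<in> X" for y
    using that by (auto simp: X_def inv_into_into f_inv_into_f)
  have basis: "free_basis G X"
  proof (rule free_basis_if_potential[where \<delta> = \<delta> and \<epsilon> = \<epsilon>])
    show "X \<subseteq> carrier G" using x_cl by (auto simp: X_def)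
    show "carrier G \<subseteq> generate G X"
    proof
      \<comment> \<open>On the way to \<open>b\<close>, an edge of \<open>F\<close> leaves
        \<open>\<rho>\<close> unchanged and any other edge multiplies it by a generator or the
        inverse of one.\<close>
      have gen: "\<rho> v \<in> generate G X" if "v \<in> V" for v
        using that
      proof (induction "card (sep v b)" arbitrary: v rule: less_induct)
        case less
        show ?case
        proof (cases "v = b")
          case True
          then show ?thesis using \<rho>_b generate.one by simp
        next
          case False
          obtain e where e: "e \<in> E" "incident e v" "opp e v \<in> V" "card (sep (opp e v) b) < card (sep v b)"
            using sep_step[OF less.prems b False] sep_edges by metis
          have IH: "\<rho> (opp e v) \<in> generate G X" using less e by simp
          show ?thesis
          proof (cases "e \<in> F")
            case True
            then have "\<rho> (opp e v) = \<rho> v"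
              using \<rho>_F e(2) by (auto simp: incident_def opp_def split: if_splits)
            then show ?thesis using IH by simp
          next
            case False
            have se: "\<rho> (src e) \<in> carrier G" "\<rho> (tgt e) \<in> carrier G" "src e \<in> V" "tgt e \<in> V"
              using e(1) src_closed tgt_closed \<rho>_cl by auto
            let ?e = "ae (inv (\<rho> (src e))) e"
            have eR: "?e \<in> R" using aF[of "inv (\<rho> (src e))" e] se e(1) False
              by (auto simp: R_def src_ae \<rho>_act)
            have xe: "x ?e = inv (\<rho> (src e)) \<otimes> \<rho> (tgt e)"
              using se e(1) by (simp add: x_def tgt_ae \<rho>_act)
            then have xe': "\<rho> (tgt e) = \<rho> (src e) \<otimes> x ?e" "\<rho> (src e) = \<rho> (tgt e) \<otimes> inv (x ?e)"
              using se by (simp_all add: m_assoc[symmetric] inv_mult_group)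
            have "x ?e \<in> X" using eR by (simp add: X_def)
            then have "x ?e \<in> generate G X" "inv (x ?e) \<in> generate G X"
              by (auto intro: generate.incl generate.inv)
            moreover have "(v = tgt e \<and> opp e v = src e) \<or> (v = src e \<and> opp e v = tgt e)"
              using e(2) src_neq_tgt[OF e(1)] by (auto simp: incident_def opp_def)
            ultimately show ?thesis using IH xe' generate.eng by metis
          qed
        qed
      qed
      fix g assume "g \<in> carrier G"
      then show "g \<in> generate G X" using gen[of "av g b"] \<rho>_act[of g b] \<rho>_b b ac by simp
    qed
  next
    fix g h y z
    assume *: "g \<in> carrier G" "h \<in> carrier G" "y \<in> X" "z \<in> X" "\<epsilon> g y = \<epsilon> h z"
    let ?d = "inv_into R x y" and ?e = "inv_into R x z"
    have de: "?d \<in> R" "?e \<in> R" using inv_x * by auto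
    have "src (ae g ?d) = src (ae h ?e)" using *(5) by (simp add: \<epsilon>_def)
    then have "\<rho> (av g (src ?d)) = \<rho> (av h (src ?e))" using src_ae * R(1)[OF de(1)] R(1)[OF de(2)] by simp
    then have "g = h" using \<rho>_act src_closed R[OF de(1)] R[OF de(2)] * by simp
    moreover have "?d = ?e"
      using *(1,5) calculation E.act_inj2 R(1)[OF de(1)] R(1)[OF de(2)] by (metis \<epsilon>_def)
    ultimately show "g = h \<and> y = z" using inv_x * by metis
  next
    fix g y f assume *: "g \<in> carrier G" "y \<in> X"
    let ?d = "inv_into R x y"
    have d: "?d \<in> R" "x ?d = y" using inv_x * by auto
    show "(\<delta> g f \<noteq> \<delta> (g \<otimes> y) f) = (f = \<epsilon> g y)"
    proof (cases "f \<in> E - F")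
      case True
      then show ?thesis using cross[OF *(1) d(1) True] d(2) by (simp add: \<delta>_def \<epsilon>_def)
    next
      case False
      moreover have "ae g ?d \<in> E - F" using aF[OF *(1)] R[OF d(1)] by blast
      ultimately show ?thesis unfolding \<delta>_def \<epsilon>_def by blast
    qed
  qed
  interpret EF: free_act G ae "E - F"
    by (rule E.free_act_subset) (use aF in auto)
  have "bij_betw (orb G ae) R (orbs G ae (E - F))"
    unfolding bij_betw_def
  proof (intro conjI subset_antisym subsetI)
    show "inj_on (orb G ae) R"
    proof (rule inj_onI)
      fix d e assume *: "d \<in> R" "e \<in> R" "orb G ae d = orb G ae e"
      then obtain g where g: "g \<in> carrier G" "e = ae g d" using E.orb_eqD R(1) by blast
      then have "\<one> = g \<otimes> \<one>" using * R \<rho>_act src_closed src_ae by metis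
      then show "d = e" using g ae_one R(1)[OF *(1)] by simp
    qed
    fix A assume "A \<in> orb G ae ` R"
    then show "A \<in> orbs G ae (E - F)" by (auto simp: orbs_def R_def)
  next
    fix A assume "A \<in> orbs G ae (E - F)"
    then obtain e where e: "e \<in> E - F" "A = orb G ae e" by (auto simp: orbs_def)
    have s: "src e \<in> V" "\<rho> (src e) \<in> carrier G" using e src_closed \<rho>_cl by auto
    let ?e = "ae (inv (\<rho> (src e))) e"
    have "?e \<in> R" using aF[of "inv (\<rho> (src e))" e] e s by (auto simp: R_def src_ae \<rho>_act)
    moreover have "orb G ae ?e = A" using E.orb_act e s by simp
    ultimately show "A \<in> orb G ae ` R" by blast
  qed
  then have "card R = card (orbs G ae (E - F))" and fR: "finite R \<longleftrightarrow> finite (orbs G ae (E - F))"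
    by (auto simp: bij_betw_same_card bij_betw_finite)
  moreover have E_un: "orbs G ae E = orbs G ae (E - F) \<union> orbs G ae F" using F(1) by (auto simp: orbs_def)
  moreover have "orbs G ae (E - F) \<inter> orbs G ae F = {}"
  proof -
    have "orb G ae d \<noteq> orb G ae e" if "d \<in> E - F" "e \<in> F" for d e
      using that F E.orb_eqD[of e d] by (metis DiffD1 DiffD2 subsetD)
    then show ?thesis by (auto simp: orbs_def)
  qed
  moreover have "finite (orbs G ae (E - F))" "finite (orbs G ae F)"
    using fin(2) E_un by auto
  ultimately have "card (orbs G ae E) = card R + card (orbs G ae F)" "finite R"
    by (simp_all add: card_Un_disjoint)
  then show ?thesis
    using that[OF basis] card_F card_image[OF inj_x] by (auto simp: X_def)
qed

end

subsection \<open>Invariant subtrees\<close>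

context free_tree
begin

text \<open>Kept as two fibre counts so that orbit counting for equivariant maps applies to each;
  \<open>degree_incident\<close> recovers the number of incident edges.\<close>

definition degree :: "'v \<Rightarrow> nat" where
  "degree v = card {e \<in> E. src e = v} + card {e \<in> E. tgt e = v}"

lemma degree_act: "\<lbrakk>g \<in> carrier G; v \<in> V\<rbrakk> \<Longrightarrow> degree (av g v) = degree v"
  by (simp add: degree_def src.card_fibre_act tgt.card_fibre_act)

lemma degree_rep: "v \<in> V \<Longrightarrow> degree (rep (orb G av v)) = degree v"
proof -
  assume v: "v \<in> V"
  have A: "orb G av v \<in> orbs G av V" using v by (simp add: orbs_def)
  obtain g where "g \<in> carrier G" "v = av g (rep (orb G av v))"
    using V.orb_eqD[OF V.rep_orb(1)[OF A] v V.rep_orb(2)[OF A]] by blast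
  then show ?thesis using degree_act V.rep_orb(1)[OF A] by metis
qed

text \<open>The handshake lemma in the quotient graph: every edge orbit is counted once at its
  source and once at its target.\<close>

lemma euler_characteristic:
  assumes "finite (orbs G av V)" "finite (orbs G ae E)"
  shows "(\<Sum>A\<in>orbs G av V. int (degree (rep A)) - 2)
    = 2 * (int (card (orbs G ae E)) - int (card (orbs G av V)))"
proof -
  have "(\<Sum>A\<in>orbs G av V. degree (rep A)) = 2 * card (orbs G ae E)"
    unfolding degree_def sum.distrib
    using src.card_orbs[OF assms(2,1)] tgt.card_orbs[OF assms(2,1)] by simp
  then show ?thesis by (simp add: sum_subtractf flip: of_nat_sum)
qed

lemma degree_incident:
  assumes "finite (orbs G ae E)"
  shows "degree v = card {e \<in> E. incident e v}"
proof -
  have "{e \<in> E. incident e v} = {e \<in> E. src e = v} \<union> {e \<in> E. tgt e = v}"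
    by (auto simp: incident_def)
  moreover have "tgt e \<noteq> v" if "e \<in> E" "src e = v" for e using src_neq_tgt[OF that(1)] that(2) by auto
  then have "{e \<in> E. src e = v} \<inter> {e \<in> E. tgt e = v} = {}" by blast
  ultimately show ?thesis
    using src.finite_fibre[OF assms] tgt.finite_fibre[OF assms]
    by (simp add: degree_def card_Un_disjoint)
qed

text \<open>A vertex other than \<open>b\<close> has an incident edge pointing towards
  \<open>b\<close>, so its orbit is an end of one of the edge orbits. The orbit of \<open>b\<close>
  is added for a tree with a single vertex.\<close>

lemma finite_vertex_orbits:
  assumes "finite (orbs G ae E)"
  shows "finite (orbs G av V)"
proof (cases "V = {}")
  case False
  then obtain b where b: "b \<in> V" by blast
  have "orbs G av V \<subseteq> insert (orb G av b)
      ((\<lambda>A. orb G av (src (rep A))) ` orbs G ae E \<union> (\<lambda>A. orb G av (tgt (rep A))) ` orbs G ae E)"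
  proof
    fix A assume "A \<in> orbs G av V"
    then obtain v where v: "v \<in> V" "A = orb G av v" by (auto simp: orbs_def)
    show "A \<in> insert (orb G av b)
      ((\<lambda>A. orb G av (src (rep A))) ` orbs G ae E \<union> (\<lambda>A. orb G av (tgt (rep A))) ` orbs G ae E)"
    proof (cases "v = b")
      case False
      then obtain e where e: "e \<in> E" "src e = v \<or> tgt e = v" using first_edge[OF v(1) b] by blast
      let ?D = "orb G ae e"
      have D: "?D \<in> orbs G ae E" using e by (simp add: orbs_def)
      obtain g where "g \<in> carrier G" "rep ?D = ae g e"
        using E.orb_eqD[OF e(1) E.rep_orb(1)[OF D]] E.rep_orb(2)[OF D] by auto
      then have "orb G av (src (rep ?D)) = orb G av (src e)"
        "orb G av (tgt (rep ?D)) = orb G av (tgt e)"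
        using e(1) V.orb_act src_closed tgt_closed by (simp_all add: src_ae tgt_ae)
      then have "A = orb G av (src (rep ?D)) \<or> A = orb G av (tgt (rep ?D))" using e(2) v(2) by auto
      then show ?thesis using D by blast
    qed (use v in simp)
  qed
  then show ?thesis using assms finite_subset by fast
qed (simp add: orbs_def)

end

section \<open>Convex subtrees and their cores\<close>

context tree_action
begin

text \<open>Connectedness is phrased as convexity, which passes to intersections at once. The empty
  pair qualifies, so nonemptiness is always tracked separately.\<close>

definition subtree :: "'v set \<Rightarrow> 'e set \<Rightarrow> bool" where
  "subtree W F \<longleftrightarrow> W \<subseteq> V \<and> F \<subseteq> E \<and> (\<forall>e\<in>F. src e \<in> W \<and> tgt e \<in> W) \<and>
     (\<forall>v\<in>W. \<forall>w\<in>W. sep v w \<subseteq> F)"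

definition invariant :: "'a set \<Rightarrow> 'v set \<Rightarrow> 'e set \<Rightarrow> bool" where
  "invariant H W F \<longleftrightarrow> (\<forall>g\<in>H. (\<forall>v\<in>W. av g v \<in> W) \<and> (\<forall>e\<in>F. ae g e \<in> F))"

definition free_on :: "'a set \<Rightarrow> bool" where
  "free_on H \<longleftrightarrow> (\<forall>g\<in>H. \<forall>v\<in>V. av g v = v \<longrightarrow> g = \<one>)"

lemma subtreeD:
  assumes "subtree W F"
  shows "v \<in> W \<Longrightarrow> v \<in> V" "e \<in> F \<Longrightarrow> e \<in> E" "e \<in> F \<Longrightarrow> src e \<in> W" "e \<in> F \<Longrightarrow> tgt e \<in> W"
    "\<lbrakk>v \<in> W; w \<in> W; e \<in> sep v w\<rbrakk> \<Longrightarrow> e \<in> F" "\<lbrakk>e \<in> F; incident e v\<rbrakk> \<Longrightarrow> v \<in> W" "e \<in> F \<Longrightarrow> opp e v \<in> W"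
  using assms unfolding subtree_def incident_def opp_def by (blast, blast, blast, blast, blast, blast, auto)

lemma subtree_Int: "\<lbrakk>subtree W F; subtree W' F'\<rbrakk> \<Longrightarrow> subtree (W \<inter> W') (F \<inter> F')"
  by (auto simp: subtree_def)

lemma free_tree_subtree:
  assumes H: "subgroup H G" and W: "subtree W F" "invariant H W F" and free: "free_on H"
  shows "free_tree (G\<lparr>carrier := H\<rparr>) W F src tgt av ae side"
proof -
  interpret H: group "G\<lparr>carrier := H\<rparr>" using H subgroup.subgroup_is_group is_group by blast
  have HG: "g \<in> carrier G" if "g \<in> H" for g using subgroup.mem_carrier[OF H that] .
  show ?thesis
  proof
    fix e assume e: "e \<in> F"
    show "src e \<in> W" "tgt e \<in> W" using subtreeD[OF W(1)] e by auto
  next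
    fix e f assume "e \<in> F" "f \<in> F"
    then show "(side f (src e) \<noteq> side f (tgt e)) = (f = e)" using subtreeD(2)[OF W(1)] by (intro side_edge) auto
  next
    fix v w assume vw: "v \<in> W" "w \<in> W"
    then have "finite (sep v w)" using finite_sep subtreeD(1)[OF W(1)] by blast
    then show "finite {e \<in> F. side e v \<noteq> side e w}"
      by (rule rev_finite_subset) (use subtreeD(2)[OF W(1)] in \<open>auto simp: sep_def\<close>)
    assume "v \<noteq> w"
    then obtain e where e: "e \<in> E" "side e v \<noteq> side e w" "src e = v \<or> tgt e = v"
      using first_edge[of v w] subtreeD(1)[OF W(1)] vw by blast
    then have "e \<in> F" using subtreeD(5)[OF W(1) vw] by (simp add: sep_def)
    then show "\<exists>e\<in>F. side e v \<noteq> side e w \<and> (src e = v \<or> tgt e = v)" using e by blast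
  next
    fix v assume "v \<in> W"
    then show "av \<one>\<^bsub>G\<lparr>carrier := H\<rparr>\<^esub> v = v" using subtreeD(1)[OF W(1)] av_one by simp
  next
    fix e assume "e \<in> F"
    then show "ae \<one>\<^bsub>G\<lparr>carrier := H\<rparr>\<^esub> e = e" using subtreeD(2)[OF W(1)] ae_one by simp
  next
    fix g v assume g: "g \<in> carrier (G\<lparr>carrier := H\<rparr>)" and v: "v \<in> W"
    show "av g v \<in> W" using W(2) g v by (simp add: invariant_def)
    show "av g v = v \<Longrightarrow> g = \<one>\<^bsub>G\<lparr>carrier := H\<rparr>\<^esub>"
      using free g subtreeD(1)[OF W(1) v] unfolding free_on_def by auto
  next
    fix g e assume g: "g \<in> carrier (G\<lparr>carrier := H\<rparr>)" and e: "e \<in> F"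
    show "ae g e \<in> F" using W(2) g e by (simp add: invariant_def)
    show "src (ae g e) = av g (src e)" "tgt (ae g e) = av g (tgt e)"
      using g subtreeD(2)[OF W(1) e] HG src_ae tgt_ae by auto
    fix v w assume "v \<in> W" "w \<in> W"
    then show "(side (ae g e) (av g v) \<noteq> side (ae g e) (av g w)) = (side e v \<noteq> side e w)"
      using side_act g subtreeD(1,2)[OF W(1)] e HG by simp
  next
    fix g h v assume "g \<in> carrier (G\<lparr>carrier := H\<rparr>)" "h \<in> carrier (G\<lparr>carrier := H\<rparr>)" "v \<in> W"
    then show "av (g \<otimes>\<^bsub>G\<lparr>carrier := H\<rparr>\<^esub> h) v = av g (av h v)"
      using av_mult HG subtreeD(1)[OF W(1)] by simp
  next
    fix g h e assume "g \<in> carrier (G\<lparr>carrier := H\<rparr>)" "h \<in> carrier (G\<lparr>carrier := H\<rparr>)" "e \<in> F"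
    then show "ae (g \<otimes>\<^bsub>G\<lparr>carrier := H\<rparr>\<^esub> h) e = ae g (ae h e)"
      using ae_mult HG subtreeD(2)[OF W(1)] by simp
  qed
qed

text \<open>The union of the translates of the geodesics from a vertex to its images under generators.\<close>

lemma ex_finite_subtree:
  assumes fg: "fin_gen_subgroup H G" and free: "free_on H" and b: "b \<in> V"
  shows "\<exists>W F. W \<noteq> {} \<and> subtree W F \<and> invariant H W F \<and> finite (orbs (G\<lparr>carrier := H\<rparr>) ae F)"
proof -
  obtain S where H: "subgroup H G" and S: "finite S" "S \<subseteq> H" "generate G S = H"
    using fg by (auto simp: fin_gen_subgroup_def)
  have HG: "g \<in> carrier G" if "g \<in> H" for g using subgroup.mem_carrier[OF H that] .
  define D where "D = (\<Union>s\<in>S. sep b (av s b))"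
  define F where "F = (\<Union>h\<in>H. ae h ` D)"
  define C where "C = insert b (src ` D \<union> tgt ` D)"
  define W where "W = (\<Union>h\<in>H. av h ` C)"
  have avb: "av h b \<in> V" if "h \<in> H" for h using HG[OF that] b av_closed by simp
  have finD: "finite D" using S avb b finite_sep by (auto simp: D_def)
  have DE: "D \<subseteq> E" using sep_edges by (auto simp: D_def)
  have CV: "C \<subseteq> V" using DE b src_closed tgt_closed by (auto simp: C_def)
  have F_act: "ae g e \<in> F" if g: "g \<in> H" and e: "e \<in> F" for g e
  proof -
    obtain h d where h: "h \<in> H" "d \<in> D" "e = ae h d" using e by (auto simp: F_def)
    then have "ae g e = ae (g \<otimes> h) d" using ae_mult HG g DE by auto
    then show ?thesis using subgroup.m_closed[OF H g h(1)] h(2) by (auto simp: F_def)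
  qed
  have W_act: "av g v \<in> W" if g: "g \<in> H" and v: "v \<in> W" for g v
  proof -
    obtain h c where h: "h \<in> H" "c \<in> C" "v = av h c" using v by (auto simp: W_def)
    then have "av g v = av (g \<otimes> h) c" using av_mult HG g CV by auto
    then show ?thesis using subgroup.m_closed[OF H g h(1)] h(2) by (auto simp: W_def)
  qed
  have inv: "invariant H W F" using F_act W_act by (simp add: invariant_def)
  have one: "\<one> \<in> H" using subgroup.one_closed[OF H] .
  have DF: "e \<in> F" if "e \<in> D" for e
  proof -
    have "e = ae \<one> e" using that DE ae_one by auto
    then show ?thesis unfolding F_def using one that by blast
  qed
  \<comment> \<open>The geodesic from \<open>b\<close> to its image under
    \<open>g \<otimes> h\<close> is covered by the one to its image under \<open>g\<close> and the
    \<open>g\<close>-translate of the one to its image under \<open>h\<close>.\<close>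
  have sep_H: "sep b (av h b) \<subseteq> F" if "h \<in> generate G S" for h
    using that
  proof (induction rule: generate.induct)
    case one
    then show ?case using av_one b by simp
  next
    case (incl s)
    then show ?case using DF by (auto simp: D_def)
  next
    case (inv s)
    have s: "s \<in> carrier G" "s \<in> H" "inv s \<in> H"
      using inv S HG subgroup.m_inv_closed[OF H] by auto
    have "sep b (av (inv s) b) = sep (av (inv s) (av s b)) (av (inv s) b)"
      using s b av_inv by simp
    also have "\<dots> = ae (inv s) ` sep (av s b) b" using sep_act s b avb by simp
    also have "\<dots> \<subseteq> F" using inv s(3) by (auto simp: F_def D_def sep_commute[of "av s b"])
    finally show ?case .
  next
    case (eng g h)
    have gh: "g \<in> H" "h \<in> H" using eng S(3) by auto
    have "sep (av g b) (av (g \<otimes> h) b) = ae g ` sep b (av h b)"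
      using sep_act gh HG b avb av_mult by simp
    also have "\<dots> \<subseteq> F" using eng.IH(2) F_act gh by auto
    finally have "sep (av g b) (av (g \<otimes> h) b) \<subseteq> F" .
    moreover have "e \<in> sep b (av g b) \<or> e \<in> sep (av g b) (av (g \<otimes> h) b)"
      if "e \<in> sep b (av (g \<otimes> h) b)" for e
      using that sep_iff[of e b "av (g \<otimes> h) b" "av g b"] by blast
    ultimately show ?case using eng.IH(1) by blast
  qed
  have sep_C: "sep b c \<subseteq> D" if c: "c \<in> C" for c
  proof (cases "c = b")
    case False
    then obtain e s where "s \<in> S" "e \<in> sep b (av s b)" "incident e c"
      using c by (auto simp: C_def D_def incident_def)
    moreover have "av s b \<in> V" using \<open>s \<in> S\<close> S(2) avb by auto
    ultimately show ?thesis using sep_endpoint[OF b, of "av s b" e c] unfolding D_def by blast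
  qed simp
  have sep_W: "sep b w \<subseteq> F" if w: "w \<in> W" for w
  proof -
    obtain h c where h: "h \<in> H" "c \<in> C" "w = av h c" using w by (auto simp: W_def)
    have "sep (av h b) w = ae h ` sep b c" using sep_act h HG b CV by auto
    then have "sep (av h b) w \<subseteq> F" using sep_C[OF h(2)] h(1) by (auto simp: F_def)
    moreover have "sep b (av h b) \<subseteq> F" using sep_H h(1) S(3) by simp
    moreover have "e \<in> sep b (av h b) \<or> e \<in> sep (av h b) w" if "e \<in> sep b w" for e
      using that sep_iff[of e b w "av h b"] by blast
    ultimately show ?thesis by blast
  qed
  have sub: "subtree W F"
    unfolding subtree_def
  proof (intro conjI ballI)
    show "W \<subseteq> V" using CV av_closed HG by (auto simp: W_def)
    show "F \<subseteq> E" using DE ae_closed HG by (auto simp: F_def)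
    fix e assume "e \<in> F"
    then obtain h d where h: "h \<in> H" "d \<in> D" "e = ae h d" by (auto simp: F_def)
    then have "src e = av h (src d)" "tgt e = av h (tgt d)" using src_ae tgt_ae HG DE by auto
    then show "src e \<in> W" "tgt e \<in> W" using h(1,2) by (auto simp: W_def C_def)
  next
    fix v w assume vw: "v \<in> W" "w \<in> W"
    have "e \<in> sep b v \<or> e \<in> sep b w" if "e \<in> sep v w" for e
      using that sep_iff[of e v w b] sep_commute[of v b] by auto
    then show "sep v w \<subseteq> F" using sep_W[OF vw(1)] sep_W[OF vw(2)] by blast
  qed
  interpret H: free_tree "G\<lparr>carrier := H\<rparr>" W F src tgt av ae side
    by (rule free_tree_subtree[OF H sub inv free])
  have "orbs (G\<lparr>carrier := H\<rparr>) ae F \<subseteq> orb (G\<lparr>carrier := H\<rparr>) ae ` D"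
  proof
    fix A assume "A \<in> orbs (G\<lparr>carrier := H\<rparr>) ae F"
    then obtain e where e: "e \<in> F" "A = orb (G\<lparr>carrier := H\<rparr>) ae e" by (auto simp: orbs_def)
    then obtain h d where h: "h \<in> H" "d \<in> D" "e = ae h d" by (auto simp: F_def)
    then show "A \<in> orb (G\<lparr>carrier := H\<rparr>) ae ` D" using H.E.orb_act[of h d] DF e by simp
  qed
  then have "finite (orbs (G\<lparr>carrier := H\<rparr>) ae F)" using finD finite_surj by blast
  moreover have "b \<in> W" using one av_one b unfolding W_def C_def by force
  ultimately show ?thesis using sub inv by blast
qed

text \<open>A leaf is never an interior vertex of a geodesic, so deleting its orbit together with
  the edges leading to it keeps convexity. The delicate point is that the other end of the edge
  survives.\<close>

lemma prune_subtree:
  assumes H: "subgroup H G" and free: "free_on H" and W: "subtree W F" "invariant H W F"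
    and w: "w \<in> W" and leaf: "{e \<in> F. incident e w} = {d}"
  defines "W' \<equiv> W - (\<lambda>h. av h w) ` H" and "F' \<equiv> F - (\<lambda>h. ae h d) ` H"
  shows "W' \<noteq> {} \<and> subtree W' F' \<and> invariant H W' F'"
proof -
  have HG: "g \<in> carrier G" if "g \<in> H" for g using subgroup.mem_carrier[OF H that] .
  note m_closed = subgroup.m_closed[OF H] and inv_closed = subgroup.m_inv_closed[OF H]
  have act: "av g v \<in> W" "ae g e \<in> F" if "g \<in> H" "v \<in> W" "e \<in> F" for g v e
    using that W(2) by (auto simp: invariant_def)
  have d: "d \<in> F" "incident d w" using leaf by blast+
  have dE: "d \<in> E" and wV: "w \<in> V" using subtreeD(2)[OF W(1) d(1)] subtreeD(1)[OF W(1) w] by auto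
  have leaf': "e = ae h d" if "h \<in> H" "e \<in> F" "incident e (av h w)" for h e
  proof -
    have e: "e \<in> E" using subtreeD(2)[OF W(1)] that by blast
    have "incident (ae (inv h) e) w"
      using incident_act[of "inv h" e "av h w"] that e HG av_inv wV by simp
    moreover have "ae (inv h) e \<in> F" using act(2)[OF _ w] inv_closed that by blast
    ultimately have "ae (inv h) e = d" using leaf by blast
    then show ?thesis using ae_inv[of h e] HG that(1) e by auto
  qed
  have inc: "incident (ae h d) (av h w)" if "h \<in> H" for h
    using incident_act d dE HG that by blast
  have "opp d w \<in> W'"
  proof -
    \<comment> \<open>If both ends of \<open>d\<close> lay in one orbit, both would be leaves and
      \<open>h\<close> would fix \<open>d\<close>. Orientations are preserved, so \<open>h\<close>
      fixes \<open>src d\<close> and is trivial by freeness, which makes \<open>d\<close> a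
      loop.\<close>
    have "opp d w \<noteq> av h w" if h: "h \<in> H" for h
    proof
      assume o: "opp d w = av h w"
      then have "ae h d = d" using leaf'[OF h d(1)] incident_opp[of d w] by simp
      then have "av h (src d) = src d" using src_ae[of h d] HG h dE by auto
      then have "h = \<one>" using free h src_closed[OF dE] unfolding free_on_def by blast
      then have "opp d w = w" using o av_one wV by simp
      then show False using sep_opp[OF dE d(2)] by simp
    qed
    then show ?thesis using subtreeD(7)[OF W(1) d(1)] by (auto simp: W'_def)
  qed
  moreover have "subtree W' F'"
    unfolding subtree_def
  proof (intro conjI ballI subsetI)
    fix v assume "v \<in> W'" then show "v \<in> V" using subtreeD(1)[OF W(1)] by (auto simp: W'_def)
  next
    fix e assume "e \<in> F'"
    then have e: "e \<in> F" "e \<notin> (\<lambda>h. ae h d) ` H" by (auto simp: F'_def)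
    then show "e \<in> E" using subtreeD(2)[OF W(1)] by blast
    show "src e \<in> W'" using leaf'[OF _ e(1)] e subtreeD(3)[OF W(1)] by (auto simp: W'_def incident_def)
    show "tgt e \<in> W'" using leaf'[OF _ e(1)] e subtreeD(4)[OF W(1)] by (auto simp: W'_def incident_def)
  next
    fix x y e assume *: "x \<in> W'" "y \<in> W'" "e \<in> sep x y"
    then have eF: "e \<in> F" and xy: "x \<in> W" "y \<in> W"
      using subtreeD(5)[OF W(1)] by (auto simp: W'_def)
    \<comment> \<open>The only edge at the leaf separates it from every other vertex, in particular
      from both \<open>x\<close> and \<open>y\<close>, and so it cannot separate \<open>x\<close>
      from \<open>y\<close>.\<close>
    have "e \<noteq> ae h d" if h: "h \<in> H" for h
    proof
      assume e: "e = ae h d"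
      have hw: "av h w \<in> W" using act(1)[OF h w d(1)] .
      have "e \<in> sep (av h w) z" if z: "z \<in> W'" for z
      proof -
        have "z \<noteq> av h w" "z \<in> W" using z h by (auto simp: W'_def)
        then obtain f where f: "f \<in> sep (av h w) z" "incident f (av h w)"
          using sep_step[of "av h w" z] subtreeD(1)[OF W(1)] hw by metis
        then have "f \<in> F" using subtreeD(5)[OF W(1) hw \<open>z \<in> W\<close>] by blast
        then show ?thesis using leaf'[OF h _ f(2)] f(1) e by simp
      qed
      then have "e \<in> sep (av h w) x" "e \<in> sep (av h w) y" using * by blast+
      then show False using *(3) sep_iff[of e x y "av h w"] sep_commute[of x "av h w"] by auto
    qed
    then show "e \<in> F'" using eF by (auto simp: F'_def)
  qed
  moreover have "invariant H W' F'"
    unfolding invariant_def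
  proof (intro ballI conjI)
    fix g v assume g: "g \<in> H" and v: "v \<in> W'"
    have "av g v \<noteq> av h w" if h: "h \<in> H" for h
    proof
      assume "av g v = av h w"
      then have "v = av (inv g) (av h w)"
        using av_inv[of g v] g v HG subtreeD(1)[OF W(1)] by (auto simp: W'_def)
      then have "v = av (inv g \<otimes> h) w" using av_mult[of "inv g" h w] g h HG wV by simp
      then show False using v m_closed[OF inv_closed[OF g] h] by (auto simp: W'_def)
    qed
    then show "av g v \<in> W'" using act(1)[OF g _ d(1)] v by (auto simp: W'_def)
  next
    fix g e assume g: "g \<in> H" and e: "e \<in> F'"
    have eE: "e \<in> E" using e subtreeD(2)[OF W(1)] by (auto simp: F'_def)
    have "ae g e \<noteq> ae h d" if h: "h \<in> H" for h
    proof
      assume "ae g e = ae h d"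
      then have "ae (inv g) (ae h d) = e"
        using ae_mult[of "inv g" g e] g HG eE ae_one by simp
      then have "e = ae (inv g \<otimes> h) d" using ae_mult[of "inv g" h d] g h HG dE by simp
      then show False using e m_closed[OF inv_closed[OF g] h] by (auto simp: F'_def)
    qed
    then show "ae g e \<in> F'" using act(2)[OF g w] e by (auto simp: F'_def)
  qed
  ultimately show ?thesis by blast
qed

text \<open>Take a nonempty invariant subtree with the fewest edge orbits; pruning a leaf would
  lower their number. An isolated vertex is still possible here and is excluded in
  \<open>core_degree\<close> for nontrivial \<open>H\<close>.\<close>

lemma ex_core:
  assumes fg: "fin_gen_subgroup H G" and free: "free_on H" and b: "b \<in> V"
  obtains W F where "W \<noteq> {}" "subtree W F" "invariant H W F" "finite (orbs (G\<lparr>carrier := H\<rparr>) ae F)"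
    "\<And>w d. w \<in> W \<Longrightarrow> {e \<in> F. incident e w} \<noteq> {d}"
proof -
  have H: "subgroup H G" using fg by (simp add: fin_gen_subgroup_def)
  let ?H = "G\<lparr>carrier := H\<rparr>"
  let ?P = "\<lambda>(W, F). W \<noteq> {} \<and> subtree W F \<and> invariant H W F \<and> finite (orbs ?H ae F)"
  let ?m = "\<lambda>(W, F). card (orbs ?H ae F)"
  obtain p where "?P p" using ex_finite_subtree[OF assms] by blast
  then obtain q where q: "?P q" "\<And>r. ?P r \<Longrightarrow> ?m q \<le> ?m r"
    using ex_has_least_nat[of ?P p ?m] by blast
  obtain W F where WF: "q = (W, F)" by force
  have W: "W \<noteq> {}" "subtree W F" "invariant H W F" "finite (orbs ?H ae F)" using q(1) WF by auto
  interpret H: free_tree ?H W F src tgt av ae side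
    by (rule free_tree_subtree[OF H W(2,3) free])
  have "{e \<in> F. incident e w} \<noteq> {d}" if w: "w \<in> W" for w d
  proof
    assume leaf: "{e \<in> F. incident e w} = {d}"
    let ?W = "W - (\<lambda>h. av h w) ` H" and ?F = "F - (\<lambda>h. ae h d) ` H"
    have d: "d \<in> F" using leaf by blast
    have sub: "orbs ?H ae ?F \<subseteq> orbs ?H ae F" by (auto simp: orbs_def)
    have "orb ?H ae d \<noteq> orb ?H ae e" if e: "e \<in> ?F" for e
      using H.E.orb_self[of e] e by (auto simp: orb_def)
    then have "orb ?H ae d \<in> orbs ?H ae F - orbs ?H ae ?F" using d by (auto simp: orbs_def)
    then have "card (orbs ?H ae ?F) < card (orbs ?H ae F)"
      using sub W(4) by (intro psubset_card_mono) auto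
    moreover have "?P (?W, ?F)"
      using prune_subtree[OF H free W(2,3) w leaf] finite_subset[OF sub W(4)] by simp
    ultimately show False using q(2)[of "(?W, ?F)"] WF by simp
  qed
  then show ?thesis using that W by blast
qed

text \<open>The edge of the bridge between two disjoint subtrees that leaves the first one is unique.\<close>

lemma disjoint_subtrees_fixed:
  assumes L: "subgroup L G" and free: "free_on L"
    and W1: "subtree W1 F1" "invariant L W1 F1" "W1 \<noteq> {}"
    and W2: "subtree W2 F2" "invariant L W2 F2" "W2 \<noteq> {}"
    and disj: "W1 \<inter> W2 = {}" and g: "g \<in> L"
  shows "g = \<one>"
proof -
  have LG: "h \<in> carrier G" if "h \<in> L" for h using subgroup.mem_carrier[OF L that] .
  have exit: "\<exists>e\<in>sep x y. \<exists>z\<in>W1. incident e z \<and> e \<notin> F1" if "x \<in> W1" "y \<in> W2" for x y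
    using that
  proof (induction "card (sep x y)" arbitrary: x rule: less_induct)
    case less
    have "x \<in> V" "y \<in> V" "x \<noteq> y" using less.prems subtreeD(1)[OF W1(1)] subtreeD(1)[OF W2(1)] disj by auto
    then obtain e where e: "e \<in> sep x y" "incident e x" "sep (opp e x) y = sep x y - {e}"
      "card (sep (opp e x) y) < card (sep x y)" using sep_step by metis
    show ?case
    proof (cases "e \<in> F1")
      case True
      then have "opp e x \<in> W1" using subtreeD(7)[OF W1(1)] by blast
      then show ?thesis using less.hyps[OF e(4) _ less.prems(2)] e(3) by auto
    qed (use e less.prems in blast)
  qed
  obtain x y where xy: "x \<in> W1" "y \<in> W2" using W1(3) W2(3) by blast
  obtain e z where e: "e \<in> sep x y" "z \<in> W1" "incident e z" "e \<notin> F1" using exit[OF xy] by blast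
  have eE: "e \<in> E" using e(1) sep_edges by blast
  have eF2: "e \<notin> F2" using e(2,3) disj subtreeD(6)[OF W2(1)] by blast
  \<comment> \<open>Moving an end within its own subtree crosses edges of that subtree only, so an
    edge outside both separates all pairs or none.\<close>
  have across: "f \<in> sep x' y'"
    if "f \<in> sep x'' y''" "f \<notin> F1" "f \<notin> F2" "x' \<in> W1" "y' \<in> W2" "x'' \<in> W1" "y'' \<in> W2" for f x' y' x'' y''
    using that subtreeD(5)[OF W1(1), of x' x'' f] subtreeD(5)[OF W2(1), of y'' y' f]
      sep_iff[of f x' y' x''] sep_iff[of f x'' y' y''] by blast
  let ?e = "ae g e" and ?z = "av g z"
  have gG: "g \<in> carrier G" and ig: "inv g \<in> L" using LG g subgroup.m_inv_closed[OF L] by auto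
  have back_e: "ae (inv g) ?e = e" using ae_mult[of "inv g" g e] ae_one eE gG by simp
  have e': "?e \<in> E" "?e \<notin> F1" "?e \<notin> F2"
    using ae_closed gG eE W1(2) W2(2) ig back_e e(4) eF2 unfolding invariant_def by metis+
  have z': "?z \<in> W1" "incident ?e ?z"
    using e(2,3) W1(2) g incident_act gG eE by (auto simp: invariant_def)
  have xV: "x \<in> V" "y \<in> V" "z \<in> V" using xy e(2) subtreeD(1)[OF W1(1)] subtreeD(1)[OF W2(1)] by auto
  have gxy: "av g x \<in> W1" "av g y \<in> W2" using xy W1(2) W2(2) g by (auto simp: invariant_def)
  have e'_sep: "?e \<in> sep (av g x) (av g y)" using sep_act[OF gG xV(1,2)] e(1) by blast
  \<comment> \<open>Otherwise step from \<open>?z\<close> over \<open>?e\<close>. The geodesic from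
    there to \<open>y\<close> still crosses \<open>e\<close>, so it passes \<open>z\<close> and has
    to go back over \<open>?e\<close>; but \<open>?e\<close> has already been crossed on the way to
    \<open>y\<close>.\<close>
  have "?e = e"
  proof (rule ccontr)
    assume ne: "?e \<noteq> e"
    define u where "u = opp ?e ?z"
    have u: "sep ?z u = {?e}" "u \<in> V" using sep_opp[OF e'(1) z'(2)] opp_closed e'(1) by (auto simp: u_def)
    have "e \<in> sep ?z y" using across[OF e(1,4) eF2 z'(1) xy(2) xy] .
    then have "e \<in> sep u y" using sep_iff[of e ?z y u] u ne by auto
    then have s: "sep u z \<subseteq> sep u y" using sep_endpoint[OF u(2) xV(2) _ e(3)] by blast
    have "?e \<notin> sep ?z z" using subtreeD(5)[OF W1(1) z'(1) e(2)] e'(2) by blast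
    then have "?e \<in> sep u z" using sep_iff[of ?e u z ?z] u sep_commute[of u ?z] by auto
    moreover have "?e \<in> sep ?z y" using across[OF e'_sep e'(2,3) z'(1) xy(2) gxy] .
    then have "?e \<notin> sep u y" using sep_iff[of ?e ?z y u] u by auto
    ultimately show False using s by blast
  qed
  then have "av g (src e) = src e" using src_ae[OF gG eE] by simp
  then show ?thesis using free g src_closed[OF eE] unfolding free_on_def by blast
qed

end

subsection \<open>Counting in the intersection of two subtrees\<close>

lemma finite_card_le_mult:
  assumes "finite B" "f ` A \<subseteq> B"
    and fib: "\<And>b. b \<in> B \<Longrightarrow> finite {a \<in> A. f a = b} \<and> card {a \<in> A. f a = b} \<le> m"
  shows "finite A \<and> card A \<le> m * card B"
proof -
  have A: "A = (\<Union>b\<in>B. {a \<in> A. f a = b})" using assms(2) by auto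
  have "finite (\<Union>b\<in>B. {a \<in> A. f a = b})" using assms(1) fib by auto
  moreover have "card (\<Union>b\<in>B. {a \<in> A. f a = b}) \<le> (\<Sum>b\<in>B. card {a \<in> A. f a = b})"
    by (rule card_UN_le[OF assms(1)])
  moreover have "\<dots> \<le> (\<Sum>b\<in>B. m)" by (rule sum_mono) (use fib in auto)
  ultimately show ?thesis using A by (simp add: mult.commute)
qed

text \<open>By symmetry p <= q. Then p (d - 2) <= (p - 2) d amounts to d <= p, and q <= 3 (q - 2)
  holds for q >= 3, with equality at 3. For q = 2 also p = 2, and d <= 2 makes the left side
  nonpositive. Equality occurs for d = p = q = 3, so 3 is the least possible constant.\<close>

lemma degree_inequality:
  fixes d p q :: int
  assumes "2 \<le> p" "2 \<le> q" "0 \<le> d" "d \<le> p" "d \<le> q"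
  shows "(d - 2) * (p * q) \<le> 3 * ((p - 2) * (q - 2)) * d"
proof -
  have *: "(d - 2) * (p * q) \<le> 3 * ((p - 2) * (q - 2)) * d"
    if le: "2 \<le> p" "p \<le> q" "d \<le> p" for p q :: int
  proof (cases "q = 2")
    case False
    have "p * (d - 2) \<le> (p - 2) * d" using le by (simp add: algebra_simps)
    then have "(p * (d - 2)) * q \<le> ((p - 2) * d) * q"
      using le by (intro mult_right_mono) auto
    also have "\<dots> \<le> ((p - 2) * d) * (3 * (q - 2))"
      using le False assms(3) by (intro mult_left_mono) auto
    finally show ?thesis by (simp add: algebra_simps)
  qed (use le assms(3) in auto)
  show ?thesis
    using *[of p q] *[of q p] assms by (cases "p \<le> q") (auto simp: mult.commute mult.left_commute)
qed

context tree_action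
begin

text \<open>The three differences are negated Euler characteristics of the quotient graphs. They are
  compared as integers, before ranks and their truncated subtraction enter.\<close>

lemma core_intersection:
  assumes H: "subgroup H G" "free_on H" and W1: "subtree W1 F1" "invariant H W1 F1"
    and fin1: "finite (orbs (G\<lparr>carrier := H\<rparr>) ae F1)"
    and deg1: "\<And>w. w \<in> W1 \<Longrightarrow> 2 \<le> card {e \<in> F1. incident e w}"
    and K: "subgroup K G" "free_on K" and W2: "subtree W2 F2" "invariant K W2 F2"
    and fin2: "finite (orbs (G\<lparr>carrier := K\<rparr>) ae F2)"
    and deg2: "\<And>w. w \<in> W2 \<Longrightarrow> 2 \<le> card {e \<in> F2. incident e w}"
    and stab: "\<And>e. e \<in> E \<Longrightarrow> finite {g \<in> H <#> K. ae g e = e} \<and> card {g \<in> H <#> K. ae g e = e} \<le> m"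
  shows "finite (orbs (G\<lparr>carrier := H \<inter> K\<rparr>) ae (F1 \<inter> F2))"
    "int (card (orbs (G\<lparr>carrier := H \<inter> K\<rparr>) ae (F1 \<inter> F2)))
      - int (card (orbs (G\<lparr>carrier := H \<inter> K\<rparr>) av (W1 \<inter> W2)))
     \<le> 6 * int m
      * ((int (card (orbs (G\<lparr>carrier := H\<rparr>) ae F1)) - int (card (orbs (G\<lparr>carrier := H\<rparr>) av W1)))
      * (int (card (orbs (G\<lparr>carrier := K\<rparr>) ae F2)) - int (card (orbs (G\<lparr>carrier := K\<rparr>) av W2))))"
proof -
  let ?H = "G\<lparr>carrier := H\<rparr>" and ?K = "G\<lparr>carrier := K\<rparr>" and ?L = "G\<lparr>carrier := H \<inter> K\<rparr>"
  let ?W = "W1 \<inter> W2" and ?F = "F1 \<inter> F2"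
  have L: "subgroup (H \<inter> K) G" "free_on (H \<inter> K)" "invariant (H \<inter> K) ?W ?F"
    using H K W1(2) W2(2) subgroups_Inter_pair by (auto simp: free_on_def invariant_def)
  have sub: "subtree ?W ?F" using subtree_Int W1(1) W2(1) by blast
  have HG: "h \<in> carrier G" if "h \<in> H" for h using subgroup.mem_carrier[OF H(1) that] .
  have KG: "k \<in> carrier G" if "k \<in> K" for k using subgroup.mem_carrier[OF K(1) that] .
  interpret TH: free_tree ?H W1 F1 src tgt av ae side
    by (rule free_tree_subtree[OF H(1) W1 H(2)])
  interpret TK: free_tree ?K W2 F2 src tgt av ae side
    by (rule free_tree_subtree[OF K(1) W2 K(2)])
  interpret TL: free_tree ?L ?W ?F src tgt av ae side
    by (rule free_tree_subtree[OF L(1) sub L(3) L(2)])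
  \<comment> \<open>Fix one representative \<open>e\<close> and write the others both as
    \<open>\<eta>\<close> e with \<open>\<eta>\<close> in \<open>H\<close> and as
    \<open>\<kappa>\<close> e with \<open>\<kappa>\<close> in \<open>K\<close>. Then
    \<open>inv \<eta> \<otimes> \<kappa>\<close> fixes \<open>e\<close> and lies in
    \<open>H <#> K\<close>. If it agrees for \<open>A\<close> and \<open>C\<close>, then
    \<open>\<eta> C \<otimes> inv (\<eta> A) = \<kappa> C \<otimes> inv (\<kappa> A)\<close> lies in
    both subgroups and carries one representative to the other.\<close>
  have fibre: "finite {A \<in> orbs ?L ae ?F. (orb ?H ae (rep A), orb ?K ae (rep A)) = MN} \<and>
      card {A \<in> orbs ?L ae ?F. (orb ?H ae (rep A), orb ?K ae (rep A)) = MN} \<le> m"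
    (is "finite ?S \<and> card ?S \<le> m") for MN
  proof (cases "?S = {}")
    case False
    then obtain A0 where A0: "A0 \<in> ?S" by blast
    define e where "e = rep A0"
    have e: "e \<in> ?F" using TL.E.rep_orb(1) A0 unfolding e_def by blast
    then have eE: "e \<in> E" using subtreeD(2)[OF W1(1)] by blast
    have ex: "\<exists>h\<in>H. rep A = ae h e" "\<exists>k\<in>K. rep A = ae k e" if A: "A \<in> ?S" for A
    proof -
      have "rep A \<in> ?F" using TL.E.rep_orb(1) A by blast
      moreover have "orb ?H ae e = orb ?H ae (rep A)" "orb ?K ae e = orb ?K ae (rep A)"
        using A A0 by (auto simp: e_def)
      ultimately show "\<exists>h\<in>H. rep A = ae h e" "\<exists>k\<in>K. rep A = ae k e"
        using TH.E.orb_eqD[of e "rep A"] TK.E.orb_eqD[of e "rep A"] e by auto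
    qed
    define \<eta> where "\<eta> A = (SOME h. h \<in> H \<and> rep A = ae h e)" for A
    define \<kappa> where "\<kappa> A = (SOME k. k \<in> K \<and> rep A = ae k e)" for A
    have \<eta>: "\<eta> A \<in> H \<and> rep A = ae (\<eta> A) e" and \<kappa>: "\<kappa> A \<in> K \<and> rep A = ae (\<kappa> A) e"
      if "A \<in> ?S" for A
      unfolding \<eta>_def \<kappa>_def by (rule someI_ex; use ex[OF that] in blast)+
    define f where "f A = inv (\<eta> A) \<otimes> \<kappa> A" for A
    have f_stab: "f ` ?S \<subseteq> {g \<in> H <#> K. ae g e = e}"
    proof
      fix g assume "g \<in> f ` ?S"
      then obtain A where A: "A \<in> ?S" "g = f A" by blast
      have "inv (\<eta> A) \<in> H" using \<eta>[OF A(1)] subgroup.m_inv_closed[OF H(1)] by blast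
      then have "g \<in> H <#> K" using \<kappa>[OF A(1)] A(2) unfolding f_def set_mult_def by blast
      moreover have "ae g e = ae (inv (\<eta> A)) (ae (\<eta> A) e)"
        using \<eta>[OF A(1)] \<kappa>[OF A(1)] A(2) HG KG eE by (simp add: f_def ae_mult)
      then have "ae g e = e" using \<eta>[OF A(1)] HG eE by (simp add: ae_mult[symmetric] ae_one)
      ultimately show "g \<in> {g \<in> H <#> K. ae g e = e}" by blast
    qed
    have f_inj: "inj_on f ?S"
    proof (rule inj_onI)
      fix A C assume A: "A \<in> ?S" and C: "C \<in> ?S" and eq: "f A = f C"
      have cl: "\<eta> A \<in> carrier G" "\<eta> C \<in> carrier G" "\<kappa> A \<in> carrier G" "\<kappa> C \<in> carrier G"
        using \<eta>[OF A] \<eta>[OF C] \<kappa>[OF A] \<kappa>[OF C] HG KG by auto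
      define l where "l = \<eta> C \<otimes> inv (\<eta> A)"
      have "l = \<eta> C \<otimes> f A \<otimes> inv (\<kappa> A)" using cl by (simp add: l_def f_def m_assoc)
      also have "\<dots> = \<kappa> C \<otimes> inv (\<kappa> A)" unfolding eq unfolding f_def using cl by (simp add: m_assoc[symmetric])
      finally have "l \<in> K"
        using \<kappa>[OF A] \<kappa>[OF C] subgroup.m_closed[OF K(1)] subgroup.m_inv_closed[OF K(1)] by simp
      moreover have "l \<in> H"
        using \<eta>[OF A] \<eta>[OF C] subgroup.m_closed[OF H(1)] subgroup.m_inv_closed[OF H(1)]
        by (simp add: l_def)
      moreover have "ae l (rep A) = rep C"
      proof -
        have "ae l (rep A) = ae (l \<otimes> \<eta> A) e" using \<eta>[OF A] cl eE by (simp add: l_def ae_mult)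
        also have "l \<otimes> \<eta> A = \<eta> C" using cl by (simp add: l_def m_assoc)
        finally show ?thesis using \<eta>[OF C] by simp
      qed
      moreover have AC: "A \<in> orbs ?L ae ?F" "C \<in> orbs ?L ae ?F" using A C by auto
      ultimately have "orb ?L ae (rep C) = orb ?L ae (rep A)"
        using TL.E.orb_act[of l "rep A"] TL.E.rep_orb(1)[OF AC(1)] by simp
      then show "A = C" using TL.E.rep_orb(2)[OF AC(1)] TL.E.rep_orb(2)[OF AC(2)] by simp
    qed
    have st: "finite {g \<in> H <#> K. ae g e = e}" "card {g \<in> H <#> K. ae g e = e} \<le> m"
      using stab[OF eE] by auto
    show ?thesis
      using inj_on_finite[OF f_inj f_stab st(1)] order_trans[OF card_inj_on_le[OF f_inj f_stab st(1)] st(2)]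
      by (rule conjI)
  next
    case True
    then show ?thesis by (simp only: finite.emptyI card.empty le0 simp_thms)
  qed
  have "finite (orbs ?L ae ?F) \<and> card (orbs ?L ae ?F) \<le> m * card (orbs ?H ae F1 \<times> orbs ?K ae F2)"
  proof (rule finite_card_le_mult[where f = "\<lambda>A. (orb ?H ae (rep A), orb ?K ae (rep A))"])
    show "finite (orbs ?H ae F1 \<times> orbs ?K ae F2)" using fin1 fin2 by simp
    show "(\<lambda>A. (orb ?H ae (rep A), orb ?K ae (rep A))) ` orbs ?L ae ?F \<subseteq> orbs ?H ae F1 \<times> orbs ?K ae F2"
      using TL.E.rep_orb(1) by (fastforce simp: orbs_def)
  qed (rule fibre)
  then show finL: "finite (orbs ?L ae ?F)" by blast
  note finV = TH.finite_vertex_orbits[OF fin1] TK.finite_vertex_orbits[OF fin2] TL.finite_vertex_orbits[OF finL]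
  define S where "S P Q = {C \<in> orbs ?L av ?W. orb ?H av (rep C) = P \<and> orb ?K av (rep C) = Q}" for P Q
  have S: "S P Q \<subseteq> orbs ?L av ?W" "finite (S P Q)" for P Q
    using finV(3) by (auto simp: S_def)
  \<comment> \<open>Half of the degree count, with \<open>\<pi>\<close> the source or the target
    map: edge orbits of the intersection over \<open>P\<close> and \<open>Q\<close> map at most
    \<open>m\<close> to one to pairs of edge orbits at \<open>P\<close> and at
    \<open>Q\<close>.\<close>
  have half: "(\<Sum>C\<in>S P Q. card {e \<in> ?F. \<pi> e = rep C}) \<le> m * (card {e \<in> F1. \<pi> e = rep P} * card {e \<in> F2. \<pi> e = rep Q})"
    if \<pi>: "equivariant_map ?H ae F1 av W1 \<pi>" "equivariant_map ?K ae F2 av W2 \<pi>" "equivariant_map ?L ae ?F av ?W \<pi>"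
      and PQ: "P \<in> orbs ?H av W1" "Q \<in> orbs ?K av W2" for \<pi> P Q
  proof -
    interpret pH: equivariant_map ?H ae F1 av W1 \<pi> by fact
    interpret pK: equivariant_map ?K ae F2 av W2 \<pi> by fact
    interpret pL: equivariant_map ?L ae ?F av ?W \<pi> by fact
    let ?X = "{e \<in> ?F. orb ?L av (\<pi> e) \<in> S P Q}"
    let ?BH = "{e \<in> F1. orb ?H av (\<pi> e) \<in> {P}}" and ?BK = "{e \<in> F2. orb ?K av (\<pi> e) \<in> {Q}}"
    interpret X: free_act ?L ae ?X
    proof (rule TL.E.free_act_subset)
      fix g e assume "g \<in> carrier ?L" "e \<in> ?X"
      then show "ae g e \<in> ?X"
        using pL.map_act[of g e] TL.V.orb_act[of g "\<pi> e"] TL.E.act_closed[of g e] pL.map_closed[of e] by auto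
    qed auto
    have X_B: "rep A \<in> ?BH" "rep A \<in> ?BK" if A: "A \<in> orbs ?L ae ?X" for A
    proof -
      have r: "rep A \<in> ?F" "orb ?L av (\<pi> (rep A)) \<in> S P Q" using X.rep_orb(1)[OF A] by auto
      define C where "C = orb ?L av (\<pi> (rep A))"
      have C: "C \<in> orbs ?L av ?W" "orb ?H av (rep C) = P" "orb ?K av (rep C) = Q"
        using r(2) by (auto simp: S_def C_def)
      obtain l where l: "l \<in> H \<inter> K" "\<pi> (rep A) = av l (rep C)"
        using TL.V.orb_eqD[of "rep C" "\<pi> (rep A)"] TL.V.rep_orb[OF C(1)] pL.map_closed[OF r(1)]
        by (auto simp: C_def)
      have "rep C \<in> W1" "rep C \<in> W2" using TL.V.rep_orb(1)[OF C(1)] by auto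
      then have "orb ?H av (\<pi> (rep A)) = P" "orb ?K av (\<pi> (rep A)) = Q"
        using TH.V.orb_act[of l "rep C"] TK.V.orb_act[of l "rep C"] l C(2,3) by auto
      then show "rep A \<in> ?BH" "rep A \<in> ?BK" using r(1) by auto
    qed
    have "(\<Sum>C\<in>S P Q. card {e \<in> ?F. \<pi> e = rep C}) = card (orbs ?L ae ?X)"
      by (rule pL.card_orbs_over[OF finL S(2,1), symmetric])
    also have "\<dots> \<le> m * card (orbs ?H ae ?BH \<times> orbs ?K ae ?BK)"
    proof (rule finite_card_le_mult[where f = "\<lambda>A. (orb ?H ae (rep A), orb ?K ae (rep A))", THEN conjunct2])
      have "finite (orbs ?H ae ?BH)" by (rule finite_subset[OF _ fin1]) (auto simp: orbs_def)
      moreover have "finite (orbs ?K ae ?BK)" by (rule finite_subset[OF _ fin2]) (auto simp: orbs_def)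
      ultimately show "finite (orbs ?H ae ?BH \<times> orbs ?K ae ?BK)" by simp
      show "(\<lambda>A. (orb ?H ae (rep A), orb ?K ae (rep A))) ` orbs ?L ae ?X
          \<subseteq> orbs ?H ae ?BH \<times> orbs ?K ae ?BK"
        using X_B by (auto simp: orbs_def)
      fix MN
      have "{A \<in> orbs ?L ae ?X. (orb ?H ae (rep A), orb ?K ae (rep A)) = MN}
          \<subseteq> {A \<in> orbs ?L ae ?F. (orb ?H ae (rep A), orb ?K ae (rep A)) = MN}"
        by (auto simp: orbs_def)
      then show "finite {A \<in> orbs ?L ae ?X. (orb ?H ae (rep A), orb ?K ae (rep A)) = MN} \<and>
          card {A \<in> orbs ?L ae ?X. (orb ?H ae (rep A), orb ?K ae (rep A)) = MN} \<le> m"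
        using fibre[of MN] finite_subset card_mono order_trans by meson
    qed
    also have "card (orbs ?H ae ?BH) = card {e \<in> F1. \<pi> e = rep P}"
      using pH.card_orbs_over[OF fin1, of "{P}"] PQ(1) by simp
    then have "card (orbs ?H ae ?BH \<times> orbs ?K ae ?BK) = card {e \<in> F1. \<pi> e = rep P} * card {e \<in> F2. \<pi> e = rep Q}"
      using pK.card_orbs_over[OF fin2, of "{Q}"] PQ(2) by (simp add: card_cartesian_product)
    finally show ?thesis .
  qed
  have local_bound: "(\<Sum>C\<in>S P Q. int (TL.degree (rep C)) - 2)
      \<le> 3 * int m * ((int (TH.degree (rep P)) - 2) * (int (TK.degree (rep Q)) - 2))"
    if PQ: "P \<in> orbs ?H av W1" "Q \<in> orbs ?K av W2" for P Q
  proof -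
    let ?p = "TH.degree (rep P)" and ?q = "TK.degree (rep Q)"
    have pq: "2 \<le> ?p" "2 \<le> ?q"
      using deg1[OF TH.V.rep_orb(1)[OF PQ(1)]] deg2[OF TK.V.rep_orb(1)[OF PQ(2)]]
      by (simp_all add: TH.degree_incident[OF fin1] TK.degree_incident[OF fin2])
    have le: "TL.degree (rep C) \<le> ?p" "TL.degree (rep C) \<le> ?q" if C: "C \<in> S P Q" for C
    proof -
      have r: "rep C \<in> W1" "rep C \<in> W2" "orb ?H av (rep C) = P" "orb ?K av (rep C) = Q"
        using C TL.V.rep_orb(1) by (auto simp: S_def)
      have "card {e \<in> ?F. src e = rep C} \<le> card {e \<in> F1. src e = rep C}"
        "card {e \<in> ?F. src e = rep C} \<le> card {e \<in> F2. src e = rep C}"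
        "card {e \<in> ?F. tgt e = rep C} \<le> card {e \<in> F1. tgt e = rep C}"
        "card {e \<in> ?F. tgt e = rep C} \<le> card {e \<in> F2. tgt e = rep C}"
        using TH.src.finite_fibre[OF fin1] TK.src.finite_fibre[OF fin2]
          TH.tgt.finite_fibre[OF fin1] TK.tgt.finite_fibre[OF fin2] by (auto intro!: card_mono)
      then have "TL.degree (rep C) \<le> TH.degree (rep C)" "TL.degree (rep C) \<le> TK.degree (rep C)"
        by (simp_all add: TL.degree_def TH.degree_def TK.degree_def)
      then show "TL.degree (rep C) \<le> ?p" "TL.degree (rep C) \<le> ?q"
        using TH.degree_rep[OF r(1)] TK.degree_rep[OF r(2)] r(3,4) by auto
    qed
    have "(\<Sum>C\<in>S P Q. TL.degree (rep C)) \<le> m * (?p * ?q)"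
    proof -
      have "(\<Sum>C\<in>S P Q. TL.degree (rep C))
          \<le> m * (card {e \<in> F1. src e = rep P} * card {e \<in> F2. src e = rep Q})
          + m * (card {e \<in> F1. tgt e = rep P} * card {e \<in> F2. tgt e = rep Q})"
        unfolding TL.degree_def sum.distrib
        by (rule add_mono; rule half)
          (use PQ TH.src.equivariant_map_axioms TK.src.equivariant_map_axioms TL.src.equivariant_map_axioms
            TH.tgt.equivariant_map_axioms TK.tgt.equivariant_map_axioms TL.tgt.equivariant_map_axioms in auto)
      \<comment> \<open>With out-degrees a, a' and in-degrees b, b' the two halves give m (a a' + b
        b'), at most m (a + b) (a' + b').\<close>
      also have "\<dots> \<le> m * (?p * ?q)"
        unfolding TH.degree_def TK.degree_def by (simp add: algebra_simps)
      finally show ?thesis .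
    qed
    then have sum: "(\<Sum>C\<in>S P Q. int (TL.degree (rep C))) \<le> int m * (int ?p * int ?q)"
      by (metis of_nat_le_iff of_nat_mult of_nat_sum)
    \<comment> \<open>The bound on the sum of degrees contributes the same factor as the
      multiplication does here; it is positive and is cancelled at the end.\<close>
    have "(\<Sum>C\<in>S P Q. int (TL.degree (rep C)) - 2) * (int ?p * int ?q)
        = (\<Sum>C\<in>S P Q. (int (TL.degree (rep C)) - 2) * (int ?p * int ?q))"
      by (rule sum_distrib_right)
    also have "\<dots> \<le> (\<Sum>C\<in>S P Q. 3 * ((int ?p - 2) * (int ?q - 2)) * int (TL.degree (rep C)))"
      by (rule sum_mono, rule degree_inequality) (use pq le in auto)
    also have "\<dots> = 3 * ((int ?p - 2) * (int ?q - 2)) * (\<Sum>C\<in>S P Q. int (TL.degree (rep C)))"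
      by (rule sum_distrib_left[symmetric])
    also have "\<dots> \<le> 3 * ((int ?p - 2) * (int ?q - 2)) * (int m * (int ?p * int ?q))"
      by (rule mult_left_mono[OF sum]) (use pq in auto)
    also have "\<dots> = 3 * int m * ((int ?p - 2) * (int ?q - 2)) * (int ?p * int ?q)" by simp
    finally show ?thesis
      by (rule mult_right_le_imp_le) (use pq in auto)
  qed
  let ?g = "\<lambda>C. (orb ?H av (rep C), orb ?K av (rep C))"
  let ?T = "orbs ?H av W1 \<times> orbs ?K av W2"
  have "?g ` orbs ?L av ?W \<subseteq> ?T" using TL.V.rep_orb(1) by (fastforce simp: orbs_def)
  then have "(\<Sum>C\<in>orbs ?L av ?W. int (TL.degree (rep C)) - 2)
      = (\<Sum>y\<in>?T. \<Sum>C\<in>{C \<in> orbs ?L av ?W. ?g C = y}. int (TL.degree (rep C)) - 2)"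
    using finV by (intro sum.group[symmetric]) auto
  also have "\<dots> \<le> (\<Sum>(P, Q)\<in>?T. 3 * int m * ((int (TH.degree (rep P)) - 2) * (int (TK.degree (rep Q)) - 2)))"
  proof (rule sum_mono, clarify)
    fix P Q assume PQ: "P \<in> orbs ?H av W1" "Q \<in> orbs ?K av W2"
    have "{C \<in> orbs ?L av ?W. ?g C = (P, Q)} = S P Q" by (auto simp: S_def)
    then show "(\<Sum>C\<in>{C \<in> orbs ?L av ?W. ?g C = (P, Q)}. int (TL.degree (rep C)) - 2)
        \<le> 3 * int m * ((int (TH.degree (rep P)) - 2) * (int (TK.degree (rep Q)) - 2))"
      using local_bound[OF PQ] by simp
  qed
  also have "\<dots> = 3 * int m * ((\<Sum>P\<in>orbs ?H av W1. int (TH.degree (rep P)) - 2)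
      * (\<Sum>Q\<in>orbs ?K av W2. int (TK.degree (rep Q)) - 2))"
    unfolding sum_product unfolding sum_distrib_left by (rule sum.cartesian_product[symmetric])
  finally have sum_le: "(\<Sum>C\<in>orbs ?L av ?W. int (TL.degree (rep C)) - 2)
      \<le> 3 * int m * ((\<Sum>P\<in>orbs ?H av W1. int (TH.degree (rep P)) - 2)
        * (\<Sum>Q\<in>orbs ?K av W2. int (TK.degree (rep Q)) - 2))" .
  \<comment> \<open>Each of the three sums is twice a difference of orbit numbers, so two factors 2
    on the right stand against one on the left.\<close>
  have halve: "l \<le> 6 * k * (a * b)" if "2 * l \<le> 3 * k * ((2 * a) * (2 * b))" for k l a b :: int
  proof -
    have "3 * k * ((2 * a) * (2 * b)) = 2 * (6 * k * (a * b))" by simp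
    then show ?thesis using that by linarith
  qed
  show "int (card (orbs ?L ae ?F)) - int (card (orbs ?L av ?W))
     \<le> 6 * int m * ((int (card (orbs ?H ae F1)) - int (card (orbs ?H av W1)))
      * (int (card (orbs ?K ae F2)) - int (card (orbs ?K av W2))))"
    using sum_le unfolding TH.euler_characteristic[OF finV(1) fin1]
      TK.euler_characteristic[OF finV(2) fin2] TL.euler_characteristic[OF finV(3) finL] by (rule halve)
qed

text \<open>A nontrivial element moves \<open>w\<close> to another vertex of the subtree, so some
  edge leaves \<open>w\<close>; exactly one is excluded by the absence of leaves.\<close>

lemma core_degree:
  assumes H: "subgroup H G" "free_on H" "H \<noteq> {\<one>}" and W: "subtree W F" "invariant H W F"
    and fin: "finite (orbs (G\<lparr>carrier := H\<rparr>) ae F)" and leaf: "\<And>d. {e \<in> F. incident e w} \<noteq> {d}"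
    and w: "w \<in> W"
  shows "2 \<le> card {e \<in> F. incident e w}"
proof -
  interpret H: free_tree "G\<lparr>carrier := H\<rparr>" W F src tgt av ae side
    by (rule free_tree_subtree[OF H(1) W H(2)])
  let ?I = "{e \<in> F. incident e w}"
  have "finite {e \<in> F. src e = w}" "finite {e \<in> F. tgt e = w}"
    using H.src.finite_fibre[OF fin] H.tgt.finite_fibre[OF fin] by auto
  moreover have "?I = {e \<in> F. src e = w} \<union> {e \<in> F. tgt e = w}" by (auto simp: incident_def)
  ultimately have finI: "finite ?I" by simp
  obtain h where h: "h \<in> H" "h \<noteq> \<one>" using H(1,3) subgroup.one_closed by blast
  have "av h w \<noteq> w" "av h w \<in> W"
    using h H(2) W(2) w subtreeD(1)[OF W(1)] unfolding free_on_def invariant_def by blast+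
  then have "?I \<noteq> {}" using H.first_edge[OF w, of "av h w"] unfolding incident_def by fastforce
  then have "card ?I \<noteq> 0" using finI by simp
  moreover have "card ?I \<noteq> 1" using leaf card_1_singletonE by metis
  ultimately show ?thesis by linarith
qed

theorem free_intersection_bound:
  assumes H: "fin_gen_subgroup H G" "free_on H" and K: "fin_gen_subgroup K G" "free_on K"
    and b: "b \<in> V"
    and stab: "\<And>e. e \<in> E \<Longrightarrow> finite {g \<in> H <#> K. ae g e = e} \<and> card {g \<in> H <#> K. ae g e = e} \<le> m"
  obtains X Y Z where "free_basis (G\<lparr>carrier := H\<rparr>) X" "finite X"
    "free_basis (G\<lparr>carrier := K\<rparr>) Y" "finite Y" "free_basis (G\<lparr>carrier := H \<inter> K\<rparr>) Z" "finite Z"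
    "card Z - 1 \<le> 6 * m * ((card X - 1) * (card Y - 1))"
proof -
  let ?H = "G\<lparr>carrier := H\<rparr>" and ?K = "G\<lparr>carrier := K\<rparr>" and ?L = "G\<lparr>carrier := H \<inter> K\<rparr>"
  have HK: "subgroup H G" "subgroup K G" using H K by (auto simp: fin_gen_subgroup_def)
  obtain W1 F1 where W1: "W1 \<noteq> {}" "subtree W1 F1" "invariant H W1 F1" "finite (orbs ?H ae F1)"
    "\<And>w d. w \<in> W1 \<Longrightarrow> {e \<in> F1. incident e w} \<noteq> {d}" using ex_core[OF H b] by blast
  obtain W2 F2 where W2: "W2 \<noteq> {}" "subtree W2 F2" "invariant K W2 F2" "finite (orbs ?K ae F2)"
    "\<And>w d. w \<in> W2 \<Longrightarrow> {e \<in> F2. incident e w} \<noteq> {d}" using ex_core[OF K b] by blast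
  interpret TH: free_tree ?H W1 F1 src tgt av ae side
    by (rule free_tree_subtree[OF HK(1) W1(2,3) H(2)])
  interpret TK: free_tree ?K W2 F2 src tgt av ae side
    by (rule free_tree_subtree[OF HK(2) W2(2,3) K(2)])
  have L: "subgroup (H \<inter> K) G" "free_on (H \<inter> K)" "invariant (H \<inter> K) W1 F1" "invariant (H \<inter> K) W2 F2"
    using H K HK W1(3) W2(3) subgroups_Inter_pair by (auto simp: free_on_def invariant_def)
  obtain X where X: "free_basis ?H X" "finite X"
    "int (card X) = int (card (orbs ?H ae F1)) - int (card (orbs ?H av W1)) + 1"
    using TH.ex_free_basis TH.finite_vertex_orbits[OF W1(4)] W1(1,4) by (metis ex_in_conv)
  obtain Y where Y: "free_basis ?K Y" "finite Y"
    "int (card Y) = int (card (orbs ?K ae F2)) - int (card (orbs ?K av W2)) + 1"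
    using TK.ex_free_basis TK.finite_vertex_orbits[OF W2(4)] W2(1,4) by (metis ex_in_conv)
  \<comment> \<open>A trivial intersection has the empty basis, and the truncated left side is 0.
    Nontriviality is what forces the two subtrees to meet and both cores to have degrees at least
    2.\<close>
  show ?thesis
  proof (cases "H \<inter> K = {\<one>}")
    case True
    have "reduced_words ({} :: 'a set) = {[]}" by (auto simp: reduced_words_def)
    moreover have "word_value ?L [] = \<one>" by (simp add: word_value_def)
    ultimately have "free_basis ?L {}" using True by (simp add: free_basis_def bij_betw_def)
    then show ?thesis using that[OF X(1,2) Y(1,2), of "{}"] by simp
  next
    case False
    then have ne: "H \<noteq> {\<one>}" "K \<noteq> {\<one>}" using HK subgroup.one_closed by blast+
    have "W1 \<inter> W2 \<noteq> {}"
    proof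
      assume "W1 \<inter> W2 = {}"
      then have "H \<inter> K \<subseteq> {\<one>}"
        using disjoint_subtrees_fixed[OF L(1,2) W1(2) L(3) W1(1) W2(2) L(4) W2(1)] by blast
      then show False using False subgroup.one_closed[OF L(1)] by blast
    qed
    then obtain c where c: "c \<in> W1 \<inter> W2" by blast
    interpret TL: free_tree ?L "W1 \<inter> W2" "F1 \<inter> F2" src tgt av ae side
      by (rule free_tree_subtree[OF L(1) subtree_Int[OF W1(2) W2(2)] _ L(2)])
        (use L(3,4) in \<open>auto simp: invariant_def\<close>)
    note deg1 = core_degree[OF HK(1) H(2) ne(1) W1(2,3,4) W1(5)]
      and deg2 = core_degree[OF HK(2) K(2) ne(2) W2(2,3,4) W2(5)]
    note bound = core_intersection[OF HK(1) H(2) W1(2,3,4) deg1 HK(2) K(2) W2(2,3,4) deg2 stab]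
    obtain Z where Z: "free_basis ?L Z" "finite Z"
      "int (card Z) = int (card (orbs ?L ae (F1 \<inter> F2))) - int (card (orbs ?L av (W1 \<inter> W2))) + 1"
      using TL.ex_free_basis[OF c] TL.finite_vertex_orbits bound(1) by metis
    \<comment> \<open>Degrees at least 2 make the difference of orbit numbers nonnegative, so
      \<open>X\<close> is nonempty and the truncated \<open>card X - 1\<close> is exact.\<close>
    have "0 \<le> (\<Sum>A\<in>orbs ?H av W1. int (TH.degree (rep A)) - 2)"
      using deg1 TH.V.rep_orb(1) TH.degree_incident[OF W1(4)]
      by (intro sum_nonneg) simp
    then have x: "int (card X - 1) = int (card (orbs ?H ae F1)) - int (card (orbs ?H av W1))"
      using TH.euler_characteristic TH.finite_vertex_orbits[OF W1(4)] W1(4) X(3) by simp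
    have "0 \<le> (\<Sum>A\<in>orbs ?K av W2. int (TK.degree (rep A)) - 2)"
      using deg2 TK.V.rep_orb(1) TK.degree_incident[OF W2(4)]
      by (intro sum_nonneg) simp
    then have y: "int (card Y - 1) = int (card (orbs ?K ae F2)) - int (card (orbs ?K av W2))"
      using TK.euler_characteristic TK.finite_vertex_orbits[OF W2(4)] W2(4) Y(3) by simp
    have "int (card Z) - 1 \<le> int (6 * m * ((card X - 1) * (card Y - 1)))"
      using bound(2) Z(3) unfolding x[symmetric] y[symmetric] by simp
    then have "card Z - 1 \<le> 6 * m * ((card X - 1) * (card Y - 1))" by linarith
    then show ?thesis using that X Y Z by blast
  qed
qed

end

subsection \<open>The Bass-Serre tree of an HNN-extension\<close>

context hnn_extension
begin

section \<open>Evaluating words in the group\<close>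

primrec letter_value :: "'a hnn_letter \<Rightarrow> 'a" where
  "letter_value (Base b) = b"
| "letter_value Stable = t"
| "letter_value Stable_inv = inv t"

definition hnn_value :: "'a hnn_letter list \<Rightarrow> 'a" where
  "hnn_value w = foldr (\<lambda>l g. letter_value l \<otimes> g) w \<one>"

abbreviation "base_words \<equiv> hnn_words (G\<lparr>carrier := B\<rparr>)"
abbreviation "cong \<equiv> hnn_cong (G\<lparr>carrier := B\<rparr>) A\<^sub>1 \<phi>"
abbreviation "cls \<equiv> hnn_class (G\<lparr>carrier := B\<rparr>) A\<^sub>1 \<phi>"
abbreviation "PG \<equiv> hnn_group (G\<lparr>carrier := B\<rparr>) A\<^sub>1 \<phi>"

lemma B_carrier: "b \<in> B \<Longrightarrow> b \<in> carrier G"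
  using subgroup.mem_carrier[OF base_subgroup] .

lemma A_carrier: "a \<in> A\<^sub>1 \<Longrightarrow> a \<in> carrier G" "A\<^sub>1 \<subseteq> carrier G" "B \<subseteq> carrier G"
  using assoc_subgroups(2) B_carrier by auto

lemma \<phi>_B: "a \<in> A\<^sub>1 \<Longrightarrow> \<phi> a \<in> B"
  using assoc_iso assoc_subgroups(4) by (auto simp: iso_def hom_def)

lemma letter_value_closed: "l \<in> Base ` B \<union> {Stable, Stable_inv} \<Longrightarrow> letter_value l \<in> carrier G"
  using B_carrier stable_closed by auto

lemma base_words_iff: "w \<in> base_words \<longleftrightarrow> set w \<subseteq> Base ` B \<union> {Stable, Stable_inv}"
  by (auto simp: hnn_words_def)

lemma base_words_append: "u @ v \<in> base_words \<longleftrightarrow> u \<in> base_words \<and> v \<in> base_words"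
  by (simp add: base_words_iff)

lemma hnn_value_simps [simp]:
  "hnn_value [] = \<one>" "hnn_value (l # w) = letter_value l \<otimes> hnn_value w"
  by (simp_all add: hnn_value_def)

lemma hnn_value_closed: "w \<in> base_words \<Longrightarrow> hnn_value w \<in> carrier G"
proof (induction w)
  case (Cons l w)
  then show ?case using letter_value_closed[of l] by (simp add: base_words_iff)
qed simp

lemma hnn_value_append:
  "\<lbrakk>u \<in> base_words; v \<in> base_words\<rbrakk> \<Longrightarrow> hnn_value (u @ v) = hnn_value u \<otimes> hnn_value v"
proof (induction u)
  case Nil
  then show ?case using hnn_value_closed by simp
next
  case (Cons l u)
  have "u \<in> base_words" "letter_value l \<in> carrier G"
    using Cons.prems(1) letter_value_closed[of l] by (auto simp: base_words_iff)
  then show ?case using Cons hnn_value_closed by (simp add: m_assoc)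
qed

lemma cong_words: "cong u v \<Longrightarrow> u \<in> base_words \<and> v \<in> base_words"
proof (induction rule: hnn_cong.induct)
  case (base_mult x y)
  then show ?case using subgroup.m_closed[OF base_subgroup] by (simp add: base_words_iff)
next
  case base_one
  then show ?case using subgroup.one_closed[OF base_subgroup] by (simp add: base_words_iff)
next
  case (conj a)
  then show ?case using assoc_subgroups(2) \<phi>_B by (auto simp: base_words_iff)
qed (auto simp: base_words_iff)

lemma cls_eq: "cong u v \<Longrightarrow> cls u = cls v"
  unfolding hnn_class_def using hnn_cong.sym hnn_cong.trans by blast

lemma cls_eqD: "\<lbrakk>v \<in> base_words; cls u = cls v\<rbrakk> \<Longrightarrow> cong u v"
  unfolding hnn_class_def using hnn_cong.refl by blast

lemma cls_mult:
  assumes "u \<in> base_words" "v \<in> base_words"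
  shows "cls u \<otimes>\<^bsub>PG\<^esub> cls v = cls (u @ v)"
proof -
  have "cls (x @ y) = cls (u @ v)" if "x \<in> cls u" "y \<in> cls v" for x y
    using that cls_eq[OF hnn_cong.append] by (metis hnn_class_def mem_Collect_eq)
  moreover have "u \<in> cls u" "v \<in> cls v"
    using assms hnn_cong.refl by (auto simp: hnn_class_def)
  ultimately have "(\<Union>x\<in>cls u. \<Union>y\<in>cls v. cls (x @ y)) = cls (u @ v)" by blast
  then show ?thesis by (simp add: hnn_group_def)
qed

text \<open>The isomorphism is forced to be evaluation of words: it is given on base letters and on
  the stable letter, and a relation determines it on the inverse letter.\<close>

lemma presentation_map:
  obtains \<psi> where "inj_on \<psi> (cls ` base_words)" "\<psi> ` cls ` base_words = carrier G"
    "\<And>w. w \<in> base_words \<Longrightarrow> \<psi> (cls w) = hnn_value w"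
proof -
  obtain \<psi> where \<psi>: "\<psi> \<in> iso PG G" "\<And>b. b \<in> B \<Longrightarrow> \<psi> (cls [Base b]) = b" "\<psi> (cls [Stable]) = t"
    using presented by blast
  have car: "carrier PG = cls ` base_words" by (simp add: hnn_group_def)
  have bij: "inj_on \<psi> (cls ` base_words)" "\<psi> ` cls ` base_words = carrier G"
    using \<psi>(1) by (auto simp: iso_def bij_betw_def car)
  have mult: "\<psi> (cls (u @ v)) = \<psi> (cls u) \<otimes> \<psi> (cls v)" if "u \<in> base_words" "v \<in> base_words" for u v
  proof -
    have "\<psi> \<in> hom PG G" using \<psi>(1) by (simp add: iso_def)
    then have "\<psi> (cls u \<otimes>\<^bsub>PG\<^esub> cls v) = \<psi> (cls u) \<otimes> \<psi> (cls v)"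
      by (rule hom_mult) (use that car in auto)
    then show ?thesis using cls_mult[OF that] by simp
  qed
  have cl: "\<psi> (cls u) \<in> carrier G" if "u \<in> base_words" for u using bij(2) that by blast
  have nil: "\<psi> (cls []) = \<one>"
  proof -
    have "cls [Base \<one>] = cls []" using cls_eq[OF hnn_cong.base_one] by simp
    then show ?thesis using \<psi>(2)[of \<one>] subgroup.one_closed[OF base_subgroup] by simp
  qed
  have sinv: "\<psi> (cls [Stable_inv]) = inv t"
  proof -
    have w: "[Stable] \<in> base_words" "[Stable_inv] \<in> base_words" by (auto simp: base_words_iff)
    have "\<psi> (cls [Stable_inv]) \<otimes> \<psi> (cls [Stable]) = \<one>"
      using mult[OF w(2,1)] cls_eq[OF hnn_cong.stable_left_inv] nil by simp
    then show ?thesis using \<psi>(3) cl[OF w(2)] stable_closed inv_equality by simp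
  qed
  have "\<psi> (cls w) = hnn_value w" if "w \<in> base_words" for w
    using that
  proof (induction w)
    case (Cons l w)
    then have l: "[l] \<in> base_words" "w \<in> base_words" by (auto simp: base_words_iff)
    have "\<psi> (cls [l]) = letter_value l"
      using Cons.prems \<psi>(2,3) sinv by (cases l) (auto simp: base_words_iff)
    then show ?case using mult[OF l] Cons.IH[OF l(2)] by simp
  qed (simp add: nil)
  then show ?thesis using that bij by blast
qed

text \<open>By injectivity of the isomorphism, a function of words that respects the congruence
  descends to the group. Together with \<open>hnn_value_surj\<close> this is the form in which the
  presentation is used.\<close>

lemma hnn_value_eq_iff: "\<lbrakk>u \<in> base_words; v \<in> base_words\<rbrakk> \<Longrightarrow> hnn_value u = hnn_value v \<longleftrightarrow> cong u v"
proof -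
  assume w: "u \<in> base_words" "v \<in> base_words"
  obtain \<psi> where \<psi>: "inj_on \<psi> (cls ` base_words)" "\<And>w. w \<in> base_words \<Longrightarrow> \<psi> (cls w) = hnn_value w"
    by (rule presentation_map, rule that)
  have "hnn_value u = hnn_value v \<longleftrightarrow> cls u = cls v"
    using inj_on_eq_iff[OF \<psi>(1), of "cls u" "cls v"] \<psi>(2) w by simp
  then show ?thesis using cls_eq cls_eqD[OF w(2)] by metis
qed

lemma hnn_value_surj:
  assumes "g \<in> carrier G" shows "\<exists>w\<in>base_words. hnn_value w = g"
proof -
  obtain \<psi> where \<psi>: "\<psi> ` cls ` base_words = carrier G" "\<And>w. w \<in> base_words \<Longrightarrow> \<psi> (cls w) = hnn_value w"
    by (rule presentation_map, rule that)
  have "g \<in> \<psi> ` cls ` base_words" using \<psi>(1) assms by simp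
  then show ?thesis using \<psi>(2) by auto
qed

lemma \<phi>_conj: "a \<in> A\<^sub>1 \<Longrightarrow> a \<otimes> t = t \<otimes> \<phi> a"
proof -
  assume a: "a \<in> A\<^sub>1"
  have c: "cong [Stable_inv, Base a, Stable] [Base (\<phi> a)]" using a by (rule hnn_cong.conj)
  have cl: "a \<in> carrier G" "\<phi> a \<in> carrier G" using A_carrier a \<phi>_B B_carrier by auto
  have "hnn_value [Stable_inv, Base a, Stable] = hnn_value [Base (\<phi> a)]"
    using hnn_value_eq_iff[THEN iffD2, OF _ _ c] cong_words[OF c] by blast
  then have "inv t \<otimes> (a \<otimes> t) = \<phi> a" using cl stable_closed by simp
  then show ?thesis using cl stable_closed by (metis inv_solve_left m_closed)
qed

text \<open>The crossing numbers modulo two with the edges \<open>gA\<^sub>1\<close> of the path spelled by a word. They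
  define the derivation from \<open>G\<close> to functions on \<open>G/A\<^sub>1\<close> that vanishes on \<open>B\<close> and maps \<open>t\<close> to the
  indicator of \<open>A\<^sub>1\<close>; it exists because this assignment respects the relations, so no normal form
  theorem is needed.\<close>

fun crosses :: "'a hnn_letter list \<Rightarrow> 'a set \<Rightarrow> bool" where
  "crosses [] X \<longleftrightarrow> False"
| "crosses (Base b # w) X \<longleftrightarrow> crosses w (inv b <# X)"
| "crosses (Stable # w) X \<longleftrightarrow> (X = A\<^sub>1) \<noteq> crosses w (inv t <# X)"
| "crosses (Stable_inv # w) X \<longleftrightarrow> (t <# X = A\<^sub>1) \<noteq> crosses w (t <# X)"

lemma l_coset_inv:
  assumes "g \<in> carrier G" "X \<subseteq> carrier G"
  shows "g <# (inv g <# X) = X" "inv g <# (g <# X) = X"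
  using assms by (simp_all add: lcos_m_assoc lcos_mult_one)

text \<open>The cocycle rule: the path spelled by \<open>v\<close> starts where \<open>u\<close>
  ends, so its crossings are translated by the value of \<open>u\<close>.\<close>

lemma crosses_append:
  assumes "u \<in> base_words" "v \<in> base_words" "X \<subseteq> carrier G"
  shows "crosses (u @ v) X \<longleftrightarrow> crosses u X \<noteq> crosses v (inv (hnn_value u) <# X)"
  using assms(1,3)
proof (induction u arbitrary: X)
  case Nil
  then show ?case by (simp add: lcos_mult_one)
next
  case (Cons l u)
  have u: "u \<in> base_words" "letter_value l \<in> carrier G" "hnn_value u \<in> carrier G"
    using Cons.prems(1) letter_value_closed[of l] hnn_value_closed by (auto simp: base_words_iff)
  have X: "inv (letter_value l) <# X \<subseteq> carrier G"
    using l_coset_subset_G[OF Cons.prems(2)] u(2) by simp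
  have "inv (hnn_value (l # u)) <# X = inv (hnn_value u) <# (inv (letter_value l) <# X)"
    using u Cons.prems(2) by (simp add: lcos_m_assoc inv_mult_group)
  then show ?case
    using Cons.IH[OF u(1) X] stable_closed by (cases l) auto
qed

lemma coset_eq_A:
  assumes "a \<in> A\<^sub>1" "X \<subseteq> carrier G"
  shows "inv a <# X = A\<^sub>1 \<longleftrightarrow> X = A\<^sub>1"
proof -
  have id: "b <# A\<^sub>1 = A\<^sub>1" if "b \<in> A\<^sub>1" for b
    using that l_repr_independence[of b \<one> A\<^sub>1] assoc_subgroups(1) A_carrier lcos_mult_one by simp
  show ?thesis
    using id[OF assms(1)] id[of "inv a"] l_coset_inv(1)[of a X] assms A_carrier(1)
      subgroup.m_inv_closed[OF assoc_subgroups(1)] by metis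
qed

text \<open>Each relation preserves the parities. On the left of the conjugation relation both
  stable letters cross the edge \<open>inv t <# A\<^sub>1\<close>, because \<open>a\<close> fixes
  the coset \<open>A\<^sub>1\<close>; base letters cross nothing. In a concatenation, congruent
  prefixes have equal values and so translate alike.\<close>

lemma cong_crosses:
  assumes "cong u v" "X \<subseteq> carrier G"
  shows "crosses u X \<longleftrightarrow> crosses v X"
  using assms
proof (induction arbitrary: X rule: hnn_cong.induct)
  case stable_right_inv
  then show ?case using stable_closed by (simp add: l_coset_inv)
next
  case (conj a)
  then show ?case using stable_closed coset_eq_A[of a "t <# X"] l_coset_subset_G by simp
next
  case (append u u' v v')
  have w: "u \<in> base_words" "u' \<in> base_words" "v \<in> base_words" "v' \<in> base_words"
    using cong_words append.hyps by blast+
  have "hnn_value u = hnn_value u'" using hnn_value_eq_iff w append.hyps(1) by blast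
  moreover have "inv (hnn_value u') <# X \<subseteq> carrier G"
    using l_coset_subset_G append.prems hnn_value_closed[OF w(2)] by simp
  ultimately show ?case using append.IH append.prems w by (simp add: crosses_append)
qed auto

lemma finite_crosses: "w \<in> base_words \<Longrightarrow> finite {X. X \<subseteq> carrier G \<and> crosses w X}"
proof (induction w)
  case (Cons l w)
  let ?f = "\<lambda>X. letter_value l <# X"
  have l: "w \<in> base_words" "letter_value l \<in> carrier G"
    using Cons.prems letter_value_closed[of l] by (auto simp: base_words_iff)
  have "{X. X \<subseteq> carrier G \<and> crosses (l # w) X}
      \<subseteq> ?f ` {X. X \<subseteq> carrier G \<and> crosses w X} \<union> {A\<^sub>1, inv t <# A\<^sub>1}"
  proof
    fix X assume "X \<in> {X. X \<subseteq> carrier G \<and> crosses (l # w) X}"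
    then have X: "X \<subseteq> carrier G" "crosses (l # w) X" by auto
    let ?Y = "inv (letter_value l) <# X"
    have Y: "?Y \<subseteq> carrier G" "X = ?f ?Y"
      using l_coset_subset_G[OF X(1)] l(2) l_coset_inv(1)[OF l(2) X(1)] by auto
    have "crosses w ?Y \<or> X = A\<^sub>1 \<or> t <# X = A\<^sub>1"
      using X(2) stable_closed by (cases l) auto
    moreover have "X = inv t <# A\<^sub>1" if "t <# X = A\<^sub>1"
      using l_coset_inv(2)[OF stable_closed X(1)] that by simp
    ultimately show "X \<in> ?f ` {X. X \<subseteq> carrier G \<and> crosses w X} \<union> {A\<^sub>1, inv t <# A\<^sub>1}"
      using Y by blast
  qed
  then show ?case by (rule finite_subset) (simp add: Cons.IH[OF l(1)])
qed simp

definition derivation :: "'a \<Rightarrow> 'a set \<Rightarrow> bool" where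
  "derivation g = crosses (SOME w. w \<in> base_words \<and> hnn_value w = g)"

lemma derivation_value:
  assumes "w \<in> base_words" "X \<subseteq> carrier G"
  shows "derivation (hnn_value w) X \<longleftrightarrow> crosses w X"
proof -
  define u where "u = (SOME u. u \<in> base_words \<and> hnn_value u = hnn_value w)"
  have "u \<in> base_words \<and> hnn_value u = hnn_value w"
    unfolding u_def by (rule someI_ex) (use assms(1) in blast)
  then have "cong u w" using hnn_value_eq_iff assms(1) by blast
  then show ?thesis using cong_crosses[OF _ assms(2)] by (simp add: derivation_def u_def)
qed

lemma derivation_mult:
  assumes "g \<in> carrier G" "h \<in> carrier G" "X \<subseteq> carrier G"
  shows "derivation (g \<otimes> h) X \<longleftrightarrow> derivation g X \<noteq> derivation h (inv g <# X)"
proof -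
  obtain u w where u: "u \<in> base_words" "hnn_value u = g" "w \<in> base_words" "hnn_value w = h"
    using hnn_value_surj assms(1,2) by blast
  have "inv g <# X \<subseteq> carrier G" using l_coset_subset_G assms by simp
  then show ?thesis
    using derivation_value[OF _ assms(3), of "u @ w"] derivation_value[OF u(1) assms(3)]
      derivation_value[OF u(3), of "inv g <# X"] crosses_append[OF u(1,3) assms(3)]
      hnn_value_append[OF u(1,3)] u base_words_append by simp
qed

lemma derivation_base: "\<lbrakk>b \<in> B; X \<subseteq> carrier G\<rbrakk> \<Longrightarrow> \<not> derivation b X"
  using derivation_value[of "[Base b]" X] B_carrier by (auto simp: base_words_iff)

lemma derivation_stable: "X \<subseteq> carrier G \<Longrightarrow> derivation t X \<longleftrightarrow> X = A\<^sub>1"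
  using derivation_value[of "[Stable]" X] stable_closed by (auto simp: base_words_iff)

lemma finite_derivation: "g \<in> carrier G \<Longrightarrow> finite {X. X \<subseteq> carrier G \<and> derivation g X}"
proof -
  assume "g \<in> carrier G"
  then obtain w where w: "w \<in> base_words" "hnn_value w = g" using hnn_value_surj by blast
  then have "{X. X \<subseteq> carrier G \<and> derivation g X} = {X. X \<subseteq> carrier G \<and> crosses w X}"
    using derivation_value by blast
  then show ?thesis using finite_crosses[OF w(1)] by simp
qed

section \<open>The tree of cosets\<close>

definition vertices :: "'a set set" where "vertices = (\<lambda>g. g <# B) ` carrier G"
definition edges :: "'a set set" where "edges = (\<lambda>g. g <# A\<^sub>1) ` carrier G"
text \<open>Set products give the ends \<open>g <# B\<close> and \<open>(g \<otimes> t) <# B\<close>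
  of the edge \<open>g <# A\<^sub>1\<close> without choosing \<open>g\<close>: \<open>B\<close>
  absorbs \<open>A\<^sub>1\<close> on its left, and so does \<open>t <# B\<close>, by the defining
  relation.\<close>

definition source :: "'a set \<Rightarrow> 'a set" where "source X = X <#> B"
definition target :: "'a set \<Rightarrow> 'a set" where "target X = X <#> (t <# B)"
text \<open>The choice of a representative is harmless since the derivation vanishes on
  \<open>B\<close>.\<close>

definition edge_side :: "'a set \<Rightarrow> 'a set \<Rightarrow> bool" where
  "edge_side e v = derivation (SOME g. g \<in> carrier G \<and> g <# B = v) e"

lemma edges_subset: "e \<in> edges \<Longrightarrow> e \<subseteq> carrier G"
  using l_coset_subset_G A_carrier by (auto simp: edges_def)

lemma vertices_subset: "v \<in> vertices \<Longrightarrow> v \<subseteq> carrier G"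
  using l_coset_subset_G A_carrier by (auto simp: vertices_def)

lemma source_coset: "g \<in> carrier G \<Longrightarrow> source (g <# A\<^sub>1) = g <# B"
proof -
  have "A\<^sub>1 <#> B = B"
  proof (intro subset_antisym subsetI)
    fix x assume "x \<in> A\<^sub>1 <#> B"
    then show "x \<in> B"
      using assoc_subgroups(2) subgroup.m_closed[OF base_subgroup] by (auto simp: set_mult_def)
  next
    fix x assume x: "x \<in> B"
    then have "x = \<one> \<otimes> x" using B_carrier by simp
    then show "x \<in> A\<^sub>1 <#> B" using x subgroup.one_closed[OF assoc_subgroups(1)] unfolding set_mult_def by blast
  qed
  moreover assume "g \<in> carrier G"
  ultimately show ?thesis unfolding source_def using setmult_lcos_assoc A_carrier by simp
qed

lemma target_coset: "g \<in> carrier G \<Longrightarrow> target (g <# A\<^sub>1) = (g \<otimes> t) <# B"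
proof -
  have tB: "t <# B \<subseteq> carrier G" using l_coset_subset_G A_carrier stable_closed by simp
  have "A\<^sub>1 <#> (t <# B) = t <# B"
  proof (intro subset_antisym subsetI)
    fix x assume "x \<in> A\<^sub>1 <#> (t <# B)"
    then obtain a b where ab: "a \<in> A\<^sub>1" "b \<in> B" "x = a \<otimes> (t \<otimes> b)" by (auto simp: set_mult_def l_coset_def)
    then have "x = t \<otimes> (\<phi> a \<otimes> b)"
      using \<phi>_conj[OF ab(1)] A_carrier(1) B_carrier \<phi>_B stable_closed by (simp add: m_assoc[symmetric])
    moreover have "\<phi> a \<otimes> b \<in> B" using ab \<phi>_B subgroup.m_closed[OF base_subgroup] by simp
    ultimately show "x \<in> t <# B" by (auto simp: l_coset_def)
  next
    fix x assume x: "x \<in> t <# B"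
    then have "x = \<one> \<otimes> x" using tB by auto
    then show "x \<in> A\<^sub>1 <#> (t <# B)" using x subgroup.one_closed[OF assoc_subgroups(1)] unfolding set_mult_def by blast
  qed
  moreover assume "g \<in> carrier G"
  ultimately show ?thesis
    unfolding target_def using setmult_lcos_assoc[OF A_carrier(2) tB] A_carrier lcos_m_assoc stable_closed by simp
qed

lemma coset_eqD:
  assumes "subgroup C G" "g \<in> carrier G" "h \<in> carrier G" "g <# C = h <# C"
  shows "\<exists>c\<in>C. h = g \<otimes> c"
proof -
  have "h = h \<otimes> \<one>" using assms(3) by simp
  then have "h \<in> h <# C" using subgroup.one_closed[OF assms(1)] unfolding l_coset_def by blast
  then have "h \<in> g <# C" using assms(4) by simp
  then show ?thesis by (auto simp: l_coset_def)
qed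

lemma edge_side_coset:
  assumes g: "g \<in> carrier G" and e: "e \<in> edges"
  shows "edge_side e (g <# B) \<longleftrightarrow> derivation g e"
proof -
  define h where "h = (SOME h. h \<in> carrier G \<and> h <# B = g <# B)"
  have h: "h \<in> carrier G \<and> h <# B = g <# B"
    unfolding h_def by (rule someI_ex) (use g in blast)
  then obtain b where b: "b \<in> B" "h = g \<otimes> b" using coset_eqD[OF base_subgroup g] by metis
  have "\<not> derivation b (inv g <# e)"
    using derivation_base[OF b(1)] l_coset_subset_G[OF edges_subset[OF e]] g by simp
  then show ?thesis
    using derivation_mult[OF g B_carrier[OF b(1)] edges_subset[OF e]] b(2)
    by (simp add: edge_side_def h_def)
qed

text \<open>The cocycle rule reduces the comparison of \<open>g\<close> with
  \<open>g \<otimes> t\<close> to the derivation of \<open>t\<close> at the translated edge, which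
  is the indicator of \<open>A\<^sub>1\<close>.\<close>

lemma edge_side_crossing:
  assumes g: "g \<in> carrier G" and f: "f \<in> edges"
  shows "edge_side f (source (g <# A\<^sub>1)) \<noteq> edge_side f (target (g <# A\<^sub>1)) \<longleftrightarrow> f = g <# A\<^sub>1"
proof -
  have "edge_side f (source (g <# A\<^sub>1)) \<noteq> edge_side f (target (g <# A\<^sub>1)) \<longleftrightarrow> derivation t (inv g <# f)"
    using g f stable_closed edges_subset[OF f]
    by (auto simp: source_coset target_coset edge_side_coset derivation_mult)
  also have "\<dots> \<longleftrightarrow> inv g <# f = A\<^sub>1"
    using derivation_stable l_coset_subset_G[OF edges_subset[OF f]] g by simp
  also have "\<dots> \<longleftrightarrow> f = g <# A\<^sub>1"
    using l_coset_inv[OF g] edges_subset[OF f] A_carrier(2) by metis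
  finally show ?thesis .
qed

definition step :: "'a set \<Rightarrow> 'a set \<Rightarrow> 'a set \<Rightarrow> bool" where
  "step v e u \<longleftrightarrow> e \<in> edges \<and> (source e = v \<and> target e = u \<or> source e = u \<and> target e = v)"

text \<open>Connectedness of the coset graph: a base letter stays in the coset of \<open>B\<close>,
  and a stable letter crosses one edge.\<close>

lemma ex_walk:
  assumes "w \<in> base_words" "g \<in> carrier G"
  shows "\<exists>es. walk step (g <# B) es ((g \<otimes> hnn_value w) <# B)"
  using assms
proof (induction w arbitrary: g)
  case Nil
  then show ?case by (intro exI[of _ "[]"]) simp
next
  case (Cons l w)
  have l: "w \<in> base_words" "letter_value l \<in> carrier G" "hnn_value w \<in> carrier G"
    using Cons.prems(1) letter_value_closed[of l] hnn_value_closed by (auto simp: base_words_iff)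
  have gl: "g \<otimes> letter_value l \<in> carrier G" using l Cons.prems(2) by simp
  obtain es where es: "walk step ((g \<otimes> letter_value l) <# B) es ((g \<otimes> hnn_value (l # w)) <# B)"
    using Cons.IH[OF l(1) gl] l Cons.prems(2) by (auto simp: m_assoc)
  consider b where "l = Base b" "b \<in> B" | "l = Stable" | "l = Stable_inv"
    using Cons.prems(1) by (auto simp: base_words_iff)
  then show ?case
  proof cases
    case 1
    have "g \<otimes> b \<in> g <# B" using 1(2) by (auto simp: l_coset_def)
    then have "g <# B = (g \<otimes> letter_value l) <# B"
      using l_repr_independence[OF _ Cons.prems(2) base_subgroup] 1(1) by simp
    then show ?thesis using es by auto
  next
    case 2
    have "step (g <# B) (g <# A\<^sub>1) ((g \<otimes> letter_value l) <# B)"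
      using Cons.prems(2) 2 by (auto simp: step_def edges_def source_coset target_coset)
    then show ?thesis using es by (intro exI[of _ "(g <# A\<^sub>1) # es"]) auto
  next
    case 3
    have "step (g <# B) ((g \<otimes> inv t) <# A\<^sub>1) ((g \<otimes> letter_value l) <# B)"
      using Cons.prems(2) 3 stable_closed
      by (auto simp: step_def edges_def source_coset target_coset m_assoc)
    then show ?thesis using es by (intro exI[of _ "((g \<otimes> inv t) <# A\<^sub>1) # es"]) auto
  qed
qed

sublocale bass_serre: tree_action G vertices edges source target
  "\<lambda>g v. g <# v" "\<lambda>g e. g <# e" edge_side
proof
  fix e assume "e \<in> edges"
  then show "source e \<in> vertices" "target e \<in> vertices"
    using stable_closed by (auto simp: edges_def vertices_def source_coset target_coset)
next
  fix g v assume "g \<in> carrier G" "v \<in> vertices"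
  then show "g <# v \<in> vertices" using A_carrier(3) by (auto simp: vertices_def lcos_m_assoc)
next
  fix g v assume "g \<in> carrier G" "v \<in> edges"
  then show "g <# v \<in> edges" using A_carrier(2) by (auto simp: edges_def lcos_m_assoc)
next
  fix g e assume "g \<in> carrier G" "e \<in> edges"
  then show "source (g <# e) = g <# source e" "target (g <# e) = g <# target e"
    using stable_closed A_carrier(2,3)
    by (auto simp: edges_def lcos_m_assoc source_coset target_coset m_assoc)
next
  fix e f assume "e \<in> edges" "f \<in> edges"
  then show "(edge_side f (source e) \<noteq> edge_side f (target e)) = (f = e)"
    using edge_side_crossing by (auto simp: edges_def)
next
  fix v w assume "v \<in> vertices" "w \<in> vertices"
  then obtain g h where g: "g \<in> carrier G" "v = g <# B" "h \<in> carrier G" "w = h <# B"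
    by (auto simp: vertices_def)
  have "{e \<in> edges. edge_side e v \<noteq> edge_side e w}
      \<subseteq> {X. X \<subseteq> carrier G \<and> derivation g X} \<union> {X. X \<subseteq> carrier G \<and> derivation h X}"
    using g edge_side_coset edges_subset by auto
  then show "finite {e \<in> edges. edge_side e v \<noteq> edge_side e w}"
    by (rule finite_subset) (simp add: finite_derivation g)
next
  fix g e v w assume *: "g \<in> carrier G" "e \<in> edges" "v \<in> vertices" "w \<in> vertices"
  have e: "g <# e \<in> edges" "e \<subseteq> carrier G" "g <# e \<subseteq> carrier G" "inv g <# (g <# e) = e"
    using *(1,2) A_carrier(2) edges_subset l_coset_subset_G l_coset_inv(2)
    by (auto simp: edges_def lcos_m_assoc)
  \<comment> \<open>Sides are invariant only up to the term \<open>derivation g (g <# e)\<close>. It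
    does not depend on the vertex and cancels when two vertices are compared.\<close>
  have "edge_side (g <# e) (g <# u) \<longleftrightarrow> derivation g (g <# e) \<noteq> edge_side e u" if "u \<in> vertices" for u
  proof -
    obtain h where h: "h \<in> carrier G" "u = h <# B" using \<open>u \<in> vertices\<close> by (auto simp: vertices_def)
    then have "g <# u = (g \<otimes> h) <# B" using *(1) A_carrier(3) by (simp add: lcos_m_assoc)
    then show ?thesis
      using edge_side_coset[of "g \<otimes> h" "g <# e"] edge_side_coset[of h e] derivation_mult[OF *(1) h(1) e(3)]
        h *(1,2) e by simp
  qed
  then show "(edge_side (g <# e) (g <# v) \<noteq> edge_side (g <# e) (g <# w)) = (edge_side e v \<noteq> edge_side e w)"
    using * by auto
next
  fix v w assume *: "v \<in> vertices" "w \<in> vertices" "v \<noteq> w"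
  then obtain g h where g: "g \<in> carrier G" "v = g <# B" "h \<in> carrier G" "w = h <# B"
    by (auto simp: vertices_def)
  obtain u where u: "u \<in> base_words" "hnn_value u = inv g \<otimes> h"
    using hnn_value_surj[of "inv g \<otimes> h"] g by auto
  have "g \<otimes> (inv g \<otimes> h) = h" using g by (simp add: m_assoc[symmetric])
  then obtain es where es: "walk step v es w" using ex_walk[OF u(1) g(1)] u(2) g by auto
  \<comment> \<open>The walk lemma quantifies over arbitrary sets in place of edges, while sides are
    controlled on edges only; hence the mask.\<close>
  define \<delta> where "\<delta> v e \<longleftrightarrow> e \<in> edges \<and> edge_side e v" for v e
  have "\<exists>e u. step v e u \<and> \<delta> v e \<noteq> \<delta> w e"
  proof (rule walk_first_edge[where st = step, OF _ _ es *(3)])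
    fix x e y f assume s: "step x e y"
    then obtain k where "k \<in> carrier G" "e = k <# A\<^sub>1" by (auto simp: step_def edges_def)
    then show "(\<delta> x f \<noteq> \<delta> y f) = (f = e)"
      using s edge_side_crossing[of k f] by (auto simp: step_def \<delta>_def)
  next
    fix x e y x' y' assume "step x e y" "step x' e y'"
    then show "x = x' \<or> x = y'" by (auto simp: step_def)
  qed
  then show "\<exists>e\<in>edges. edge_side e v \<noteq> edge_side e w \<and> (source e = v \<or> target e = v)"
    by (auto simp: step_def \<delta>_def)
qed (use vertices_subset edges_subset in \<open>auto simp: lcos_mult_one lcos_m_assoc\<close>)

text \<open>The stabilizer of \<open>g <# B\<close> is the conjugate of \<open>B\<close> by
  \<open>inv g\<close> in the convention of \<open>conjugate_set\<close>.\<close>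

lemma free_on_vertices:
  assumes "subgroup H G" "\<forall>g\<in>carrier G. H \<inter> conjugate_set G g B = {\<one>}"
  shows "bass_serre.free_on H"
  unfolding bass_serre.free_on_def
proof (intro ballI impI)
  fix h v assume h: "h \<in> H" and v: "v \<in> vertices" and hv: "h <# v = v"
  have hG: "h \<in> carrier G" using subgroup.mem_carrier[OF assms(1) h] .
  obtain g where g: "g \<in> carrier G" "v = g <# B" using v by (auto simp: vertices_def)
  then have "g <# B = (h \<otimes> g) <# B" using hv hG A_carrier(3) by (simp add: lcos_m_assoc)
  then obtain b where b: "b \<in> B" "h \<otimes> g = g \<otimes> b" using coset_eqD[OF base_subgroup g(1)] hG g(1) by blast
  then have "h = inv (inv g) \<otimes> b \<otimes> inv g"
    using hG g(1) B_carrier by (metis inv_closed inv_inv inv_solve_right' m_closed)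
  then have "h \<in> H \<inter> conjugate_set G (inv g) B" using h b(1) by (auto simp: conjugate_set_def)
  then show "h = \<one>" using assms(2) g(1) by auto
qed

text \<open>An element fixing \<open>g <# A\<^sub>1\<close> sends \<open>g\<close> to some
  \<open>g \<otimes> a\<close>. This is where the conjugates of \<open>A\<^sub>1\<close> in the
  definition of \<open>m\<close> come from.\<close>

lemma edge_stabilizer:
  assumes "P \<subseteq> carrier G" "e \<in> edges"
  shows "\<exists>g\<in>carrier G. {x \<in> P. x <# e = e} \<subseteq> conjugate_set G g A\<^sub>1 \<inter> P"
proof -
  obtain g where g: "g \<in> carrier G" "e = g <# A\<^sub>1" using assms(2) by (auto simp: edges_def)
  have "x \<in> conjugate_set G (inv g) A\<^sub>1" if x: "x \<in> P" "x <# e = e" for x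
  proof -
    have xG: "x \<in> carrier G" using x assms(1) by blast
    have "g <# A\<^sub>1 = (x \<otimes> g) <# A\<^sub>1" using x(2) g xG A_carrier(2) by (simp add: lcos_m_assoc)
    then obtain a where a: "a \<in> A\<^sub>1" "x \<otimes> g = g \<otimes> a"
      using coset_eqD[OF assoc_subgroups(1) g(1)] xG g(1) by blast
    then have "x = inv (inv g) \<otimes> a \<otimes> inv g"
      using xG g(1) A_carrier(1) by (metis inv_closed inv_inv inv_solve_right' m_closed)
    then show ?thesis using a(1) by (auto simp: conjugate_set_def)
  qed
  then show ?thesis using g(1) by (intro bexI[of _ "inv g"]) auto
qed

end

theorem corollary2:
  fixes G :: "('a, 'b) monoid_scheme" and B A\<^sub>1 A\<^sub>2 H K :: "'a set"
    and \<phi> :: "'a \<Rightarrow> 'a" and t :: 'a and m :: nat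
  assumes "hnn_extension G B A\<^sub>1 A\<^sub>2 \<phi> t"
    and "finite A\<^sub>1" "finite A\<^sub>2"
    and "fin_gen_subgroup H G" "fin_gen_subgroup K G"
    and "\<forall>g\<in>carrier G. H \<inter> conjugate_set G g B = {\<one>\<^bsub>G\<^esub>}"
    and "\<forall>g\<in>carrier G. K \<inter> conjugate_set G g B = {\<one>\<^bsub>G\<^esub>}"
    and "m = Max ((\<lambda>g. card (conjugate_set G g A\<^sub>1 \<inter> (H <#>\<^bsub>G\<^esub> K))) ` carrier G)"
  shows "free_group (G\<lparr>carrier := H\<rparr>) \<and> free_group (G\<lparr>carrier := K\<rparr>) \<and>
         reduced_rank (G\<lparr>carrier := H \<inter> K\<rparr>)
           \<le> 6 * enat m * (reduced_rank (G\<lparr>carrier := H\<rparr>) * reduced_rank (G\<lparr>carrier := K\<rparr>)) \<and>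
         reduced_rank (G\<lparr>carrier := H \<inter> K\<rparr>)
           \<le> 6 * enat (card A\<^sub>1) * (reduced_rank (G\<lparr>carrier := H\<rparr>) * reduced_rank (G\<lparr>carrier := K\<rparr>))"
proof -
  interpret hnn_extension G B A\<^sub>1 A\<^sub>2 \<phi> t by fact
  let ?c = "\<lambda>g. card (conjugate_set G g A\<^sub>1 \<inter> (H <#>\<^bsub>G\<^esub> K))"
  have sub: "subgroup H G" "subgroup K G" using assms(4,5) by (auto simp: fin_gen_subgroup_def)
  have fin: "finite (conjugate_set G g A\<^sub>1)" for g using assms(2) by (simp add: conjugate_set_def)
  have c_le: "?c g \<le> card A\<^sub>1" for g
  proof -
    have "?c g \<le> card (conjugate_set G g A\<^sub>1)" using fin by (intro card_mono) auto
    then show ?thesis using card_image_le[OF assms(2)] le_trans unfolding conjugate_set_def by blast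
  qed
  \<comment> \<open>The group may be infinite, but the values are bounded by
    \<open>card A\<^sub>1\<close>; so \<open>Max\<close> is taken over a finite set and is
    attained.\<close>
  have "?c ` carrier G \<subseteq> {..card A\<^sub>1}" by (rule image_subsetI) (simp add: c_le)
  then have fin_c: "finite (?c ` carrier G)" by (rule finite_subset) simp
  have c_m: "?c g \<le> m" if "g \<in> carrier G" for g
    unfolding assms(8) by (rule Max_ge[OF fin_c]) (rule imageI[OF that])
  have "?c ` carrier G \<noteq> {}" by blast
  then have "m \<in> ?c ` carrier G" unfolding assms(8) by (rule Max_in[OF fin_c])
  then have m_le: "m \<le> card A\<^sub>1" using c_le by blast
  have HK: "H <#>\<^bsub>G\<^esub> K \<subseteq> carrier G"
    using set_mult_closed subgroup.subset[OF sub(1)] subgroup.subset[OF sub(2)] by blast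
  have stab: "finite {x \<in> H <#>\<^bsub>G\<^esub> K. x <#\<^bsub>G\<^esub> e = e} \<and> card {x \<in> H <#>\<^bsub>G\<^esub> K. x <#\<^bsub>G\<^esub> e = e} \<le> m"
    if "e \<in> edges" for e
  proof -
    obtain g where g: "g \<in> carrier G"
      "{x \<in> H <#>\<^bsub>G\<^esub> K. x <#\<^bsub>G\<^esub> e = e} \<subseteq> conjugate_set G g A\<^sub>1 \<inter> (H <#>\<^bsub>G\<^esub> K)"
      using edge_stabilizer[OF HK \<open>e \<in> edges\<close>] by blast
    have f: "finite (conjugate_set G g A\<^sub>1 \<inter> (H <#>\<^bsub>G\<^esub> K))" using fin by simp
    show ?thesis
      using finite_subset[OF g(2) f] le_trans[OF card_mono[OF f g(2)] c_m[OF g(1)]] by (rule conjI)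
  qed
  have b: "\<one>\<^bsub>G\<^esub> <#\<^bsub>G\<^esub> B \<in> vertices" by (auto simp: vertices_def)
  obtain X Y Z where X: "free_basis (G\<lparr>carrier := H\<rparr>) X" "finite X"
    and Y: "free_basis (G\<lparr>carrier := K\<rparr>) Y" "finite Y"
    and Z: "free_basis (G\<lparr>carrier := H \<inter> K\<rparr>) Z" "finite Z"
    and bound: "card Z - 1 \<le> 6 * m * ((card X - 1) * (card Y - 1))"
    by (rule bass_serre.free_intersection_bound[OF assms(4) free_on_vertices[OF sub(1) assms(6)]
        assms(5) free_on_vertices[OF sub(2) assms(7)] b stab], assumption, rule that)
  have grp: "group (G\<lparr>carrier := H\<rparr>)" "group (G\<lparr>carrier := K\<rparr>)" "group (G\<lparr>carrier := H \<inter> K\<rparr>)"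
    using sub subgroups_Inter_pair subgroup.subgroup_is_group is_group by blast+
  have rank: "reduced_rank (G\<lparr>carrier := H\<rparr>) = enat (card X - 1)"
    "reduced_rank (G\<lparr>carrier := K\<rparr>) = enat (card Y - 1)"
    "reduced_rank (G\<lparr>carrier := H \<inter> K\<rparr>) = enat (card Z - 1)"
    using group.reduced_rank_eq grp X Y Z by blast+
  have "6 * m * ((card X - 1) * (card Y - 1)) \<le> 6 * card A\<^sub>1 * ((card X - 1) * (card Y - 1))"
    using m_le by simp
  then have "card Z - 1 \<le> 6 * card A\<^sub>1 * ((card X - 1) * (card Y - 1))" using bound by linarith
  moreover have "6 * enat k * (enat x * enat y) = enat (6 * k * (x * y))" for k x y
    by (simp add: numeral_eq_enat)
  ultimately show ?thesis
    using bound grp X(1) Y(1) unfolding rank free_group_def by auto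
qed

end
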